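(* Let $\pi_{L,N}$ be the canonical stationary measures with weights $w_L$ satisfying the standing assumptions in the context, and suppose $\kappa+2>\max\{\gamma,1\}$. Consider the thermodynamic limit $L,N=N_L\to\infty$ with $N/L\to\rho$, where $\rho>\rho_c$. Set $$C_L=\left(\frac{(\rho-\rho_c)L^\gamma}{\theta\,\Gamma(\kappa+2)}\right)^{1/(\kappa+2)} ,$$ so that $C_L\ll L$, i.e. $C_L/L\to0$. Let $\tilde\eta$ be a size-biased configuration under $\pi_{L,N}$. Then $$\tilde\eta_1/C_L\overset{d}{\longrightarrow}\begin{cases}0&\text{with probability }\rho_c/\rho,\\ Z&\text{with probability }(\rho-\rho_c)/\rho,\end{cases}$$ where $Z\sim\Gamma(\kappa+2,1)$ (Gamma distribution with density $s^{\kappa+1}e^{-s}/\Gamma(\kappa+2)$ on $(0,\infty)$); that is, the limit law is the mixture $\frac{\rho_c}{\rho}\delta_0+\frac{\rho-\rho_c}{\rho}\Gamma(\kappa+2,1)$. Additionally, for any fixed $m\in\mathbb{N}$, $(\tilde\eta_1/C_L,\dots,\tilde\eta_m/C_L)$ converges in distribution to a vector of $m$ i.i.d. random variables with this mixture as marginal law.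
   Context: Setting. For each $L$, $\Lambda=\Lambda_L$ is a finite index set with $|\Lambda|=L$, identified with $\{1,\dots,L\}$; configurations are $\eta=(\eta_x)_{x\in\Lambda}\in\mathbb{N}_0^\Lambda$, and $E_{L,N}=\{\eta\in\mathbb{N}_0^\Lambda:\sum_{x\in\Lambda}\eta_x=N\}$. The canonical measure on $E_{L,N}$ is $$\pi_{L,N}[\eta]=\frac{1}{Z_{L,N}}\prod_{x\in\Lambda}w_L(\eta_x),\qquad Z_{L,N}=\sum_{\eta\in E_{L,N}}\prod_{x\in\Lambda}w_L(\eta_x).$$ Standing assumptions on the weights. The $w_L$ are strictly positive and of the form $$w_L(n)=w(n)+\frac{\theta}{L^\gamma}(n+1)^\kappa\big(1+\delta_L(n)\big),\qquad n\in\mathbb{N}_0,$$ with constants $\theta>0$, $\gamma>0$, $\kappa>-1$, where $L\sup_{n\le N}|\delta_L(n)|\to0$ in the thermodynamic limit. The bulk weights $w:\mathbb{N}_0\to[0,\infty)$ satisfy: there is $\bar\phi\in(1,\infty]$ such that $z(\phi):=\sum_{n\ge0}w(n)\phi^n<\infty$ (for $\phi\ge 0$) if and only if $\phi\in[0,\bar\phi)$; $\sum_{n\ge0}w(n)=1$; and $\rho_c:=\sum_{n\ge0}n\,w(n)<\infty$. Put $R(\phi):=\frac{1}{z(\phi)}\sum_{n\ge0}n\,w(n)\phi^n$; it is continuous and increasing with $R(0)=0$, $R(1)=\rho_c$, and for every $\rho\ge0$ there is $\phi\in[0,\bar\phi)$ with $R(\phi)=\rho$. Size-biased configuration. Given $\eta\in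 E_{L,N}$ distributed according to $\pi_{L,N}$, define a random permutation $\sigma:\Lambda\to\Lambda$ recursively: $\sigma(1)=x$ with probability $\eta_x/N$ for $x\in\Lambda$, and $$\sigma(k+1)=x\ \text{ with probability }\ \frac{\eta_x}{N-(\eta_{\sigma(1)}+\dots+\eta_{\sigma(k)})},\qquad x\in\Lambda\setminus\{\sigma(1),\dots,\sigma(k)\}$$ (once all remaining sites are empty, the remaining order is arbitrary). The size-biased configuration is $\tilde\eta=(\tilde\eta_k)_{k=1}^L$ with $\tilde\eta_k=\eta_{\sigma(k)}$. *)

theory Defs
  imports "HOL-Probability.Probability"
begin

definition weighted_pmf :: "'a set \<Rightarrow> ('a \<Rightarrow> real) \<Rightarrow> 'a pmf" where
  "weighted_pmf S f = embed_pmf (\<lambda>x. if x \<in> S then f x / sum f S else 0)"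

lemma pmf_weighted_pmf:
  assumes "finite S" and nonneg: "\<And>x. x \<in> S \<Longrightarrow> f x \<ge> 0" and pos: "sum f S > 0"
  shows "pmf (weighted_pmf S f) x = (if x \<in> S then f x / sum f S else 0)"
  unfolding weighted_pmf_def
proof (rule pmf_embed_pmf)
  show "0 \<le> (if y \<in> S then f y / sum f S else 0)" for y
    using assms by simp
  have "(\<integral>\<^sup>+y. ennreal (if y \<in> S then f y / sum f S else 0) \<partial>count_space UNIV)
      = (\<integral>\<^sup>+y. ennreal (f y / sum f S) * indicator S y \<partial>count_space UNIV)"
    by (intro nn_integral_cong) (auto split: split_indicator)
  also have "\<dots> = (\<integral>\<^sup>+y. ennreal (f y / sum f S) \<partial>count_space S)"
    by (simp add: nn_integral_count_space_indicator)
  also have "\<dots> = (\<Sum>y\<in>S. ennreal (f y / sum f S))"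
    using \<open>finite S\<close> by (simp add: nn_integral_count_space_finite)
  also have "\<dots> = ennreal (\<Sum>y\<in>S. f y / sum f S)"
    using nonneg pos by (intro sum_ennreal) simp
  also have "(\<Sum>y\<in>S. f y / sum f S) = 1"
    using pos by (simp add: sum_divide_distrib [symmetric])
  finally show "(\<integral>\<^sup>+y. ennreal (if y \<in> S then f y / sum f S else 0) \<partial>count_space UNIV) = 1"
    by simp
qed

definition configs :: "nat \<Rightarrow> nat \<Rightarrow> (nat \<Rightarrow> nat) set" where
  "configs L N = {\<eta> \<in> {1..L} \<rightarrow>\<^sub>E UNIV. (\<Sum>x\<in>{1..L}. \<eta> x) = N}"

definition canonical_pmf :: "(nat \<Rightarrow> real) \<Rightarrow> nat \<Rightarrow> nat \<Rightarrow> (nat \<Rightarrow> nat) pmf" where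
  "canonical_pmf v L N = weighted_pmf (configs L N) (\<lambda>\<eta>. \<Prod>x\<in>{1..L}. v (\<eta> x))"

lemma finite_configs: "finite (configs L N)"
proof (rule finite_subset)
  show "configs L N \<subseteq> {1..L} \<rightarrow>\<^sub>E {..N}"
  proof
    fix \<eta> assume \<eta>: "\<eta> \<in> configs L N"
    then have "\<eta> x \<le> N" if "x \<in> {1..L}" for x
      using that member_le_sum [of x "{1..L}" \<eta>] by (auto simp: configs_def)
    then show "\<eta> \<in> {1..L} \<rightarrow>\<^sub>E {..N}"
      using \<eta> by (auto simp: configs_def PiE_iff)
  qed
qed (simp add: finite_PiE)

lemma configs_nonempty:
  assumes "L \<ge> 1" shows "configs L N \<noteq> {}"
proof -
  have "(\<lambda>x\<in>{1..L}. if x = 1 then N else 0) \<in> configs L N"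
    using assms by (auto simp: configs_def)
  then show ?thesis by blast
qed

lemma pmf_canonical_pmf:
  assumes "L \<ge> 1" "\<And>n. v n > 0"
  shows "pmf (canonical_pmf v L N) \<eta> =
    (if \<eta> \<in> configs L N
     then (\<Prod>x\<in>{1..L}. v (\<eta> x)) / (\<Sum>\<zeta>\<in>configs L N. \<Prod>x\<in>{1..L}. v (\<zeta> x)) else 0)"
  unfolding canonical_pmf_def
  using assms configs_nonempty [of L N]
  by (intro pmf_weighted_pmf finite_configs sum_pos prod_nonneg prod_pos) (auto intro: less_imp_le)

(* The list xs = [sigma(1), ..., sigma(k)] records the sites chosen so far.  Once all remaining sites
   are empty, the next one is drawn from t xs, where t is an arbitrary rule. *)
definition next_site ::
    "(nat list \<Rightarrow> nat pmf) \<Rightarrow> nat \<Rightarrow> (nat \<Rightarrow> nat) \<Rightarrow> nat list \<Rightarrow> nat pmf" where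
  "next_site t L \<eta> xs =
     (if \<forall>x \<in> {1..L} - set xs. \<eta> x = 0 then t xs
      else weighted_pmf ({1..L} - set xs) (\<lambda>x. real (\<eta> x)))"

lemma pmf_next_site:
  assumes "\<eta> \<in> configs L N" "distinct xs" "set xs \<subseteq> {1..L}" "(\<Sum>y\<leftarrow>xs. \<eta> y) < N"
    and x: "x \<in> {1..L} - set xs"
  shows "pmf (next_site t L \<eta> xs) x = real (\<eta> x) / (real N - real (\<Sum>y\<leftarrow>xs. \<eta> y))"
proof -
  have N: "N = sum \<eta> ({1..L} - set xs) + (\<Sum>y\<leftarrow>xs. \<eta> y)"
    using assms sum.subset_diff [of "set xs" "{1..L}" \<eta>]
    by (auto simp: configs_def sum_list_distinct_conv_sum_set)
  then have *: "(\<Sum>y\<in>{1..L} - set xs. real (\<eta> y)) = real N - real (\<Sum>y\<leftarrow>xs. \<eta> y)"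
    by simp
  have "\<not> (\<forall>x \<in> {1..L} - set xs. \<eta> x = 0)"
    using N assms(4) by (metis add_0 less_irrefl sum.neutral)
  then have "pmf (next_site t L \<eta> xs) x
      = real (\<eta> x) / (\<Sum>y\<in>{1..L} - set xs. real (\<eta> y))"
    unfolding next_site_def
    using * assms(4) x
    by (simp only: if_False, subst pmf_weighted_pmf) auto
  then show ?thesis by (simp only: *)
qed

primrec size_biased_sites ::
    "(nat list \<Rightarrow> nat pmf) \<Rightarrow> nat \<Rightarrow> (nat \<Rightarrow> nat) \<Rightarrow> nat \<Rightarrow> nat list pmf" where
  "size_biased_sites t L \<eta> 0 = return_pmf []"
| "size_biased_sites t L \<eta> (Suc k) =
     bind_pmf (size_biased_sites t L \<eta> k)
       (\<lambda>xs. map_pmf (\<lambda>x. xs @ [x]) (next_site t L \<eta> xs))"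

definition admissible_rule :: "nat \<Rightarrow> (nat list \<Rightarrow> nat pmf) \<Rightarrow> bool" where
  "admissible_rule L t \<longleftrightarrow> (\<forall>xs. set xs \<subset> {1..L} \<longrightarrow> set_pmf (t xs) \<subseteq> {1..L} - set xs)"

lemma admissible_rule_uniform: "admissible_rule L (\<lambda>xs. pmf_of_set ({1..L} - set xs))"
  unfolding admissible_rule_def
proof (intro allI impI)
  fix xs assume "set xs \<subset> {1..L}"
  then have "{1..L} - set xs \<noteq> {}" by blast
  then show "set_pmf (pmf_of_set ({1..L} - set xs)) \<subseteq> {1..L} - set xs"
    by (subst set_pmf_of_set) auto
qed

lemma size_biased_sites_permutation:
  assumes "admissible_rule L t" "k \<le> L" "xs \<in> set_pmf (size_biased_sites t L \<eta> k)"
  shows "length xs = k \<and> distinct xs \<and> set xs \<subseteq> {1..L}"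
  using assms(2,3)
proof (induction k arbitrary: xs)
  case (Suc k)
  then obtain ys x where ys: "ys \<in> set_pmf (size_biased_sites t L \<eta> k)"
    and x: "x \<in> set_pmf (next_site t L \<eta> ys)" and xs: "xs = ys @ [x]"
    by auto
  have IH: "length ys = k" "distinct ys" "set ys \<subseteq> {1..L}"
    using Suc.IH [OF _ ys] Suc.prems by auto
  have "card (set ys) = k"
    using IH by (simp add: distinct_card)
  then have sub: "set ys \<subset> {1..L}"
    using IH Suc.prems by (metis psubsetI card_atLeastAtMost diff_Suc_1 not_less_eq_eq le_refl)
  have "x \<in> {1..L} - set ys"
  proof (cases "\<forall>x \<in> {1..L} - set ys. \<eta> x = 0")
    case True
    then have "x \<in> set_pmf (t ys)"
      using x by (simp add: next_site_def)
    then show ?thesis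
      using sub assms(1) unfolding admissible_rule_def by blast
  next
    case False
    then have "(\<Sum>y\<in>{1..L} - set ys. real (\<eta> y)) > 0"
      by (auto intro!: sum_pos2)
    with x False show ?thesis
      by (auto simp: next_site_def set_pmf_iff pmf_weighted_pmf split: if_splits)
  qed
  with IH xs show ?case by auto
qed simp

(* The joint law of the size-biased configuration as a list of length L; the k-th entry
   of the configuration, for k = 1, ..., L, is the list element with index k - 1. *)
definition size_biased_pmf ::
    "((nat \<Rightarrow> nat) \<Rightarrow> nat list \<Rightarrow> nat pmf) \<Rightarrow> (nat \<Rightarrow> real) \<Rightarrow> nat \<Rightarrow> nat \<Rightarrow> nat list pmf" where
  "size_biased_pmf t v L N =
     bind_pmf (canonical_pmf v L N)
       (\<lambda>\<eta>. map_pmf (map \<eta>) (size_biased_sites (t \<eta>) L \<eta> L))"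

definition cluster_scale :: "real \<Rightarrow> real \<Rightarrow> real \<Rightarrow> real \<Rightarrow> real \<Rightarrow> nat \<Rightarrow> real" where
  "cluster_scale \<theta> \<gamma> \<kappa> \<rho> \<rho>c L =
     ((\<rho> - \<rho>c) * real L powr \<gamma> / (\<theta> * Gamma (\<kappa> + 2))) powr (1 / (\<kappa> + 2))"

definition gamma_measure :: "real \<Rightarrow> real measure" where
  "gamma_measure a =
     density lborel (\<lambda>s. ennreal (if s > 0 then s powr (a - 1) * exp (- s) / Gamma a else 0))"

lemma prob_space_gamma_measure:
  assumes "a > 0" shows "prob_space (gamma_measure a)"
proof
  let ?f = "\<lambda>s::real. s powr (a - 1) / exp s"
  have hi: "(?f has_integral Gamma a) {0..}"
    using Gamma_integral_real [OF assms] .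
  have "emeasure (gamma_measure a) (space (gamma_measure a))
      = (\<integral>\<^sup>+s. ennreal (if s > 0 then s powr (a - 1) * exp (- s) / Gamma a else 0) \<partial>lborel)"
    by (simp add: gamma_measure_def emeasure_density)
  also have "\<dots> = (\<integral>\<^sup>+s. ennreal (?f s / Gamma a * indicator {0..} s) \<partial>lborel)"
    by (intro nn_integral_cong) (auto simp: exp_minus field_simps split: split_indicator)
  also have "\<dots> = (\<integral>\<^sup>+s. ennreal (?f s / Gamma a) * indicator {0..} s \<partial>lborel)"
    by (intro nn_integral_cong) (auto split: split_indicator)
  also have "\<dots> = ennreal (Gamma a / Gamma a)"
    using assms has_integral_divide [OF hi, of "Gamma a"] Gamma_real_pos [OF assms]
    by (intro nn_integral_has_integral_lebesgue') auto
  also have "\<dots> = 1"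
    using Gamma_real_pos [OF assms] by simp
  finally show "emeasure (gamma_measure a) (space (gamma_measure a)) = 1" .
qed

(* The mixture (1 - p) delta_0 + p Gamma(a, 1), realised as a two-stage experiment. *)
definition zero_gamma_mixture :: "real \<Rightarrow> real \<Rightarrow> real measure" where
  "zero_gamma_mixture p a =
     measure_pmf (bernoulli_pmf p) \<bind> (\<lambda>b. if b then gamma_measure a else return borel 0)"

lemma emeasure_zero_gamma_mixture:
  assumes "a > 0" "0 \<le> p" "p \<le> 1" "A \<in> sets borel"
  shows "emeasure (zero_gamma_mixture p a) A =
    ennreal (1 - p) * indicator A 0 + ennreal p * emeasure (gamma_measure a) A"
proof -
  have 1: "gamma_measure a \<in> space (subprob_algebra borel)"
    using prob_space_gamma_measure [OF assms(1)]
    by (auto simp: space_subprob_algebra gamma_measure_def intro: prob_space_imp_subprob_space)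
  have 2: "return borel (0::real) \<in> space (subprob_algebra borel)"
    by (auto simp: space_subprob_algebra intro!: prob_space_imp_subprob_space prob_space_return)
  have "emeasure (zero_gamma_mixture p a) A =
    (\<integral>\<^sup>+b. emeasure (if b then gamma_measure a else return borel 0) A
        \<partial>measure_pmf (bernoulli_pmf p))"
    unfolding zero_gamma_mixture_def
    by (rule emeasure_bind [where N = borel]) (use 1 2 assms in auto)
  then show ?thesis
    using assms by (simp add: add.commute mult.commute)
qed

(* Weak convergence of laws on the product space of real lines indexed by I. *)
definition weak_conv_prod :: "'i set \<Rightarrow> (nat \<Rightarrow> ('i \<Rightarrow> real) measure) \<Rightarrow> ('i \<Rightarrow> real) measure \<Rightarrow> bool"
  where
  "weak_conv_prod I \<mu> \<nu> \<longleftrightarrow>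
     (\<forall>f. continuous_map (product_topology (\<lambda>_. euclidean) I) euclideanreal f \<longrightarrow>
          bounded (f ` (I \<rightarrow>\<^sub>E UNIV)) \<longrightarrow>
          (\<lambda>n. \<integral>x. f x \<partial>\<mu> n) \<longlonglongrightarrow> (\<integral>x. f x \<partial>\<nu>))"

end

theory Submission
  imports Defs "HOL-Real_Asymp.Real_Asymp"
begin

text \<open>
  Tilt the weights to \<open>W L n * exp (- s * n)\<close>, with \<open>s\<close> chosen such that \<open>L\<close> independent sites have
  mean total mass exactly \<open>N\<close>.  A Riemann sum for the Gamma integral shows \<open>s * C \<longlonglongrightarrow> 1\<close> for the
  cluster scale \<open>C\<close>, and that the size-biased tilted weight, rescaled by \<open>C\<close>, converges to the mixture
  of a point mass at 0 and a Gamma law.  The total mass fluctuates on the scale \<open>sqrt (L * C)\<close>, which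
  is much larger than \<open>C\<close>; a local limit theorem, obtained by Fourier inversion, therefore gives that
  the tilted partition sums of \<open>L\<close> sites with mass \<open>N\<close> and of \<open>L - m\<close> sites with mass \<open>N - j\<close>,
  \<open>j = O(C)\<close>, are asymptotically equal.  Hence on the box of entries of order \<open>C\<close> the law of the first
  \<open>m\<close> size-biased entries is bounded below by almost the \<open>m\<close>-fold product of the size-biased tilted
  weight.  As the box carries almost all mass of the product, the two laws are close in total variation.
\<close>

section \<open>Riemann sums for the Gamma integral\<close>


text \<open>At fugacity 1 the bulk carries only density \<open>\<rho>c\<close>, so the excess
  \<open>\<rho> - \<rho>c\<close> must come from the perturbation. Tilted by
  \<open>exp (- s n)\<close>, the latter has mean about \<open>\<theta> / L powr \<gamma> * Gamma
  (\<kappa> + 2) * s powr (- (\<kappa> + 2))\<close>; equating this with the excess and putting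
  \<open>s = 1 / C\<close> gives the formula for the cluster scale. Size biasing turns
  \<open>n powr \<kappa>\<close> into \<open>n powr (\<kappa> + 1)\<close>, hence the shape
  \<open>\<kappa> + 2\<close>, and gives bulk and condensate the masses
  \<open>\<rho>c / \<rho>\<close> and \<open>(\<rho> - \<rho>c) / \<rho>\<close>. The obstacle is
  aperiodicity: the bulk may live on a sublattice, so decay of the characteristic function at
  frequencies above \<open>1 / C\<close> has to come from the small condensate part. About
  \<open>C\<close> consecutive integers of weight about \<open>1 / C^2\<close> each lower its
  modulus by \<open>c / C\<close>, and \<open>exp (- c L / C)\<close> beats
  \<open>sqrt (L C)\<close> because \<open>C\<close> is a power of \<open>L\<close> with exponent
  below 1. On the box only lower bounds are required, which lets all size-biased denominators be
  replaced by \<open>N\<close>. All single-site sums stop at \<open>N L\<close>, the range in which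
  \<open>\<delta>\<close> is controlled.\<close>

lemma integrable_Gamma_integrand:
  assumes "(a::real) > 0"
  shows "integrable lborel (\<lambda>x. indicator {0<..} x * (x powr (a - 1) * exp (- x)))"
    and "(\<integral>x. indicator {0<..} x * (x powr (a - 1) * exp (- x)) \<partial>lborel) = Gamma a"
proof -
  let ?f = "\<lambda>x. x powr (a - 1) / exp x"
  have "(?f has_integral Gamma a) {0..}"
    using Gamma_integral_real[OF assms] .
  then have *: "((\<lambda>x. indicator {0<..} x * (x powr (a - 1) * exp (- x))) has_integral Gamma a) UNIV"
    by (subst (asm) has_integral_restrict_UNIV[symmetric])
       (erule has_integral_eq[rotated], auto simp: exp_minus field_simps indicator_def)
  have ae: "integrable lebesgue (\<lambda>x. indicator {0<..} x * (x powr (a - 1) * exp (- x)))"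
    using nonnegative_absolutely_integrable_1[OF has_integral_integrable[OF *]]
    by (auto simp: set_integrable_def indicator_def)
  then show i: "integrable lborel (\<lambda>x. indicator {0<..} x * (x powr (a - 1) * exp (- x)))"
    by (subst (asm) integrable_completion) auto
  show "(\<integral>x. indicator {0<..} x * (x powr (a - 1) * exp (- x)) \<partial>lborel) = Gamma a"
    using has_integral_integral_lborel[OF i] * by (rule has_integral_unique)
qed

text \<open>Turns a Riemann sum of mesh \<open>s\<close> into the integral of a step function, so
  that its limit becomes a matter of dominated convergence.\<close>

lemma sum_eq_lborel_integral:
  fixes h :: "nat \<Rightarrow> real"
  assumes s: "s > 0"
  shows "s * (\<Sum>n\<le>M. h n) =
    (\<integral>x. (if x \<ge> 0 \<and> nat \<lfloor>x / s\<rfloor> \<le> M then h (nat \<lfloor>x / s\<rfloor>) else 0) \<partial>lborel)" (is "_ = ?R")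
proof -
  have eq: "(if x \<ge> 0 \<and> nat \<lfloor>x / s\<rfloor> \<le> M then h (nat \<lfloor>x / s\<rfloor>) else 0) =
      (\<Sum>n\<le>M. indicator {s * real n..<s * (real n + 1)} x * h n)" for x
  proof -
    have "indicator {s * real n..<s * (real n + 1)} x * h n
        = (if n = nat \<lfloor>x / s\<rfloor> then (if x \<ge> 0 then h n else 0) else 0)" for n
    proof -
      have "x \<in> {s * real n..<s * (real n + 1)} \<longleftrightarrow> real n \<le> x / s \<and> x / s < real n + 1"
        using s by (auto simp: field_simps)
      also have "\<dots> \<longleftrightarrow> x \<ge> 0 \<and> n = nat \<lfloor>x / s\<rfloor>"
        using s by (smt (verit) floor_eq4 floor_of_nat le_floor_iff nat_eq_iff of_nat_0_le_iff
            of_int_floor_le floor_less_iff floor_unique of_int_of_nat_eq zero_le_divide_iff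
            real_of_int_floor_add_one_gt zero_le_floor nat_int)
      finally show ?thesis by (auto simp: indicator_def)
    qed
    then show ?thesis by (simp add: sum.delta')
  qed
  have "?R = (\<Sum>n\<le>M. \<integral>x. indicator {s * real n..<s * (real n + 1)} x * h n \<partial>lborel)"
    unfolding eq using s by (subst Bochner_Integration.integral_sum) (auto simp: field_simps)
  also have "\<dots> = (\<Sum>n\<le>M. s * h n)"
    using s by (intro sum.cong) (auto simp: field_simps)
  finally show ?thesis by (simp add: sum_distrib_left)
qed

text \<open>The factor \<open>s powr (\<kappa> + 2)\<close> is spent in three ways: one
  \<open>s\<close> is the mesh width, one turns \<open>n\<close> into \<open>s n\<close>, and
  \<open>s powr \<kappa>\<close> turns \<open>(n + 1) powr \<kappa>\<close> into a function of
  \<open>s (n + 1)\<close>. Quadratic growth of \<open>f\<close> is allowed because moments up to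
  order three are read off later.\<close>

lemma gamma_riemann_sum_tendsto:
  fixes f :: "real \<Rightarrow> real" and s e :: "nat \<Rightarrow> real" and M :: "nat \<Rightarrow> nat" and \<kappa> A :: real
    and d :: "nat \<Rightarrow> nat \<Rightarrow> real"
  assumes \<kappa>: "\<kappa> > -1" and s_pos: "\<forall>\<^sub>F L in sequentially. s L > 0" and s0: "s \<longlonglongrightarrow> 0"
    and sM: "filterlim (\<lambda>L. s L * real (M L)) at_top sequentially"
    and cont: "continuous_on UNIV f" and bound: "\<And>x. x \<ge> 0 \<Longrightarrow> \<bar>f x\<bar> \<le> A * (1 + x\<^sup>2)"
    and e0: "e \<longlonglongrightarrow> 0" and d: "\<forall>\<^sub>F L in sequentially. \<forall>n\<le>M L. \<bar>d L n\<bar> \<le> e L"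
  shows "(\<lambda>L. s L powr (\<kappa> + 2) *
      (\<Sum>n\<le>M L. real n * (real n + 1) powr \<kappa> * (1 + d L n) * exp (- s L * real n) * f (s L * real n)))
    \<longlonglongrightarrow> (\<integral>x. indicator {0<..} x * (x powr (\<kappa> + 1) * exp (- x)) * f x \<partial>lborel)"
proof -
  define h where "h = (\<lambda>L n. (s L * real n) * (s L * (real n + 1)) powr \<kappa> * (1 + d L n)
     * exp (- s L * real n) * f (s L * real n))"
  define g where "g = (\<lambda>L x. if x \<ge> 0 \<and> nat \<lfloor>x / s L\<rfloor> \<le> M L then h L (nat \<lfloor>x / s L\<rfloor>) else 0)"
  define G where "G = (\<lambda>x. indicator {0<..} x * (x powr (\<kappa> + 1) * exp (- x)) * f x)"
  \<comment> \<open>\<open>K\<close> collects the losses: 2 bounds \<open>1 + d\<close>,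
    \<open>exp 1\<close> is the price of replacing the mesh point below \<open>x\<close> by
    \<open>x\<close> in the exponential (mesh below 1), and the power of 2 comes from the factor
    with exponent \<open>\<kappa>\<close>. Expanding
    \<open>x (1 + x powr \<kappa>) (1 + x^2)\<close> gives the four Gamma integrands of
    \<open>D\<close>.\<close>
  define K where "K = 2 * exp 1 * (1 + 2 powr \<bar>\<kappa>\<bar>) * A"
  define D where "D = (\<lambda>x. K * (indicator {0<..} x * (x powr (\<kappa> + 2 - 1) * exp (- x)) +
     indicator {0<..} x * (x powr (\<kappa> + 4 - 1) * exp (- x)) +
     indicator {0<..} x * (x powr (2 - 1) * exp (- x)) +
     indicator {0<..} x * (x powr (4 - 1) * exp (- x))))"
  have A: "A \<ge> 0" using bound[of 0] by auto
  have [measurable]: "f \<in> borel_measurable borel"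
    using cont by (rule borel_measurable_continuous_onI)
  have ev: "\<forall>\<^sub>F L in sequentially. s L > 0 \<and> s L < 1 \<and> (\<forall>n\<le>M L. \<bar>d L n\<bar> \<le> e L) \<and> e L < 1"
    using s_pos d order_tendstoD(2)[OF s0 zero_less_one] order_tendstoD(2)[OF e0 zero_less_one]
    by eventually_elim auto
  obtain L0 where L0: "\<And>L. L \<ge> L0 \<Longrightarrow> s L > 0 \<and> s L < 1 \<and> (\<forall>n\<le>M L. \<bar>d L n\<bar> \<le> e L) \<and> e L < 1"
    using ev unfolding eventually_sequentially by auto
  have eq: "s L powr (\<kappa> + 2) *
      (\<Sum>n\<le>M L. real n * (real n + 1) powr \<kappa> * (1 + d L n) * exp (- s L * real n) * f (s L * real n))
     = integral\<^sup>L lborel (g L)" if "s L > 0" for L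
  proof -
    have "s L powr (\<kappa> + 2) = s L * (s L * s L powr \<kappa>)"
      using that by (simp add: powr_add power2_eq_square powr_numeral)
    then have "s L powr (\<kappa> + 2) *
      (\<Sum>n\<le>M L. real n * (real n + 1) powr \<kappa> * (1 + d L n) * exp (- s L * real n) * f (s L * real n))
      = s L * (\<Sum>n\<le>M L. h L n)"
      using that by (simp add: h_def sum_distrib_left powr_mult mult_ac)
    then show ?thesis
      unfolding g_def sum_eq_lborel_integral[OF that, of "h L" "M L"] .
  qed
  have fl: "s * real (nat \<lfloor>x / s\<rfloor>) \<le> x \<and> x \<le> s * (real (nat \<lfloor>x / s\<rfloor>) + 1)" if "x \<ge> 0" "s > 0" for x s :: real
  proof -
    have "real (nat \<lfloor>x / s\<rfloor>) = of_int \<lfloor>x / s\<rfloor>" using that by simp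
    moreover have "real_of_int \<lfloor>x / s\<rfloor> \<le> x / s" "x / s \<le> real_of_int \<lfloor>x / s\<rfloor> + 1" by linarith+
    ultimately show ?thesis using that
      by (simp only: pos_le_divide_eq pos_divide_le_eq mult.commute)
  qed
  have lim: "(\<lambda>L. g L x) \<longlonglongrightarrow> G x" if "x \<noteq> 0" for x
  proof (cases "x > 0")
    case False
    then show ?thesis using that by (simp add: g_def G_def)
  next
    case x: True
    define y where "y = (\<lambda>L. s L * real (nat \<lfloor>x / s L\<rfloor>))"
    have y: "y L \<le> x \<and> x \<le> y L + s L" if "L \<ge> L0" for L
      using fl[of x "s L"] x L0[OF that] by (simp add: y_def algebra_simps)
    have lower: "(\<lambda>L. x - s L) \<longlonglongrightarrow> x" using s0 by (auto intro!: tendsto_eq_intros)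
    have ylim: "y \<longlonglongrightarrow> x"
      by (rule tendsto_sandwich[OF _ _ lower tendsto_const])
         (use y in \<open>auto simp: eventually_sequentially intro!: exI[of _ L0]\<close>, fastforce)
    have small: "\<forall>\<^sub>F L in sequentially. nat \<lfloor>x / s L\<rfloor> \<le> M L"
    proof -
      have "\<forall>\<^sub>F L in sequentially. s L * real (M L) \<ge> x"
        using sM by (auto simp: filterlim_at_top)
      then show ?thesis using eventually_ge_at_top[of L0]
      proof eventually_elim
        case (elim L)
        have "s L * real (nat \<lfloor>x / s L\<rfloor>) \<le> s L * real (M L)"
          using y[OF elim(2)] elim by (simp add: y_def)
        then show ?case using L0[OF elim(2)] by simp
      qed
    qed
    \<comment> \<open>Nothing is known about \<open>d L n\<close> for \<open>n > M L\<close>, so it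
      is set to 0 there; for fixed \<open>x\<close> this case disappears eventually.\<close>
    have "(\<lambda>L. if nat \<lfloor>x / s L\<rfloor> \<le> M L then d L (nat \<lfloor>x / s L\<rfloor>) else 0) \<longlonglongrightarrow> 0"
    proof (rule tendsto_rabs_zero_cancel, rule tendsto_sandwich[OF _ _ tendsto_const e0])
      show "\<forall>\<^sub>F L in sequentially. \<bar>if nat \<lfloor>x / s L\<rfloor> \<le> M L then d L (nat \<lfloor>x / s L\<rfloor>) else 0\<bar> \<le> e L"
        using ev by eventually_elim (auto intro: order_trans[OF abs_ge_zero])
    qed auto
    then have dlim: "(\<lambda>L. d L (nat \<lfloor>x / s L\<rfloor>)) \<longlonglongrightarrow> 0"
      by (rule Lim_transform_eventually) (use small in \<open>auto elim: eventually_mono\<close>)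
    have flim: "(\<lambda>L. f (y L)) \<longlonglongrightarrow> f x"
      using cont ylim by (intro isCont_tendsto_compose[of x f]) (auto simp: continuous_on_eq_continuous_at)
    have "(\<lambda>L. y L * (y L + s L) powr \<kappa> * (1 + d L (nat \<lfloor>x / s L\<rfloor>)) * exp (- y L) * f (y L))
       \<longlonglongrightarrow> x * (x + 0) powr \<kappa> * (1 + 0) * exp (- x) * f x"
      using x by (intro tendsto_intros ylim dlim flim s0) auto
    also have "x * (x + 0) powr \<kappa> * (1 + 0) * exp (- x) * f x = G x"
      using x by (simp add: G_def powr_add mult_ac)
    finally show ?thesis
      by (rule Lim_transform_eventually)
         (use small in eventually_elim, use x in \<open>simp add: g_def h_def y_def algebra_simps\<close>)
  qed
  have dom: "\<bar>g L x\<bar> \<le> D x" if L: "L \<ge> L0" and "x \<noteq> 0" for L x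
  proof (cases "x > 0 \<and> nat \<lfloor>x / s L\<rfloor> \<le> M L")
    case False
    moreover have "K \<ge> 0" using A by (simp add: K_def)
    ultimately show ?thesis using \<open>x \<noteq> 0\<close> by (auto simp: g_def D_def)
  next
    case True
    define n where "n = nat \<lfloor>x / s L\<rfloor>"
    define y where "y = s L * real n"
    have x: "x > 0" and n: "n \<le> M L" using True by (auto simp: n_def)
    have sL: "s L > 0" "s L < 1" using L0[OF L] by auto
    have "\<bar>d L n\<bar> \<le> 1" using L0[OF L] n by fastforce
    then have dn: "\<bar>1 + d L n\<bar> \<le> 2" by linarith
    have y: "0 \<le> y" "y \<le> x" "x \<le> y + s L" using fl[of x "s L"] x sL by (auto simp: y_def n_def algebra_simps)
    \<comment> \<open>The sign of \<open>\<kappa>\<close> decides which side of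
      \<open>y \<le> x \<le> y + s L\<close> is used: an increasing power needs
      \<open>y + s L \<le> 2 max 1 x\<close>, a decreasing one needs
      \<open>x \<le> y + s L\<close>.\<close>
    have p: "(y + s L) powr \<kappa> \<le> (1 + 2 powr \<bar>\<kappa>\<bar>) * (1 + x powr \<kappa>)"
    proof (cases "\<kappa> \<ge> 0")
      case \<kappa>: True
      have "(y + s L) powr \<kappa> \<le> (2 * max 1 x) powr \<kappa>"
        using y sL \<kappa> by (intro powr_mono2) auto
      also have "\<dots> = 2 powr \<kappa> * max 1 x powr \<kappa>" by (subst powr_mult) auto
      also have "\<dots> \<le> (1 + 2 powr \<bar>\<kappa>\<bar>) * (1 + x powr \<kappa>)"
        using \<kappa> by (intro mult_mono) (auto simp: max_def)
      finally show ?thesis .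
    next
      case False
      then have "(y + s L) powr \<kappa> \<le> x powr \<kappa>"
        using y x by (intro powr_mono2') auto
      also have "\<dots> \<le> 1 * (1 + x powr \<kappa>)" by simp
      also have "\<dots> \<le> (1 + 2 powr \<bar>\<kappa>\<bar>) * (1 + x powr \<kappa>)" by (intro mult_right_mono) auto
      finally show ?thesis .
    qed
    have ex: "exp (- y) \<le> exp 1 * exp (- x)"
      using y sL by (simp add: exp_add[symmetric])
    have fy: "\<bar>f y\<bar> \<le> A * (1 + x\<^sup>2)"
      using bound[OF y(1)] y A by (smt (verit) mult_left_mono power_mono)
    have "g L x = y * (y + s L) powr \<kappa> * (1 + d L n) * exp (- y) * f y"
      using True by (simp add: g_def h_def y_def n_def algebra_simps)
    then have "\<bar>g L x\<bar> = y * (y + s L) powr \<kappa> * \<bar>1 + d L n\<bar> * exp (- y) * \<bar>f y\<bar>"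
      using y by (simp add: abs_mult)
    also have "\<dots> \<le> x * ((1 + 2 powr \<bar>\<kappa>\<bar>) * (1 + x powr \<kappa>)) * 2 * (exp 1 * exp (- x)) * (A * (1 + x\<^sup>2))"
      using y dn ex fy p x by (intro mult_mono) auto
    also have "\<dots> = D x"
    proof -
      have "x powr (\<kappa> + 1) = x * x powr \<kappa>" "x powr (\<kappa> + 3) = x ^ 3 * x powr \<kappa>" "x powr 3 = x ^ 3"
        using x by (simp_all add: powr_add powr_numeral)
      then show ?thesis using x unfolding D_def K_def
        by (simp add: algebra_simps power2_eq_square power3_eq_cube)
    qed
    finally show ?thesis .
  qed
  have intD: "integrable lborel D"
    unfolding D_def using \<kappa>
    by (intro integrable_mult_right Bochner_Integration.integrable_add integrable_Gamma_integrand) auto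
  have meas: "(\<lambda>x. g L x) \<in> borel_measurable lborel" for L
    unfolding g_def h_def by measurable
  have ne: "AE x in lborel. x \<noteq> (0::real)" by (rule AE_lborel_singleton)
  have "(\<lambda>k. integral\<^sup>L lborel (g (k + L0))) \<longlonglongrightarrow> integral\<^sup>L lborel G"
  proof (rule integral_dominated_convergence[where w = D])
    show "G \<in> borel_measurable lborel" unfolding G_def by measurable
    show "AE x in lborel. (\<lambda>k. g (k + L0) x) \<longlonglongrightarrow> G x"
      using ne by eventually_elim (rule LIMSEQ_ignore_initial_segment[OF lim])
    show "AE x in lborel. norm (g (k + L0) x) \<le> D x" for k
      using ne by eventually_elim (auto intro: dom)
  qed (use intD meas in auto)
  then have "(\<lambda>L. integral\<^sup>L lborel (g L)) \<longlonglongrightarrow> integral\<^sup>L lborel G"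
    by (rule LIMSEQ_offset)
  then have "(\<lambda>L. s L powr (\<kappa> + 2) *
      (\<Sum>n\<le>M L. real n * (real n + 1) powr \<kappa> * (1 + d L n) * exp (- s L * real n) * f (s L * real n)))
    \<longlonglongrightarrow> integral\<^sup>L lborel G"
    by (rule Lim_transform_eventually) (use s_pos in eventually_elim, use eq in simp)
  then show ?thesis by (simp add: G_def)
qed

section \<open>The grand canonical weights\<close>


lemma one_plus_square_times_exp_le:
  assumes "(x::real) \<ge> 0" shows "(1 + x\<^sup>2) * exp (- x) \<le> 3"
proof -
  have "1 + x + x\<^sup>2 / 2 \<le> exp x"
    using exp_lower_Taylor_quadratic[OF assms] by simp
  then have "1 + x\<^sup>2 \<le> 3 * exp x" using assms by (smt (verit) zero_le_power2 field_sum_of_halves)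
  then have "(1 + x\<^sup>2) * exp (- x) \<le> 3 * exp x * exp (- x)"
    by (intro mult_right_mono) auto
  then show ?thesis by (simp add: mult.assoc exp_add[symmetric])
qed

lemma abs_le_one_plus_square: "\<bar>x\<bar> \<le> 1 * (1 + (x::real)\<^sup>2)"
proof -
  have "2 * \<bar>x\<bar> \<le> 1 + \<bar>x\<bar>\<^sup>2" using zero_le_power2[of "\<bar>x\<bar> - 1"] by (simp add: power2_diff)
  then have "2 * \<bar>x\<bar> \<le> 1 + x\<^sup>2" by simp
  then show ?thesis using abs_ge_zero[of x] unfolding mult_1 by linarith
qed

text \<open>Source of the point mass at 0: for fixed \<open>n\<close> the argument
  \<open>s n\<close> tends to 0, so only \<open>f 0\<close> survives. Tannery's theorem applies with
  majorant \<open>3 A v n\<close>, because \<open>(1 + x^2) exp (- x)\<close> is at most 3.\<close>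

lemma truncated_sum_tendsto:
  fixes v :: "nat \<Rightarrow> real" and f :: "real \<Rightarrow> real"
  assumes v: "v sums V" "\<And>n. v n \<ge> 0" and s_pos: "\<forall>\<^sub>F L in sequentially. s L > 0" and s0: "s \<longlonglongrightarrow> 0"
    and M: "filterlim M at_top sequentially"
    and cont: "continuous_on UNIV f" and bound: "\<And>x. x \<ge> 0 \<Longrightarrow> \<bar>f x\<bar> \<le> A * (1 + x\<^sup>2)"
  shows "(\<lambda>L. \<Sum>n\<le>M L. v n * exp (- s L * real n) * f (s L * real n)) \<longlonglongrightarrow> V * f 0"
proof -
  define a where "a = (\<lambda>n L. if n \<le> M L then v n * exp (- s L * real n) * f (s L * real n) else 0)"
  have A: "A \<ge> 0" using bound[of 0] by auto
  have lim: "(\<lambda>L. a n L) \<longlonglongrightarrow> v n * f 0" for n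
  proof -
    have "(\<lambda>L. s L * real n) \<longlonglongrightarrow> 0 * real n" by (intro tendsto_intros s0)
    then have *: "(\<lambda>L. f (s L * real n)) \<longlonglongrightarrow> f 0"
      using cont by (intro isCont_tendsto_compose[of 0 f]) (auto simp: continuous_on_eq_continuous_at)
    have "(\<lambda>L. v n * exp (- s L * real n) * f (s L * real n)) \<longlonglongrightarrow> v n * exp (- 0 * real n) * f 0"
      by (intro tendsto_intros s0 *)
    then have "(\<lambda>L. v n * exp (- s L * real n) * f (s L * real n)) \<longlonglongrightarrow> v n * f 0" by simp
    moreover have "\<forall>\<^sub>F L in sequentially. n \<le> M L" using M by (auto simp: filterlim_at_top)
    ultimately show ?thesis
      by (elim Lim_transform_eventually) (auto simp: a_def elim: eventually_mono)
  qed
  have bnd: "norm (a n L) \<le> v n * (3 * A)" if "s L > 0" for n L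
  proof -
    have "\<bar>v n * exp (- s L * real n) * f (s L * real n)\<bar>
       \<le> v n * (exp (- (s L * real n)) * (A * (1 + (s L * real n)\<^sup>2)))"
      using bound[of "s L * real n"] v(2)[of n] that by (auto simp: abs_mult mult.assoc intro!: mult_left_mono)
    also have "\<dots> = v n * (A * ((1 + (s L * real n)\<^sup>2) * exp (- (s L * real n))))"
      by (simp add: mult_ac)
    also have "\<dots> \<le> v n * (A * 3)"
      using A v(2)[of n] that by (intro mult_left_mono one_plus_square_times_exp_le) auto
    finally show ?thesis using A v(2)[of n] by (simp add: a_def mult_ac)
  qed
  have "(\<lambda>L. suminf (\<lambda>n. a n L)) \<longlonglongrightarrow> suminf (\<lambda>n. v n * f 0)"
  proof (rule tannerys_theorem[THEN conjunct2, THEN conjunct2])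
    show "\<forall>\<^sub>F (n, L) in sequentially \<times>\<^sub>F sequentially. norm (a n L) \<le> v n * (3 * A)"
      unfolding eventually_prod_filter
      by (rule exI[of _ "\<lambda>_. True"], rule exI[of _ "\<lambda>L. s L > 0"]) (use s_pos bnd in auto)
    show "summable (\<lambda>n. v n * (3 * A))" using v by (intro summable_mult2) (auto simp: sums_iff)
  qed (use lim in auto)
  moreover have "suminf (\<lambda>n. v n * f 0) = V * f 0" using v by (metis sums_mult2 sums_unique)
  moreover have "suminf (\<lambda>n. a n L) = (\<Sum>n\<le>M L. v n * exp (- s L * real n) * f (s L * real n))" for L
    by (subst suminf_finite[of "{..M L}"]) (auto simp: a_def)
  ultimately show ?thesis by simp
qed

section \<open>Scale comparisons and limits of the tilted sums\<close>

locale condensation =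
  fixes w :: "nat \<Rightarrow> real"
    and W \<delta> :: "nat \<Rightarrow> nat \<Rightarrow> real"
    and \<theta> \<gamma> \<kappa> \<rho> \<rho>c :: real
    and N :: "nat \<Rightarrow> nat"
  assumes \<theta>: "\<theta> > 0" and \<gamma>: "\<gamma> > 0" and \<kappa>: "\<kappa> > -1"
    and W_pos: "\<And>L n. L \<ge> 1 \<Longrightarrow> W L n > 0"
    and W_eq: "\<And>L n. L \<ge> 1 \<Longrightarrow>
      W L n = w n + \<theta> / real L powr \<gamma> * (real n + 1) powr \<kappa> * (1 + \<delta> L n)"
    and w_nonneg: "\<And>n. w n \<ge> 0"
    and w_sums: "w sums 1"
    and w_mean: "(\<lambda>n. real n * w n) sums \<rho>c"
    and \<gamma>\<kappa>: "\<gamma> < \<kappa> + 2"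
    and N_top: "filterlim N at_top sequentially"
    and N_density: "(\<lambda>L. real (N L) / real L) \<longlonglongrightarrow> \<rho>"
    and \<rho>: "\<rho> > \<rho>c"
    and \<delta>_small: "(\<lambda>L. real L * (SUP n\<in>{..N L}. \<bar>\<delta> L n\<bar>)) \<longlonglongrightarrow> 0"
begin

definition C :: "nat \<Rightarrow> real" where "C = cluster_scale \<theta> \<gamma> \<kappa> \<rho> \<rho>c"

definition err :: "nat \<Rightarrow> real" where "err L = (SUP n\<in>{..N L}. \<bar>\<delta> L n\<bar>)"

text \<open>An unnormalised expectation of \<open>f (s n)\<close> under the size-biased tilted
  weight. The factor \<open>real n\<close> makes \<open>T\<close> at the constant 1 the unnormalised
  mean, and at \<open>x^k\<close> the moment of order \<open>k + 1\<close> times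
  \<open>s^k\<close>.\<close>

definition T :: "(real \<Rightarrow> real) \<Rightarrow> nat \<Rightarrow> real \<Rightarrow> real" where
  "T f L s = (\<Sum>n\<le>N L. real n * W L n * exp (- s * real n) * f (s * real n))"

definition P :: "nat \<Rightarrow> real \<Rightarrow> real" where
  "P L s = (\<Sum>n\<le>N L. W L n * exp (- s * real n))"

text \<open>\<open>J f / Gamma (\<kappa> + 2)\<close> is the expectation of \<open>f\<close> under
  the Gamma law of shape \<open>\<kappa> + 2\<close>.\<close>

definition J :: "(real \<Rightarrow> real) \<Rightarrow> real" where
  "J f = (\<integral>x. indicator {0<..} x * (x powr (\<kappa> + 1) * exp (- x)) * f x \<partial>lborel)"

lemma \<rho>c_nonneg: "\<rho>c \<ge> 0"
  using w_mean w_nonneg by (auto simp: sums_iff intro!: suminf_nonneg)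

lemma \<rho>_pos: "\<rho> > 0" using \<rho>c_nonneg \<rho> by linarith

lemma Gamma_pos: "Gamma (\<kappa> + 2) > 0" using \<kappa> by (intro Gamma_real_pos) auto

text \<open>The exponent is \<open>\<gamma> / (\<kappa> + 2)\<close>. Once \<open>C\<close> is a
  pure power of \<open>L\<close>, every comparison of scales is decided by asymptotic
  automation.\<close>

lemma C_eq:
  obtains c \<beta> where "c > 0" "0 < \<beta>" "\<beta> < 1" "C = (\<lambda>L. c * real L powr \<beta>)"
proof
  let ?c = "(\<rho> - \<rho>c) / (\<theta> * Gamma (\<kappa> + 2))"
  show "?c powr (1 / (\<kappa> + 2)) > 0" using \<rho> \<theta> Gamma_pos by simp
  show "0 < \<gamma> / (\<kappa> + 2)" "\<gamma> / (\<kappa> + 2) < 1" using \<gamma> \<kappa> \<gamma>\<kappa> by auto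
  show "C = (\<lambda>L. ?c powr (1 / (\<kappa> + 2)) * real L powr (\<gamma> / (\<kappa> + 2)))"
  proof
    fix L
    have "C L = (?c * real L powr \<gamma>) powr (1 / (\<kappa> + 2))"
      by (simp add: C_def cluster_scale_def)
    also have "\<dots> = ?c powr (1 / (\<kappa> + 2)) * real L powr (\<gamma> / (\<kappa> + 2))"
      using \<rho> \<theta> Gamma_pos by (subst powr_mult) (auto simp: powr_powr)
    finally show "C L = ?c powr (1 / (\<kappa> + 2)) * real L powr (\<gamma> / (\<kappa> + 2))" .
  qed
qed

lemma C_pos: "L \<ge> 1 \<Longrightarrow> C L > 0"
  by (rule C_eq) auto

lemma C_top: "filterlim C at_top sequentially"
  by (rule C_eq, simp) real_asymp

lemma C_over_L: "(\<lambda>L. C L / real L) \<longlonglongrightarrow> 0"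
  by (rule C_eq, simp) real_asymp

lemma L_over_C: "filterlim (\<lambda>L. real L / C L) at_top sequentially"
  by (rule C_eq, simp) real_asymp

text \<open>Makes the frequencies beyond \<open>1 / C\<close> negligible in the Fourier inversion
  even after multiplication by the standard deviation scale; \<open>L / C\<close> grows like a
  positive power of \<open>L\<close>.\<close>

lemma exp_tail:
  assumes "b > 0" shows "(\<lambda>L. sqrt (real L * C L) * exp (- b * real L / C L)) \<longlonglongrightarrow> 0"
  using assms by (rule_tac C_eq, simp) real_asymp

lemma N_over_C: "filterlim (\<lambda>L. real (N L) / C L) at_top sequentially"
proof -
  have "filterlim (\<lambda>L. real (N L) / real L * (real L / C L)) at_top sequentially"
    by (rule filterlim_tendsto_pos_mult_at_top[OF N_density \<rho>_pos L_over_C])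
  then show ?thesis
    by (rule filterlim_mono_eventually) (auto simp: eventually_sequentially intro!: exI[of _ 1])
qed

text \<open>The defining equation of \<open>C\<close> solved for the perturbation strength. The
  right-hand side already isolates \<open>s powr (\<kappa> + 2)\<close>, the prefactor of the
  Riemann sum, leaving a factor that depends only on \<open>s C\<close>.\<close>

lemma condensate_weight:
  assumes "L \<ge> 1" "s > 0"
  shows "\<theta> / real L powr \<gamma> = (\<rho> - \<rho>c) / Gamma (\<kappa> + 2) * (s * C L) powr (- (\<kappa> + 2)) * s powr (\<kappa> + 2)"
proof -
  have "C L powr (\<kappa> + 2) = (\<rho> - \<rho>c) * real L powr \<gamma> / (\<theta> * Gamma (\<kappa> + 2))"
    unfolding C_def cluster_scale_def using \<kappa> \<rho> \<theta> Gamma_pos assms by (simp add: powr_powr)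
  moreover have "(s * C L) powr (- (\<kappa> + 2)) * s powr (\<kappa> + 2) = 1 / C L powr (\<kappa> + 2)"
    using assms C_pos[of L] by (simp only: powr_minus_divide powr_mult) (simp add: powr_gt_zero)
  ultimately show ?thesis
    using \<rho> \<theta> Gamma_pos assms by (simp add: mult.assoc)
qed

lemma err_tendsto: "err \<longlonglongrightarrow> 0"
proof -
  have "(\<lambda>L. real L * err L / real L) \<longlonglongrightarrow> 0"
    using tendsto_mult[OF \<delta>_small lim_inverse_n] by (simp add: err_def divide_inverse)
  then show ?thesis
    by (rule Lim_transform_eventually) (auto simp: eventually_sequentially intro!: exI[of _ 1])
qed

lemma \<delta>_le_err: "n \<le> N L \<Longrightarrow> \<bar>\<delta> L n\<bar> \<le> err L"
  unfolding err_def by (rule cSUP_upper) auto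

text \<open>The tilt is first located only in a bracket of order \<open>1 / C\<close>; its exact
  asymptotics are derived afterwards. The limit lemmas therefore have to work under this two-sided
  bound alone.\<close>

definition comparable :: "(nat \<Rightarrow> real) \<Rightarrow> bool" where
  "comparable s \<longleftrightarrow> (\<exists>a>0. \<exists>b. \<forall>\<^sub>F L in sequentially. a \<le> s L * C L \<and> s L * C L \<le> b)"

lemma comparable_tendsto:
  assumes "(\<lambda>L. s L * C L) \<longlonglongrightarrow> a" "a > 0" shows "comparable s"
  unfolding comparable_def
proof (intro exI conjI)
  show "\<forall>\<^sub>F L in sequentially. a / 2 \<le> s L * C L \<and> s L * C L \<le> a + 1"
    using order_tendstoD(1)[OF assms(1), of "a / 2"] order_tendstoD(2)[OF assms(1), of "a + 1"] assms(2)
    by (auto elim: eventually_elim2)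
qed (use assms in auto)

lemma comparable_facts:
  assumes "comparable s"
  shows "\<forall>\<^sub>F L in sequentially. s L > 0" and "s \<longlonglongrightarrow> 0"
    and "filterlim (\<lambda>L. s L * real (N L)) at_top sequentially"
proof -
  obtain a b where a: "a > 0" and ev: "\<forall>\<^sub>F L in sequentially. a \<le> s L * C L \<and> s L * C L \<le> b"
    using assms by (auto simp: comparable_def)
  have ev': "\<forall>\<^sub>F L in sequentially. L \<ge> 1 \<and> C L > 0 \<and> a / C L \<le> s L \<and> s L \<le> b / C L"
    using ev eventually_ge_at_top[of 1]
    by eventually_elim (use C_pos in \<open>auto simp: field_simps\<close>)
  then show "\<forall>\<^sub>F L in sequentially. s L > 0"
    by eventually_elim (use a in \<open>auto intro: less_le_trans[OF divide_pos_pos]\<close>)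
  have lim: "(\<lambda>L. c / C L) \<longlonglongrightarrow> 0" for c
    by (rule real_tendsto_divide_at_top[OF tendsto_const C_top])
  show "s \<longlonglongrightarrow> 0"
    by (rule tendsto_sandwich[OF _ _ lim[of a] lim[of b]]) (use ev' in \<open>auto elim: eventually_mono\<close>)
  have "filterlim (\<lambda>L. a * (real (N L) / C L)) at_top sequentially"
    by (rule filterlim_tendsto_pos_mult_at_top[OF tendsto_const a N_over_C])
  then show "filterlim (\<lambda>L. s L * real (N L)) at_top sequentially"
  proof (rule filterlim_at_top_mono)
    show "\<forall>\<^sub>F L in sequentially. a * (real (N L) / C L) \<le> s L * real (N L)"
      using ev'
    proof eventually_elim
      case (elim L)
      then have "a / C L * real (N L) \<le> s L * real (N L)" by (intro mult_right_mono) auto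
      then show ?case by simp
    qed
  qed
qed

text \<open>Since \<open>s C\<close> need not converge, the condensate term is subtracted rather
  than given a limit. The weight splits into the bulk, which contributes
  \<open>\<rho>c * f 0\<close>, and the condensate, a bounded coefficient times a Riemann sum
  tending to \<open>J f\<close>.\<close>

lemma T_tendsto:
  assumes s: "comparable s"
    and cont: "continuous_on UNIV f" and bound: "\<And>x. x \<ge> 0 \<Longrightarrow> \<bar>f x\<bar> \<le> A * (1 + x\<^sup>2)"
  shows "(\<lambda>L. T f L (s L) - (\<rho> - \<rho>c) / Gamma (\<kappa> + 2) * (s L * C L) powr (- (\<kappa> + 2)) * J f) \<longlonglongrightarrow> \<rho>c * f 0"
proof -
  define c where "c = (\<lambda>L. (\<rho> - \<rho>c) / Gamma (\<kappa> + 2) * (s L * C L) powr (- (\<kappa> + 2)))"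
  define X where "X = (\<lambda>L. s L powr (\<kappa> + 2) *
      (\<Sum>n\<le>N L. real n * (real n + 1) powr \<kappa> * (1 + \<delta> L n) * exp (- s L * real n) * f (s L * real n)))"
  note sf = comparable_facts[OF s]
  obtain a b where a: "a > 0" and ab: "\<forall>\<^sub>F L in sequentially. a \<le> s L * C L \<and> s L * C L \<le> b"
    using s by (auto simp: comparable_def)
  have X: "(\<lambda>L. X L - J f) \<longlonglongrightarrow> 0"
    unfolding X_def J_def
    by (subst LIM_zero_iff, rule gamma_riemann_sum_tendsto[OF \<kappa> sf cont bound err_tendsto])
       (use \<delta>_le_err in auto)
  have bulk: "(\<lambda>L. \<Sum>n\<le>N L. (real n * w n) * exp (- s L * real n) * f (s L * real n)) \<longlonglongrightarrow> \<rho>c * f 0"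
    by (rule truncated_sum_tendsto[OF w_mean _ sf(1,2) N_top cont bound]) (use w_nonneg in auto)
  have cb: "\<forall>\<^sub>F L in sequentially. norm (c L) \<le> (\<rho> - \<rho>c) / Gamma (\<kappa> + 2) * a powr (- (\<kappa> + 2))"
    using ab
  proof eventually_elim
    case (elim L)
    have "(s L * C L) powr (- (\<kappa> + 2)) \<le> a powr (- (\<kappa> + 2))"
      using elim a \<kappa> by (intro powr_mono2') auto
    then have "c L \<le> (\<rho> - \<rho>c) / Gamma (\<kappa> + 2) * a powr (- (\<kappa> + 2))"
      unfolding c_def using \<rho> Gamma_pos by (intro mult_left_mono) auto
    moreover have "c L \<ge> 0" unfolding c_def using \<rho> Gamma_pos by auto
    ultimately show ?case by simp
  qed
  have "(\<lambda>L. c L * (X L - J f)) \<longlonglongrightarrow> 0"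
    by (rule lim_null_mult_left_bounded[OF cb X])
  then have "(\<lambda>L. (\<Sum>n\<le>N L. (real n * w n) * exp (- s L * real n) * f (s L * real n)) + c L * (X L - J f))
    \<longlonglongrightarrow> \<rho>c * f 0 + 0"
    by (intro tendsto_add bulk)
  moreover have "\<forall>\<^sub>F L in sequentially. T f L (s L) - c L * J f =
     (\<Sum>n\<le>N L. (real n * w n) * exp (- s L * real n) * f (s L * real n)) + c L * (X L - J f)"
    using sf(1) eventually_ge_at_top[of 1]
  proof eventually_elim
    case (elim L)
    have "T f L (s L) = (\<Sum>n\<le>N L. (real n * w n) * exp (- s L * real n) * f (s L * real n)) +
      \<theta> / real L powr \<gamma> * (\<Sum>n\<le>N L. real n * (real n + 1) powr \<kappa> * (1 + \<delta> L n) * exp (- s L * real n) * f (s L * real n))"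
      unfolding T_def W_eq[OF elim(2)] by (simp add: sum_distrib_left sum.distrib[symmetric] algebra_simps add_divide_distrib)
    then show ?case
      unfolding condensate_weight[OF elim(2,1)] by (simp add: c_def X_def algebra_simps)
  qed
  ultimately have "(\<lambda>L. T f L (s L) - c L * J f) \<longlonglongrightarrow> \<rho>c * f 0"
    by (subst tendsto_cong) auto
  then show ?thesis by (simp only: c_def)
qed

lemma J_power:
  "J (\<lambda>x. x ^ k) = Gamma (\<kappa> + 2 + real k)"
proof -
  have "J (\<lambda>x. x ^ k) = (\<integral>x. indicator {0<..} x * (x powr (\<kappa> + 2 + real k - 1) * exp (- x)) \<partial>lborel)"
    unfolding J_def
    by (intro Bochner_Integration.integral_cong)
       (auto simp: indicator_def powr_add powr_realpow[symmetric] powr_diff field_simps)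
  also have "\<dots> = Gamma (\<kappa> + 2 + real k)"
    using \<kappa> by (intro integrable_Gamma_integrand) auto
  finally show ?thesis .
qed

lemma J_one: "J (\<lambda>x. 1) = Gamma (\<kappa> + 2)" using J_power[of 0] by simp

lemma T_one_tendsto:
  assumes "comparable s"
  shows "(\<lambda>L. T (\<lambda>x. 1) L (s L) - (\<rho> - \<rho>c) * (s L * C L) powr (- (\<kappa> + 2))) \<longlonglongrightarrow> \<rho>c"
  using T_tendsto[OF assms, of "\<lambda>x. 1" 1] Gamma_pos by (simp add: J_one)

text \<open>The condensate has vanishing total weight. Below a fixed level \<open>k\<close> it
  vanishes like \<open>L powr (- \<gamma>)\<close>; from \<open>k\<close> on it is at most
  \<open>1 / k\<close> times the first moment \<open>T\<close>, which stays bounded.\<close>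

lemma P_tendsto:
  assumes s: "comparable s"
  shows "(\<lambda>L. P L (s L)) \<longlonglongrightarrow> 1"
proof -
  note sf = comparable_facts[OF s]
  define c where "c = (\<lambda>L n. \<theta> / real L powr \<gamma> * (real n + 1) powr \<kappa> * (1 + \<delta> L n) * exp (- s L * real n))"
  obtain a b where a: "a > 0" and ab: "\<forall>\<^sub>F L in sequentially. a \<le> s L * C L \<and> s L * C L \<le> b"
    using s by (auto simp: comparable_def)
  define B where "B = (\<rho> - \<rho>c) * a powr (- (\<kappa> + 2)) + \<rho>c + 1"
  have bulk: "(\<lambda>L. \<Sum>n\<le>N L. w n * exp (- s L * real n) * 1) \<longlonglongrightarrow> 1 * 1"
    by (rule truncated_sum_tendsto[OF w_sums w_nonneg sf(1,2) N_top, of "\<lambda>_. 1" 1]) auto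
  have Tb: "\<forall>\<^sub>F L in sequentially. T (\<lambda>x. 1) L (s L) \<le> B"
    using ab order_tendstoD(2)[OF T_one_tendsto[OF s] less_add_one]
  proof (eventually_elim, goal_cases)
    case (1 L)
    have "(s L * C L) powr (- (\<kappa> + 2)) \<le> a powr (- (\<kappa> + 2))"
      using 1 a \<kappa> by (intro powr_mono2') auto
    then have "(\<rho> - \<rho>c) * (s L * C L) powr (- (\<kappa> + 2)) \<le> (\<rho> - \<rho>c) * a powr (- (\<kappa> + 2))"
      using \<rho> by (intro mult_left_mono) auto
    then show ?case using 1 by (simp add: B_def)
  qed
  have B: "B > 0" using \<rho> \<rho>c_nonneg by (simp add: B_def add_nonneg_pos)
  have c0: "(\<lambda>L. \<Sum>n\<le>N L. c L n) \<longlonglongrightarrow> 0"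
  proof (rule order_tendstoI)
    fix e :: real
    have ev: "\<forall>\<^sub>F L in sequentially. L \<ge> 1 \<and> s L > 0 \<and> err L < 1 \<and> T (\<lambda>x. 1) L (s L) \<le> B"
      using eventually_ge_at_top[of 1] sf(1) order_tendstoD(2)[OF err_tendsto zero_less_one] Tb
      by eventually_elim auto
    have c_nonneg: "c L n \<ge> 0" if "err L < 1" "n \<le> N L" for L n
      using that \<theta> \<delta>_le_err[of n L] unfolding c_def by (intro mult_nonneg_nonneg) auto
    {
      assume e: "e < 0"
      show "\<forall>\<^sub>F L in sequentially. e < (\<Sum>n\<le>N L. c L n)"
        using ev by eventually_elim (use e c_nonneg in \<open>auto intro!: less_le_trans[OF e] sum_nonneg\<close>)
    }
    {
      assume e: "e > 0"
      \<comment> \<open>Large enough for the high part, at most \<open>B / k\<close>, to use up less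
        than half of \<open>e\<close>.\<close>
      define k where "k = nat \<lceil>2 * B / e\<rceil> + 1"
      have k: "real k > 2 * B / e" "k > 0" unfolding k_def by linarith+
      define S where "S = (\<Sum>n<k. (real n + 1) powr \<kappa>)"
      have "((\<lambda>L. real L powr (- \<gamma>)) \<longlonglongrightarrow> 0)"
        using \<gamma> by (intro tendsto_neg_powr filterlim_real_sequentially) auto
      then have "(\<lambda>L. \<theta> * real L powr (- \<gamma>) * (2 * S)) \<longlonglongrightarrow> \<theta> * 0 * (2 * S)"
        by (intro tendsto_intros)
      then have "\<forall>\<^sub>F L in sequentially. \<theta> * real L powr (- \<gamma>) * (2 * S) < e / 2"
        using e by (intro order_tendstoD(2)) auto
      then show "\<forall>\<^sub>F L in sequentially. (\<Sum>n\<le>N L. c L n) < e"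
        using ev
      proof eventually_elim
        case (elim L)
        have L: "L \<ge> 1" "s L > 0" "err L < 1" "T (\<lambda>x. 1) L (s L) \<le> B" using elim by auto
        have "c L n \<le> (if n < k then \<theta> * real L powr (- \<gamma>) * 2 * (real n + 1) powr \<kappa> else 0)
           + real n * W L n * exp (- s L * real n) / real k" if n: "n \<le> N L" for n
        proof (cases "n < k")
          case True
          have "c L n \<le> \<theta> / real L powr \<gamma> * (real n + 1) powr \<kappa> * 2 * 1"
            unfolding c_def using \<theta> \<delta>_le_err[OF n] L by (intro mult_mono mult_left_mono) auto
          moreover have "real n * W L n * exp (- s L * real n) / real k \<ge> 0"
            using W_pos[OF L(1), of n] by simp
          ultimately show ?thesis using True by (simp add: powr_minus divide_inverse mult_ac)
        next
          case False
          have "c L n \<le> W L n * exp (- s L * real n)"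
            unfolding c_def W_eq[OF L(1)] using w_nonneg[of n] by (simp add: algebra_simps)
          also have "\<dots> \<le> real n / real k * (W L n * exp (- s L * real n))"
            using False k W_pos[OF L(1), of n] by (auto simp: field_simps)
          finally show ?thesis using False by simp
        qed
        then have "(\<Sum>n\<le>N L. c L n) \<le> (\<Sum>n\<le>N L. (if n < k then \<theta> * real L powr (- \<gamma>) * 2 * (real n + 1) powr \<kappa> else 0)
           + real n * W L n * exp (- s L * real n) / real k)"
          by (intro sum_mono) auto
        also have "\<dots> = (\<Sum>n\<le>N L. if n < k then \<theta> * real L powr (- \<gamma>) * 2 * (real n + 1) powr \<kappa> else 0)
           + T (\<lambda>x. 1) L (s L) / real k"
          by (simp add: sum.distrib T_def sum_divide_distrib)
        also have "(\<Sum>n\<le>N L. if n < k then \<theta> * real L powr (- \<gamma>) * 2 * (real n + 1) powr \<kappa> else 0)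
           = (\<Sum>n\<in>{..N L} \<inter> {..<k}. \<theta> * real L powr (- \<gamma>) * 2 * (real n + 1) powr \<kappa>)"
          by (subst sum.inter_restrict) (auto intro!: sum.cong)
        also have "\<dots> \<le> (\<Sum>n<k. \<theta> * real L powr (- \<gamma>) * 2 * (real n + 1) powr \<kappa>)"
          using \<theta> by (intro sum_mono2) auto
        also have "\<dots> = \<theta> * real L powr (- \<gamma>) * (2 * S)"
          by (simp add: S_def sum_distrib_left mult.assoc)
        also have "T (\<lambda>x. 1) L (s L) / real k \<le> B / real k"
          using L by (intro divide_right_mono) auto
        also have "B / real k < e / 2"
          using k e by (simp add: field_simps)
        finally show ?case using elim by simp
      qed
    }
  qed
  have "(\<lambda>L. (\<Sum>n\<le>N L. w n * exp (- s L * real n) * 1) + (\<Sum>n\<le>N L. c L n)) \<longlonglongrightarrow> 1 * 1 + 0"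
    by (intro tendsto_add bulk c0)
  moreover have "\<forall>\<^sub>F L in sequentially. P L (s L) =
     (\<Sum>n\<le>N L. w n * exp (- s L * real n) * 1) + (\<Sum>n\<le>N L. c L n)"
    using eventually_ge_at_top[of 1]
    by eventually_elim (simp add: P_def W_eq c_def sum.distrib[symmetric] algebra_simps)
  ultimately show ?thesis by (subst tendsto_cong) auto
qed

text \<open>At \<open>s = a / C\<close> the tilted mean tends to
  \<open>\<rho>c + (\<rho> - \<rho>c) * a powr (- (\<kappa> + 2))\<close>, which lies above
  \<open>\<rho>\<close> for \<open>a = 1 / 2\<close> and below it for \<open>a = 2\<close>. As
  \<open>N / L\<close> tends to \<open>\<rho>\<close>, the intermediate value theorem yields an
  exact solution in between.\<close>

lemma tilt_exists:
  obtains s where "(\<lambda>L. s L * C L) \<longlonglongrightarrow> 1"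
    and "\<forall>\<^sub>F L in sequentially. T (\<lambda>x. 1) L (s L) = real (N L) / real L * P L (s L)"
proof -
  define R where "R = (\<lambda>L s. T (\<lambda>x. 1) L s / P L s)"
  have Rlim: "(\<lambda>L. R L (a / C L)) \<longlonglongrightarrow> \<rho>c + (\<rho> - \<rho>c) * a powr (- (\<kappa> + 2))" if a: "a > 0" for a
  proof -
    have ev: "\<forall>\<^sub>F L in sequentially. a / C L * C L = a"
      using eventually_ge_at_top[of 1] by eventually_elim (use C_pos in force)
    then have lim: "(\<lambda>L. a / C L * C L) \<longlonglongrightarrow> a" by (rule tendsto_eventually)
    then have cmp: "comparable (\<lambda>L. a / C L)" using a by (rule comparable_tendsto)
    have "(\<lambda>L. (\<rho> - \<rho>c) * (a / C L * C L) powr (- (\<kappa> + 2))) \<longlonglongrightarrow> (\<rho> - \<rho>c) * a powr (- (\<kappa> + 2))"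
      using a by (intro tendsto_intros lim) auto
    from tendsto_add[OF T_one_tendsto[OF cmp] this]
    have "(\<lambda>L. T (\<lambda>x. 1) L (a / C L)) \<longlonglongrightarrow> \<rho>c + (\<rho> - \<rho>c) * a powr (- (\<kappa> + 2))" by simp
    from tendsto_divide[OF this P_tendsto[OF cmp]] show ?thesis by (simp add: R_def)
  qed
  have P_pos: "P L s > 0" if "L \<ge> 1" for L s
    unfolding P_def using W_pos[OF that] by (intro sum_pos) auto
  have pow: "(2::real) powr (- (\<kappa> + 2)) < 1" "1 < (1 / 2) powr (- (\<kappa> + 2))"
    using gr_one_powr[of 2 "\<kappa> + 2"] \<kappa> by (simp_all only: powr_minus_divide powr_divide) (auto simp: field_simps)
  have up: "\<rho> < \<rho>c + (\<rho> - \<rho>c) * (1 / 2) powr (- (\<kappa> + 2))"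
    using mult_strict_left_mono[OF pow(2), of "\<rho> - \<rho>c"] \<rho> by (simp only: mult_1_right) linarith
  have down: "\<rho>c + (\<rho> - \<rho>c) * 2 powr (- (\<kappa> + 2)) < \<rho>"
    using mult_strict_left_mono[OF pow(1), of "\<rho> - \<rho>c"] \<rho> by (simp only: mult_1_right) linarith
  \<comment> \<open>\<open>u\<close> and \<open>l\<close> separate the two end values from
    \<open>\<rho>\<close>, so that the order at the ends holds eventually with
    \<open>N L / L\<close> in place of \<open>\<rho>\<close>.\<close>
  obtain u where u: "\<rho> < u" "u < \<rho>c + (\<rho> - \<rho>c) * (1 / 2) powr (- (\<kappa> + 2))" using up dense by blast
  obtain l where l: "l < \<rho>" "\<rho>c + (\<rho> - \<rho>c) * 2 powr (- (\<kappa> + 2)) < l" using down dense by blast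
  have half: "(1 / 2 :: real) > 0" and two: "(2 :: real) > 0" by auto
  define good where "good = (\<lambda>L s. 1 / 2 \<le> s * C L \<and> s * C L \<le> 2 \<and> R L s = real (N L) / real L)"
  define s where "s = (\<lambda>L. SOME s. good L s)"
  have "\<forall>\<^sub>F L in sequentially. \<exists>s. good L s"
    using eventually_ge_at_top[of 1] order_tendstoD(1)[OF Rlim[OF half] u(2)] order_tendstoD(2)[OF Rlim[OF two] l(2)]
      order_tendstoD(1)[OF N_density l(1)] order_tendstoD(2)[OF N_density u(1)]
  proof (eventually_elim, goal_cases)
    case (1 L)
    have Cp: "C L > 0" using C_pos 1 by simp
    have "\<exists>x. (1 / 2) / C L \<le> x \<and> x \<le> 2 / C L \<and> R L x = real (N L) / real L"
    proof (rule IVT2')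
      show "continuous_on {1 / 2 / C L..2 / C L} (R L)"
        unfolding R_def T_def
      proof (intro continuous_intros ballI)
        show "continuous_on {1 / 2 / C L..2 / C L} (P L)"
          unfolding P_def by (intro continuous_intros)
        show "P L x \<noteq> 0" for x using P_pos[OF 1(1), of x] by simp
      qed
          show "1 / 2 / C L \<le> 2 / C L" using Cp by (simp add: field_simps)
    qed (use 1 in auto)
    then show ?case using Cp by (auto simp: good_def field_simps)
  qed
  then have good: "\<forall>\<^sub>F L in sequentially. good L (s L)"
    by eventually_elim (simp add: s_def someI_ex)
  have cmp: "comparable s"
    unfolding comparable_def by (rule exI[of _ "1/2"], simp, rule exI[of _ 2])
      (use good in \<open>auto simp: good_def elim: eventually_mono\<close>)
  have Teq: "\<forall>\<^sub>F L in sequentially. T (\<lambda>x. 1) L (s L) = real (N L) / real L * P L (s L)"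
    using good eventually_ge_at_top[of 1]
  proof eventually_elim
    case (elim L)
    then have "T (\<lambda>x. 1) L (s L) / P L (s L) = real (N L) / real L"
      by (simp add: good_def R_def)
    then show ?case using P_pos[of L "s L"] elim by (simp add: field_simps)
  qed
  \<comment> \<open>Now the mean condition identifies the limit: it forces \<open>T\<close> to tend
    to \<open>\<rho>\<close>, while the bracket alone already determines \<open>T\<close> as a
    function of \<open>s C\<close> up to a vanishing error. Comparing the two gives
    \<open>s C\<close> tending to 1.\<close>
  have "(\<lambda>L. real (N L) / real L * P L (s L)) \<longlonglongrightarrow> \<rho> * 1"
    by (intro tendsto_mult N_density P_tendsto cmp)
  then have "(\<lambda>L. T (\<lambda>x. 1) L (s L)) \<longlonglongrightarrow> \<rho>"
    using Teq by (subst tendsto_cong) auto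
  from tendsto_diff[OF this T_one_tendsto[OF cmp]]
  have "(\<lambda>L. (\<rho> - \<rho>c) * (s L * C L) powr (- (\<kappa> + 2))) \<longlonglongrightarrow> \<rho> - \<rho>c" by simp
  from tendsto_divide[OF this tendsto_const[of "\<rho> - \<rho>c"]]
  have "(\<lambda>L. (s L * C L) powr (- (\<kappa> + 2))) \<longlonglongrightarrow> 1" using \<rho> by simp
  then have "(\<lambda>L. ((s L * C L) powr (- (\<kappa> + 2))) powr (- 1 / (\<kappa> + 2))) \<longlonglongrightarrow> 1 powr (- 1 / (\<kappa> + 2))"
    by (intro tendsto_intros) auto
  moreover have "\<forall>\<^sub>F L in sequentially. ((s L * C L) powr (- (\<kappa> + 2))) powr (- 1 / (\<kappa> + 2)) = s L * C L"
    using good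
  proof eventually_elim
    case (elim L)
    have "- (\<kappa> + 2) * (- 1 / (\<kappa> + 2)) = 1" using \<kappa> by (simp add: divide_simps)
    then show ?case using elim by (simp only: powr_powr) (auto simp: good_def)
  qed
  ultimately have "(\<lambda>L. s L * C L) \<longlonglongrightarrow> 1"
    by (simp add: tendsto_cong)
  then show ?thesis using Teq that by blast
qed

end

section \<open>Characteristic sums and Fourier inversion\<close>


text \<open>Jordan's inequality: a concave function lies above its chord.\<close>

lemma sin_ge_two_over_pi:
  assumes "0 \<le> x" "x \<le> pi / 2" shows "sin x \<ge> 2 / pi * x"
proof -
  have "concave_on {0..pi / 2} sin"
    by (rule f''_le0_imp_concave[where f' = cos and f'' = "\<lambda>x. - sin x"])
       (auto intro!: derivative_eq_intros sin_ge_zero)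
  from concave_onD_Icc'[OF this, of x] assms show ?thesis by simp
qed

text \<open>The half-angle formula together with Jordan's inequality, where \<open>2 / pi\<close> is
  weakened to \<open>1 / 2\<close>; this is the origin of the 8.\<close>

lemma cos_le_quadratic:
  assumes "\<bar>x\<bar> \<le> pi" shows "cos x \<le> 1 - x\<^sup>2 / 8"
proof -
  have s: "sin \<bar>x / 2\<bar> \<ge> \<bar>x / 2\<bar> / 2"
  proof -
    have "1 / 2 \<le> 2 / pi" using pi_less_4 by (simp add: field_simps)
    from mult_right_mono[OF this, of "\<bar>x / 2\<bar>"] have "1 / 2 * \<bar>x / 2\<bar> \<le> 2 / pi * \<bar>x / 2\<bar>" by simp
    also have "\<dots> \<le> sin \<bar>x / 2\<bar>" using assms by (intro sin_ge_two_over_pi) auto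
    finally show ?thesis by simp
  qed
  have "cos x = cos (2 * \<bar>x / 2\<bar>)" by (cases "x \<ge> 0") auto
  also have "\<dots> = 1 - 2 * (sin \<bar>x / 2\<bar>)\<^sup>2" by (rule cos_double_sin)
  also have "\<dots> \<le> 1 - 2 * (\<bar>x / 2\<bar> / 2)\<^sup>2"
    using power_mono[OF s, of 2] by simp
  also have "\<dots> = 1 - x\<^sup>2 / 8" by (simp add: power_divide)
  finally show ?thesis .
qed

lemma norm_one_plus_cis: "norm (1 + cis x) = 2 * \<bar>cos (x / 2)\<bar>"
proof -
  have "1 + cis x = cis (x / 2) * (2 * of_real (cos (x / 2)))"
    by (auto simp: complex_eq_iff cos_double_cos[of "x / 2", simplified] sin_double[of "x / 2", simplified] power2_eq_square)
  then show ?thesis by (simp add: norm_mult)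
qed

lemma norm_one_minus_cis: "norm (1 - cis x) = 2 * \<bar>sin (x / 2)\<bar>"
  using dist_exp_i_1[of x] by (simp add: cis_conv_exp norm_minus_commute)

text \<open>Near the origin the terms \<open>k\<close> and \<open>k + B\<close> are paired; far from it the sum is geometric.\<close>

lemma norm_sum_cis_le:
  fixes B :: nat and K \<xi> :: real
  assumes B: "B > 0" "0 \<le> K" "K \<le> real B" and \<xi>: "\<bar>\<xi>\<bar> \<le> pi"
  shows "norm (\<Sum>k<2*B. cis (real k * \<xi>)) \<le> 2 * real B * (1 - min 1 ((K * \<xi>)\<^sup>2) / 32)"
proof (cases "real B * \<bar>\<xi>\<bar> \<le> pi")
  case True
  have "(\<Sum>k<2*B. cis (real k * \<xi>)) = (\<Sum>k<B. cis (real k * \<xi>)) + (\<Sum>k=B..<2*B. cis (real k * \<xi>))"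
    by (simp add: lessThan_atLeast0 sum.atLeastLessThan_concat)
  also have "(\<Sum>k=B..<2*B. cis (real k * \<xi>)) = (\<Sum>k<B. cis (real (k + B) * \<xi>))"
    using sum.shift_bounds_nat_ivl[of "\<lambda>k. cis (real k * \<xi>)" 0 B B] by (simp add: lessThan_atLeast0 mult_2)
  also have "(\<Sum>k<B. cis (real k * \<xi>)) + \<dots> = (\<Sum>k<B. cis (real k * \<xi>) * (1 + cis (real B * \<xi>)))"
    by (simp add: sum.distrib[symmetric] cis_mult distrib_left distrib_right)
  also have "norm \<dots> \<le> (\<Sum>k<B. 2 * \<bar>cos (real B * \<xi> / 2)\<bar>)"
    by (rule order_trans[OF norm_sum]) (simp add: norm_mult norm_one_plus_cis)
  also have "\<dots> = 2 * real B * cos (real B * \<xi> / 2)"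
  proof -
    have "\<bar>real B * \<xi> / 2\<bar> \<le> pi / 2" using True by (simp add: abs_mult)
    then have "cos (real B * \<xi> / 2) \<ge> 0" by (intro cos_ge_zero) linarith+
    then show ?thesis by simp
  qed
  \<comment> \<open>Half the angle in the quadratic bound turns the 8 into the 32 of the
    statement.\<close>
  also have "\<dots> \<le> 2 * real B * (1 - (real B * \<xi> / 2)\<^sup>2 / 8)"
  proof -
    have "\<bar>real B * \<xi> / 2\<bar> \<le> pi / 2" using True by (simp add: abs_mult)
    then have "\<bar>real B * \<xi> / 2\<bar> \<le> pi" using pi_gt_zero by linarith
    then show ?thesis by (intro mult_left_mono cos_le_quadratic) auto
  qed
  also have "\<dots> \<le> 2 * real B * (1 - min 1 ((K * \<xi>)\<^sup>2) / 32)"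
  proof -
    have "(K * \<xi>)\<^sup>2 \<le> (real B * \<xi>)\<^sup>2"
      using B by (simp add: power_mult_distrib mult_right_mono power_mono)
    then show ?thesis by (intro mult_left_mono) (auto simp: power_divide)
  qed
  finally show ?thesis .
next
  case False
  then have "\<xi> \<noteq> 0" by auto
  have s: "2 * \<bar>sin (\<xi> / 2)\<bar> \<ge> 2 / pi * \<bar>\<xi>\<bar>"
  proof -
    have "sin \<bar>\<xi> / 2\<bar> \<ge> 2 / pi * \<bar>\<xi> / 2\<bar>" using \<xi> by (intro sin_ge_two_over_pi) auto
    moreover have "sin \<bar>\<xi> / 2\<bar> \<le> \<bar>sin (\<xi> / 2)\<bar>" by (cases "\<xi> \<ge> 0") auto
    ultimately have "2 / pi * \<bar>\<xi> / 2\<bar> \<le> \<bar>sin (\<xi> / 2)\<bar>" by linarith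
    then show ?thesis by simp
  qed
  have sp: "2 / pi * \<bar>\<xi>\<bar> > 0" using \<open>\<xi> \<noteq> 0\<close> by simp
  then have ne: "cis \<xi> \<noteq> 1" using s norm_one_minus_cis[of \<xi>] by auto
  have "(\<Sum>k<2*B. cis (real k * \<xi>)) = (\<Sum>k<2*B. cis \<xi> ^ k)"
    by (intro sum.cong) (simp_all only: Complex.DeMoivre)
  also have "\<dots> = (1 - cis \<xi> ^ (2 * B)) / (1 - cis \<xi>)"
    using ne by (simp add: sum_gp_strict)
  finally have "norm (\<Sum>k<2*B. cis (real k * \<xi>)) = norm (1 - cis \<xi> ^ (2 * B)) / (2 * \<bar>sin (\<xi> / 2)\<bar>)"
    by (simp add: norm_divide norm_one_minus_cis)
  also have "\<dots> \<le> 2 / (2 / pi * \<bar>\<xi>\<bar>)"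
  proof (rule frac_le)
    show "norm (1 - cis \<xi> ^ (2 * B)) \<le> 2"
      using norm_triangle_ineq4[of 1 "cis \<xi> ^ (2 * B)"] by (simp add: norm_power)
  qed (use s sp in auto)
  \<comment> \<open>In this range the geometric sum is at most \<open>B\<close>, half of the trivial
    bound \<open>2 B\<close>, so the factor \<open>1 - 1 / 32\<close> holds with much room.\<close>
  also have "\<dots> = pi / \<bar>\<xi>\<bar>" by simp
  also have "\<dots> \<le> real B" using False \<open>\<xi> \<noteq> 0\<close> by (simp add: field_simps)
  also have "\<dots> \<le> 2 * real B * (1 - 1 / 32)" by simp
  also have "\<dots> \<le> 2 * real B * (1 - min 1 ((K * \<xi>)\<^sup>2) / 32)"
    by (intro mult_left_mono) auto
  finally show ?thesis .
qed

text \<open>Peel a constant layer of height \<open>b\<close> off the block. The remaining weights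
  are nonnegative and are estimated trivially; all cancellation comes from the layer, whose mass
  \<open>2 b B\<close> times \<open>1 / 32\<close> is the gain.\<close>

lemma norm_weighted_sum_cis_le:
  fixes a :: "nat \<Rightarrow> real" and b K :: real and B :: nat
  assumes a: "\<And>k. k \<le> M \<Longrightarrow> a k \<ge> 0" and b: "b \<ge> 0" "\<And>k. k0 \<le> k \<Longrightarrow> k < k0 + 2 * B \<Longrightarrow> b \<le> a k"
    and M: "k0 + 2 * B \<le> M + 1" and B: "B > 0" "0 \<le> K" "K \<le> real B" and \<xi>: "\<bar>\<xi>\<bar> \<le> pi"
  shows "norm (\<Sum>k\<le>M. of_real (a k) * cis (real k * \<xi>))
    \<le> (\<Sum>k\<le>M. a k) - b * real B / 16 * min 1 ((K * \<xi>)\<^sup>2)"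
proof -
  let ?I = "{k0..<k0 + 2 * B}"
  have sub: "?I \<subseteq> {..M}" using M by auto
  define r where "r = (\<lambda>k. a k - b * indicator ?I k)"
  have r: "r k \<ge> 0" if "k \<le> M" for k
    using a[OF that] b(2)[of k] by (auto simp: r_def indicator_def)
  have block: "norm (\<Sum>k\<in>?I. cis (real k * \<xi>)) \<le> 2 * real B * (1 - min 1 ((K * \<xi>)\<^sup>2) / 32)"
  proof -
    have "(\<Sum>k\<in>?I. cis (real k * \<xi>)) = (\<Sum>k<2*B. cis (real (k + k0) * \<xi>))"
      using sum.shift_bounds_nat_ivl[of "\<lambda>k. cis (real k * \<xi>)" 0 k0 "2 * B"]
      by (simp add: lessThan_atLeast0 add.commute)
    also have "\<dots> = cis (real k0 * \<xi>) * (\<Sum>k<2*B. cis (real k * \<xi>))"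
      by (simp add: sum_distrib_left cis_mult algebra_simps)
    also have "norm \<dots> = norm (\<Sum>k<2*B. cis (real k * \<xi>))" by (simp add: norm_mult)
    finally show ?thesis using norm_sum_cis_le[OF B \<xi>] by simp
  qed
  have ind: "(\<Sum>k\<le>M. indicator ?I k * f k) = (\<Sum>k\<in>?I. f k)" for f :: "nat \<Rightarrow> 'x::real_algebra_1"
    by (rule sum.mono_neutral_cong_right) (use sub in auto)
  have "(\<Sum>k\<le>M. of_real (a k) * cis (real k * \<xi>)) =
     (\<Sum>k\<le>M. of_real (r k) * cis (real k * \<xi>)) + of_real b * (\<Sum>k\<le>M. indicator ?I k * cis (real k * \<xi>))"
    unfolding sum_distrib_left sum.distrib[symmetric]
    by (intro sum.cong) (auto simp: r_def indicator_def algebra_simps)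
  also have "norm \<dots> \<le> (\<Sum>k\<le>M. r k) + b * (2 * real B * (1 - min 1 ((K * \<xi>)\<^sup>2) / 32))"
  proof (rule norm_triangle_mono)
    show "norm (\<Sum>k\<le>M. of_real (r k) * cis (real k * \<xi>)) \<le> (\<Sum>k\<le>M. r k)"
      by (rule order_trans[OF norm_sum]) (use r in \<open>auto simp: norm_mult intro!: sum_mono\<close>)
    show "norm (of_real b * (\<Sum>k\<le>M. indicator ?I k * cis (real k * \<xi>))) \<le> b * (2 * real B * (1 - min 1 ((K * \<xi>)\<^sup>2) / 32))"
      unfolding ind using block b by (simp add: norm_mult mult_left_mono)
  qed
  also have "(\<Sum>k\<le>M. r k) = (\<Sum>k\<le>M. a k) - b * (2 * real B)"
    using ind[of "\<lambda>_. 1::real"] by (simp add: r_def sum_subtractf sum_distrib_left[symmetric])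
  finally show ?thesis by (simp add: algebra_simps)
qed

text \<open>The canonical partition function over an arbitrary set of sites, so that fixing the
  entries at some sites leaves an object of the same kind on the others.\<close>

definition partition_sum :: "(nat \<Rightarrow> real) \<Rightarrow> 'a set \<Rightarrow> nat \<Rightarrow> real" where
  "partition_sum v A n = (\<Sum>\<eta>\<in>{\<eta> \<in> A \<rightarrow>\<^sub>E UNIV. sum \<eta> A = n}. \<Prod>x\<in>A. v (\<eta> x))"

lemma prod_cis: "finite A \<Longrightarrow> (\<Prod>x\<in>A. cis (f x)) = cis (sum f A)"
  by (induction A rule: finite_induct) (auto simp: cis_mult)

lemma integral_cis_int:
  "(\<integral>\<xi>. indicator {-pi..pi} \<xi> *\<^sub>R cis (of_int k * \<xi>) \<partial>lborel) = (if k = 0 then 2 * pi else 0)"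
proof (cases "k = 0")
  case True
  then show ?thesis by (simp add: scaleR_conv_of_real)
next
  case False
  let ?F = "\<lambda>\<xi>. cis (of_int k * \<xi>) / (\<i> * of_int k)"
  have "(\<integral>\<xi>. indicator {-pi..pi} \<xi> *\<^sub>R cis (of_int k * \<xi>) \<partial>lborel) = ?F pi - ?F (- pi)"
  proof (rule integral_FTC_atLeastAtMost)
    fix x
    have "((\<lambda>z. exp (\<i> * of_int k * z) / (\<i> * of_int k)) has_field_derivative
        exp (\<i> * of_int k * of_real x)) (at (of_real x))"
      using False by (auto intro!: derivative_eq_intros)
    from has_vector_derivative_real_field[OF this]
    show "(?F has_vector_derivative cis (of_int k * x)) (at x within {-pi..pi})"
      by (simp add: cis_conv_exp mult.assoc)
  qed (auto intro!: continuous_intros)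
  also have "cis (of_int k * pi) = cis (of_int k * (- pi))"
    by (auto simp: complex_eq_iff sin_zero_iff_int2)
  finally show ?thesis using False by simp
qed

text \<open>Coefficient extraction from a generating polynomial: expand the power over all maps from
  \<open>A\<close> to \<open>{..M}\<close>, and let orthogonality of the characters select total
  mass \<open>n\<close>. As \<open>n \<le> M\<close>, cutting the entries at \<open>M\<close> loses
  no configuration of that mass.\<close>

lemma partition_sum_fourier:
  assumes A: "finite A" and n: "n \<le> M"
  shows "(\<integral>\<xi>. indicator {-pi..pi} \<xi> *\<^sub>R
      ((\<Sum>k\<le>M. of_real (a k) * cis (real k * \<xi>)) ^ card A * cis (- (real n * \<xi>))) \<partial>lborel)
    = of_real (2 * pi * partition_sum a A n)"
proof -
  let ?G = "A \<rightarrow>\<^sub>E {..M}"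
  have fin: "finite ?G" using A by (intro finite_PiE) auto
  have "(\<Sum>k\<le>M. of_real (a k) * cis (real k * \<xi>)) ^ card A * cis (- (real n * \<xi>))
     = (\<Sum>g\<in>?G. of_real (\<Prod>x\<in>A. a (g x)) * cis (of_int (int (sum g A) - int n) * \<xi>))" for \<xi>
  proof -
    have "(\<Sum>k\<le>M. of_real (a k) * cis (real k * \<xi>)) ^ card A
      = (\<Prod>x\<in>A. \<Sum>k\<le>M. of_real (a k) * cis (real k * \<xi>))" by simp
    also have "\<dots> = (\<Sum>g\<in>?G. \<Prod>x\<in>A. of_real (a (g x)) * cis (real (g x) * \<xi>))"
      by (rule prod_sum_PiE[OF A]) auto
    also have "\<dots> = (\<Sum>g\<in>?G. of_real (\<Prod>x\<in>A. a (g x)) * cis (real (sum g A) * \<xi>))"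
      using A by (simp add: prod.distrib prod_cis sum_distrib_right)
    finally show ?thesis
      by (simp add: sum_distrib_right mult.assoc cis_mult left_diff_distrib)
  qed
  then have "(\<integral>\<xi>. indicator {-pi..pi} \<xi> *\<^sub>R
      ((\<Sum>k\<le>M. of_real (a k) * cis (real k * \<xi>)) ^ card A * cis (- (real n * \<xi>))) \<partial>lborel)
    = (\<integral>\<xi>. (\<Sum>g\<in>?G. of_real (\<Prod>x\<in>A. a (g x)) *
        (indicator {-pi..pi} \<xi> *\<^sub>R cis (of_int (int (sum g A) - int n) * \<xi>))) \<partial>lborel)"
    by (simp only: scaleR_sum_right mult_scaleR_right)
  also have "\<dots> = (\<Sum>g\<in>?G. of_real (\<Prod>x\<in>A. a (g x)) *
     (\<integral>\<xi>. indicator {-pi..pi} \<xi> *\<^sub>R cis (of_int (int (sum g A) - int n) * \<xi>) \<partial>lborel))"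
  proof (subst Bochner_Integration.integral_sum)
    fix g
    have "integrable lborel (\<lambda>\<xi>. indicator {-pi..pi} \<xi> *\<^sub>R cis (of_int (int (sum g A) - int n) * \<xi>))"
      by (intro borel_integrable_compact) (auto intro!: continuous_intros)
    then show "integrable lborel (\<lambda>\<xi>. of_real (\<Prod>x\<in>A. a (g x)) *
        (indicator {-pi..pi} \<xi> *\<^sub>R cis (of_int (int (sum g A) - int n) * \<xi>)))"
      by (rule integrable_mult_right)
  qed (simp only: integral_mult_right_zero)
  also have "\<dots> = (\<Sum>g\<in>?G. if sum g A = n then of_real (2 * pi * (\<Prod>x\<in>A. a (g x))) else 0)"
    unfolding integral_cis_int by (intro sum.cong) (auto simp del: of_nat_sum)
  also have "\<dots> = (\<Sum>g\<in>{g\<in>?G. sum g A = n}. of_real (2 * pi * (\<Prod>x\<in>A. a (g x))))"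
    by (rule sum.inter_filter[OF fin, symmetric])
  also have "{g\<in>?G. sum g A = n} = {g \<in> A \<rightarrow>\<^sub>E UNIV. sum g A = n}"
  proof -
    have "g x \<le> M" if "sum g A = n" "x \<in> A" for g x
      using member_le_sum[of x A g] that A n by auto
    then show ?thesis by (auto simp: PiE_iff)
  qed
  finally show ?thesis by (simp add: partition_sum_def sum_distrib_left)
qed

text \<open>On configurations of fixed mass the tilt is a constant factor, which is why the
  canonical measure does not depend on it.\<close>

lemma partition_sum_tilt:
  "partition_sum (\<lambda>k. v k * exp (- s * real k)) A n = exp (- s * real n) * partition_sum v A n"
proof (cases "finite A")
  case True
  have "(\<Prod>x\<in>A. exp (- (s * real (\<eta> x)))) = exp (- (s * real (sum \<eta> A)))" for \<eta>
    using True by (simp add: exp_sum[symmetric] sum_distrib_left sum_negf)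
  then show ?thesis
    by (auto simp: partition_sum_def prod.distrib sum_distrib_left intro!: sum.cong)
next
  case False
  then show ?thesis by (auto simp: partition_sum_def sum_distrib_left intro!: sum.cong)
qed

lemma partition_sum_scale:
  "partition_sum (\<lambda>k. v k / c) A n = partition_sum v A n / c ^ card A"
  by (simp add: partition_sum_def prod_dividef sum_divide_distrib)

section \<open>A local limit theorem\<close>


lemma abs_exp_minus_linear_le:
  assumes "(y::real) \<ge> 0" shows "\<bar>exp (- y) - (1 - y)\<bar> \<le> y\<^sup>2"
proof -
  have "exp (- y) \<ge> 1 - y" using exp_ge_add_one_self[of "- y"] by simp
  moreover have "exp (- y) \<le> 1 / (1 + y)"
    using exp_ge_add_one_self[of y] assms by (simp add: exp_minus inverse_eq_divide frac_le)
  moreover have "1 / (1 + y) - (1 - y) = y\<^sup>2 / (1 + y)"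
    using assms by (simp add: field_simps power2_eq_square)
  moreover have "y\<^sup>2 / (1 + y) \<le> y\<^sup>2 / 1" using assms by (intro divide_left_mono) auto
  ultimately show ?thesis by simp
qed

text \<open>Taylor expansion to third order; centring at the mean removes the linear term. Since
  \<open>real k\<close> and \<open>\<mu>\<close> are nonnegative, the cube of their distance is at
  most the sum of their cubes.\<close>

lemma norm_sum_cis_centered_le:
  fixes p :: "nat \<Rightarrow> real"
  assumes p: "\<And>k. k \<le> M \<Longrightarrow> p k \<ge> 0" "(\<Sum>k\<le>M. p k) = 1" "(\<Sum>k\<le>M. p k * real k) = \<mu>"
  defines "v \<equiv> (\<Sum>k\<le>M. p k * real k ^ 2) - \<mu>\<^sup>2"
  shows "norm ((\<Sum>k\<le>M. of_real (p k) * cis ((real k - \<mu>) * \<xi>)) - of_real (1 - v * \<xi>\<^sup>2 / 2))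
     \<le> \<bar>\<xi>\<bar> ^ 3 * ((\<Sum>k\<le>M. p k * real k ^ 3) + \<mu> ^ 3) / 6" and "v \<ge> 0"
proof -
  have \<mu>: "\<mu> \<ge> 0" using p(1) by (auto simp: p(3)[symmetric] intro!: sum_nonneg)
  have v: "v = (\<Sum>k\<le>M. p k * (real k - \<mu>)\<^sup>2)"
  proof -
    have "(\<Sum>k\<le>M. p k * (real k - \<mu>)\<^sup>2) = (\<Sum>k\<le>M. p k * real k ^ 2 - 2 * \<mu> * (p k * real k) + \<mu>\<^sup>2 * p k)"
      by (intro sum.cong) (auto simp: power2_eq_square algebra_simps)
    also have "\<dots> = (\<Sum>k\<le>M. p k * real k ^ 2) - 2 * \<mu> * \<mu> + \<mu>\<^sup>2 * 1"
      by (simp only: sum.distrib sum_subtractf sum_distrib_left[symmetric] p)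
    finally show ?thesis by (simp add: v_def power2_eq_square)
  qed
  then show "v \<ge> 0" using p(1) by (auto intro!: sum_nonneg)
  have c0: "(\<Sum>k\<le>M. p k * (real k - \<mu>)) = 0"
  proof -
    have "(\<Sum>k\<le>M. p k * (real k - \<mu>)) = (\<Sum>k\<le>M. p k * real k) - \<mu> * (\<Sum>k\<le>M. p k)"
      by (simp add: sum_subtractf sum_distrib_left algebra_simps)
    then show ?thesis using p by simp
  qed
  have step: "norm (cis x - (1 + \<i> * of_real x - of_real (x\<^sup>2 / 2))) \<le> \<bar>x\<bar> ^ 3 / 6" for x
    using iexp_approx1[of x 2]
    by (simp add: cis_conv_exp numeral_eq_Suc power2_eq_square algebra_simps)
  have cube: "\<bar>real k - \<mu>\<bar> ^ 3 \<le> real k ^ 3 + \<mu> ^ 3" for k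
  proof (cases "real k \<ge> \<mu>")
    case True
    then have "\<bar>real k - \<mu>\<bar> ^ 3 \<le> real k ^ 3" using \<mu> by (intro power_mono) auto
    then show ?thesis using \<mu> by (simp add: add_increasing2)
  next
    case False
    then have "\<bar>real k - \<mu>\<bar> ^ 3 \<le> \<mu> ^ 3" using \<mu> by (intro power_mono) auto
    then show ?thesis using \<mu> by (simp add: add_increasing)
  qed
  have "(\<Sum>k\<le>M. of_real (p k) * (1 + \<i> * of_real ((real k - \<mu>) * \<xi>) - of_real (((real k - \<mu>) * \<xi>)\<^sup>2 / 2)))
    = of_real (\<Sum>k\<le>M. p k) + \<i> * of_real \<xi> * of_real (\<Sum>k\<le>M. p k * (real k - \<mu>))
       - of_real (\<xi>\<^sup>2 / 2) * of_real (\<Sum>k\<le>M. p k * (real k - \<mu>)\<^sup>2)"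
    unfolding of_real_sum sum_distrib_left sum.distrib[symmetric] sum_subtractf[symmetric]
    by (intro sum.cong) (auto simp: complex_eq_iff power2_eq_square field_simps)
  also have "\<dots> = of_real (1 - v * \<xi>\<^sup>2 / 2)"
    by (simp add: p c0 v[symmetric])
  finally have "(\<Sum>k\<le>M. of_real (p k) * cis ((real k - \<mu>) * \<xi>)) - of_real (1 - v * \<xi>\<^sup>2 / 2)
     = (\<Sum>k\<le>M. of_real (p k) * (cis ((real k - \<mu>) * \<xi>) -
         (1 + \<i> * of_real ((real k - \<mu>) * \<xi>) - of_real (((real k - \<mu>) * \<xi>)\<^sup>2 / 2))))"
    by (simp only: right_diff_distrib sum_subtractf)
  also have "norm \<dots> \<le> (\<Sum>k\<le>M. p k * (\<bar>\<xi>\<bar> ^ 3 * (real k ^ 3 + \<mu> ^ 3) / 6))"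
  proof (rule sum_norm_le, unfold norm_mult)
    fix k assume "k \<in> {..M}"
    then have pk: "p k \<ge> 0" using p(1) by auto
    have "\<bar>(real k - \<mu>) * \<xi>\<bar> ^ 3 / 6 \<le> \<bar>\<xi>\<bar> ^ 3 * (real k ^ 3 + \<mu> ^ 3) / 6"
      using cube[of k] by (simp add: abs_mult power_mult_distrib mult.commute mult_left_mono)
    then show "norm (complex_of_real (p k)) * norm (cis ((real k - \<mu>) * \<xi>) -
         (1 + \<i> * of_real ((real k - \<mu>) * \<xi>) - of_real (((real k - \<mu>) * \<xi>)\<^sup>2 / 2)))
        \<le> p k * (\<bar>\<xi>\<bar> ^ 3 * (real k ^ 3 + \<mu> ^ 3) / 6)"
      unfolding norm_of_real abs_of_nonneg[OF pk]
      by (intro mult_left_mono order_trans[OF step] pk)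
  qed
  also have "\<dots> = \<bar>\<xi>\<bar> ^ 3 * ((\<Sum>k\<le>M. p k * real k ^ 3) + (\<Sum>k\<le>M. p k) * \<mu> ^ 3) / 6"
    by (simp add: sum_distrib_left sum_distrib_right sum.distrib[symmetric] sum_divide_distrib algebra_simps add_divide_distrib)
  finally show "norm ((\<Sum>k\<le>M. of_real (p k) * cis ((real k - \<mu>) * \<xi>)) - of_real (1 - v * \<xi>\<^sup>2 / 2))
     \<le> \<bar>\<xi>\<bar> ^ 3 * ((\<Sum>k\<le>M. p k * real k ^ 3) + \<mu> ^ 3) / 6"
    by (simp add: p)
qed

lemma integral_gaussian:
  assumes "V > 0"
  shows "integrable lborel (\<lambda>u::real. exp (- (V * u\<^sup>2 / 2)))"
    and "(\<integral>u. exp (- (V * u\<^sup>2 / 2)) \<partial>lborel) = sqrt (2 * pi / V)"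
proof -
  have s: "sqrt (1 / V) > 0" using assms by simp
  have eq: "exp (- (V * u\<^sup>2 / 2)) = sqrt (2 * pi / V) * normal_density 0 (sqrt (1 / V)) u" for u
    using assms by (simp add: normal_density_def real_sqrt_divide real_sqrt_mult field_simps)
  show "integrable lborel (\<lambda>u::real. exp (- (V * u\<^sup>2 / 2)))"
    unfolding eq using integrable_normal_density[OF s] by simp
  show "(\<integral>u. exp (- (V * u\<^sup>2 / 2)) \<partial>lborel) = sqrt (2 * pi / V)"
    unfolding eq using integral_normal_density[OF s] by simp
qed

text \<open>The variance per summand grows like \<open>K\<close>, so the natural frequency unit is
  \<open>1 / sqrt (L K)\<close>. The integral is cut at \<open>1 / K\<close>: inside, rescaling and
  dominated convergence yield a Gaussian integral; outside, the modulus bound makes the rest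
  exponentially small. Third moments of order \<open>K^2\<close> suffice because
  \<open>L K^2 / (L K) powr (3 / 2)\<close> is \<open>sqrt (K / L)\<close>. Dropping
  \<open>m\<close> summands and shifting the target by \<open>j = O(K)\<close> alters the phase only
  negligibly.\<close>

lemma local_limit_theorem:
  fixes p :: "nat \<Rightarrow> nat \<Rightarrow> real" and M N j :: "nat \<Rightarrow> nat" and K :: "nat \<Rightarrow> real" and m :: nat
  defines "ch \<equiv> \<lambda>L \<xi>. \<Sum>k\<le>M L. complex_of_real (p L k) * cis (real k * \<xi>)"
  assumes p: "\<forall>\<^sub>F L in sequentially. (\<forall>k\<le>M L. p L k \<ge> 0) \<and> (\<Sum>k\<le>M L. p L k) = 1 \<and>
      (\<Sum>k\<le>M L. p L k * real k) = real (N L) / real L"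
    and K: "filterlim K at_top sequentially" "(\<lambda>L. K L / real L) \<longlonglongrightarrow> 0"
      "\<And>b. b > 0 \<Longrightarrow> (\<lambda>L. sqrt (real L * K L) * exp (- b * real L / K L)) \<longlonglongrightarrow> 0"
    and mean: "(\<lambda>L. real (N L) / real L) \<longlonglongrightarrow> \<rho>"
    and second: "(\<lambda>L. (\<Sum>k\<le>M L. p L k * real k ^ 2) / K L) \<longlonglongrightarrow> V" "V > 0"
    and third: "(\<lambda>L. (\<Sum>k\<le>M L. p L k * real k ^ 3) / (K L)\<^sup>2) \<longlonglongrightarrow> S"
    and char: "c > 0" "\<forall>\<^sub>F L in sequentially. \<forall>\<xi>. \<bar>\<xi>\<bar> \<le> pi \<longrightarrow> norm (ch L \<xi>) \<le> 1 - c / K L * min 1 ((K L * \<xi>)\<^sup>2)"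
    and j: "\<forall>\<^sub>F L in sequentially. real (j L) \<le> A * K L"
  shows "(\<lambda>L. of_real (sqrt (real L * K L)) * (\<integral>\<xi>. indicator {-pi..pi} \<xi> *\<^sub>R
      (ch L \<xi> ^ (L - m) * cis (- ((real (N L) - real (j L)) * \<xi>))) \<partial>lborel)) \<longlonglongrightarrow> complex_of_real (sqrt (2 * pi / V))"
proof -
  define \<tau> where "\<tau> = (\<lambda>L. sqrt (real L * K L))"
  define \<mu> where "\<mu> = (\<lambda>L. real (N L) / real L)"
  define F where "F = (\<lambda>L \<xi>. ch L \<xi> ^ (L - m) * cis (- ((real (N L) - real (j L)) * \<xi>)))"
  define G where "G = (\<lambda>L u. indicator {-(\<tau> L / K L)..\<tau> L / K L} u *\<^sub>R F L (u / \<tau> L))"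
  define H where "H = (\<lambda>L. \<integral>\<xi>. indicator ({-pi..pi} - {-(1 / K L)..1 / K L}) \<xi> *\<^sub>R F L \<xi> \<partial>lborel)"
  have contF: "continuous_on A (F L)" for A L
    unfolding F_def ch_def by (intro continuous_intros)
  have measF[measurable]: "F L \<in> borel_measurable borel" for L
    by (rule borel_measurable_continuous_onI[OF contF])
  have K1: "\<forall>\<^sub>F L in sequentially. K L \<ge> 1" using K(1) by (auto simp: filterlim_at_top)
  have Kj: "(\<lambda>L. K L / \<tau> L) \<longlonglongrightarrow> 0"
  proof -
    have "(\<lambda>L. sqrt (K L / real L)) \<longlonglongrightarrow> sqrt 0" by (intro tendsto_intros K)
    then have "(\<lambda>L. sqrt (K L / real L)) \<longlonglongrightarrow> 0" by simp
    moreover have "\<forall>\<^sub>F L in sequentially. sqrt (K L / real L) = K L / \<tau> L"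
      using K1 eventually_gt_at_top[of 0]
    proof eventually_elim
      case (elim L)
      have "K L = sqrt (K L) * sqrt (K L)" using elim by simp
      then show ?case using elim
        by (simp add: \<tau>_def real_sqrt_divide real_sqrt_mult field_simps)
    qed
    ultimately show ?thesis by (rule Lim_transform_eventually)
  qed
  have ev: "\<forall>\<^sub>F L in sequentially. K L \<ge> 1 \<and> L \<ge> 1 \<and> L \<ge> 2 * m \<and> c / K L \<le> 1 \<and> \<tau> L > 0 \<and>
     (\<forall>\<xi>. \<bar>\<xi>\<bar> \<le> pi \<longrightarrow> norm (ch L \<xi>) \<le> 1 - c / K L * min 1 ((K L * \<xi>)\<^sup>2))"
    using K1 eventually_ge_at_top[of 1] eventually_ge_at_top[of "2 * m"] char(2)
      filterlim_at_top[THEN iffD1, OF K(1), rule_format, of c]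
    by eventually_elim (auto simp: \<tau>_def)
  obtain L0 where L0: "\<And>L. L \<ge> L0 \<Longrightarrow> K L \<ge> 1 \<and> L \<ge> 1 \<and> L \<ge> 2 * m \<and> c / K L \<le> 1 \<and> \<tau> L > 0 \<and>
     (\<forall>\<xi>. \<bar>\<xi>\<bar> \<le> pi \<longrightarrow> norm (ch L \<xi>) \<le> 1 - c / K L * min 1 ((K L * \<xi>)\<^sup>2))"
    using ev unfolding eventually_sequentially by auto
  have normF: "norm (F L \<xi>) \<le> exp (- (c / K L * min 1 ((K L * \<xi>)\<^sup>2)) * real (L - m))"
    if L: "L \<ge> L0" and \<xi>: "\<bar>\<xi>\<bar> \<le> pi" for L \<xi>
  proof -
    have "norm (ch L \<xi>) \<le> 1 - c / K L * min 1 ((K L * \<xi>)\<^sup>2)" using L0[OF L] \<xi> by blast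
    also have "\<dots> \<le> exp (- (c / K L * min 1 ((K L * \<xi>)\<^sup>2)))"
      using exp_ge_add_one_self[of "- (c / K L * min 1 ((K L * \<xi>)\<^sup>2))"] by simp
    finally have "norm (ch L \<xi>) ^ (L - m) \<le> exp (- (c / K L * min 1 ((K L * \<xi>)\<^sup>2))) ^ (L - m)"
      by (intro power_mono) auto
    then show ?thesis by (simp add: F_def norm_mult norm_power exp_of_nat_mult[symmetric] mult.commute)
  qed
  have intF: "integrable lborel (\<lambda>\<xi>. indicator {a..b} \<xi> *\<^sub>R F L \<xi>)" for a b L
    by (rule borel_integrable_compact[OF compact_Icc contF])
  have intH: "integrable lborel (\<lambda>\<xi>. indicator ({-pi..pi} - {-(1 / K L)..1 / K L}) \<xi> *\<^sub>R F L \<xi>)" for L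
    by (rule Bochner_Integration.integrable_bound[OF intF[of "-pi" pi L]]) (auto simp: indicator_def)
  have split: "of_real (\<tau> L) * (\<integral>\<xi>. indicator {-pi..pi} \<xi> *\<^sub>R F L \<xi> \<partial>lborel)
     = integral\<^sup>L lborel (G L) + of_real (\<tau> L) * H L" if L: "L \<ge> L0" for L
  proof -
    have K: "1 / K L \<le> pi" "K L > 0" "\<tau> L > 0"
      using L0[OF L] pi_ge_two by (auto intro: order_trans[of _ 1])
    have "(\<integral>\<xi>. indicator {-pi..pi} \<xi> *\<^sub>R F L \<xi> \<partial>lborel)
       = (\<integral>\<xi>. indicator {-(1 / K L)..1 / K L} \<xi> *\<^sub>R F L \<xi> + indicator ({-pi..pi} - {-(1 / K L)..1 / K L}) \<xi> *\<^sub>R F L \<xi> \<partial>lborel)"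
      using K by (intro Bochner_Integration.integral_cong) (auto simp: indicator_def)
    also have "\<dots> = (\<integral>\<xi>. indicator {-(1 / K L)..1 / K L} \<xi> *\<^sub>R F L \<xi> \<partial>lborel) + H L"
      unfolding H_def
    proof (rule Bochner_Integration.integral_add)
    qed (rule intF intH)+
    also have "(\<integral>\<xi>. indicator {-(1 / K L)..1 / K L} \<xi> *\<^sub>R F L \<xi> \<partial>lborel)
      = (1 / \<tau> L) *\<^sub>R (\<integral>u. indicator {-(1 / K L)..1 / K L} (0 + 1 / \<tau> L * u) *\<^sub>R F L (0 + 1 / \<tau> L * u) \<partial>lborel)"
      using K by (subst lborel_integral_real_affine[of "1 / \<tau> L" _ 0]) auto
    also have "(\<integral>u. indicator {-(1 / K L)..1 / K L} (0 + 1 / \<tau> L * u) *\<^sub>R F L (0 + 1 / \<tau> L * u) \<partial>lborel) = integral\<^sup>L lborel (G L)"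
      unfolding G_def using K
      by (intro Bochner_Integration.integral_cong) (auto simp: indicator_def field_simps)
    finally show ?thesis using K by (simp add: scaleR_conv_of_real field_simps)
  qed
  have far: "(\<lambda>L. of_real (\<tau> L) * H L) \<longlonglongrightarrow> 0"
  proof (rule Lim_null_comparison)
    \<comment> \<open>The factor \<open>exp (c * real m)\<close> pays for the \<open>m\<close>
      missing summands in the exponent, using \<open>K \<ge> 1\<close>.\<close>
    show "(\<lambda>L. 2 * pi * exp (c * real m) * (\<tau> L * exp (- c * real L / K L))) \<longlonglongrightarrow> 0"
      using tendsto_mult_left[OF K(3)[OF char(1)], of "2 * pi * exp (c * real m)"] by (simp add: \<tau>_def)
    have "norm (of_real (\<tau> L) * H L) \<le> 2 * pi * exp (c * real m) * (\<tau> L * exp (- c * real L / K L))"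
      if L: "L \<ge> L0" for L
    proof -
      have l: "K L \<ge> 1" "L \<ge> m" "\<tau> L > 0" using L0[OF L] by auto
      have b: "norm (indicator ({-pi..pi} - {-(1 / K L)..1 / K L}) \<xi> *\<^sub>R F L \<xi>)
         \<le> indicator {-pi..pi} \<xi> * exp (- (c / K L * real (L - m)))" for \<xi>
      proof (cases "\<xi> \<in> {-pi..pi} - {-(1 / K L)..1 / K L}")
        case True
        then have "\<bar>\<xi>\<bar> > 1 / K L" by auto
        then have "1 \<le> \<bar>K L * \<xi>\<bar>" using l by (simp add: abs_mult field_simps)
        then have "(K L * \<xi>)\<^sup>2 \<ge> 1" using one_le_power[of "\<bar>K L * \<xi>\<bar>" 2] by simp
        then show ?thesis using normF[OF L, of \<xi>] True by (auto simp: abs_le_iff)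
      qed (auto simp: indicator_def)
      have "norm (H L) \<le> (\<integral>\<xi>. indicator {-pi..pi} \<xi> * exp (- (c / K L * real (L - m))) \<partial>lborel)"
        unfolding H_def
      proof (rule Bochner_Integration.integral_norm_bound_integral[OF intH])
        show "integrable lborel (\<lambda>\<xi>. indicator {-pi..pi} \<xi> * exp (- (c / K L * real (L - m))) :: real)"
          by (intro integrable_mult_left integrable_real_indicator) auto
      qed (rule b)
      also have "\<dots> = 2 * pi * exp (- (c / K L * real (L - m)))" by simp
      also have "- (c / K L * real (L - m)) \<le> c * real m + (- c * real L / K L)"
      proof -
        have "c * real m * (1 / K L) \<le> c * real m * 1" using l char(1) by (intro mult_left_mono) auto
        then show ?thesis using l by (simp add: of_nat_diff field_simps)
      qed
      finally have "norm (H L) \<le> 2 * pi * exp (c * real m + (- c * real L / K L))" by simp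
      then have "\<tau> L * norm (H L) \<le> \<tau> L * (2 * pi * exp (c * real m + (- c * real L / K L)))"
        using l by (intro mult_left_mono) auto
      then show ?thesis using l by (simp add: norm_mult exp_add[symmetric] mult_ac)
    qed
    then show "\<forall>\<^sub>F L in sequentially. norm (of_real (\<tau> L) * H L) \<le> 2 * pi * exp (c * real m) * (\<tau> L * exp (- c * real L / K L))"
      unfolding eventually_sequentially by blast
  qed
  \<comment> \<open>Integrable majorant for the rescaled integrand. The half in the exponent comes
    from \<open>L \<ge> 2 * m\<close>, which gives \<open>(L - m) / L \<ge> 1 / 2\<close>.\<close>
  have near_bound: "norm (G L u) \<le> exp (- (c * u\<^sup>2 / 2))" if L: "L \<ge> L0" for L u
  proof (cases "u \<in> {-(\<tau> L / K L)..\<tau> L / K L}")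
    case True
    have l: "K L \<ge> 1" "L \<ge> 2 * m" "L \<ge> 1" "\<tau> L > 0" using L0[OF L] by auto
    have u: "\<bar>K L * (u / \<tau> L)\<bar> \<le> 1" using True l by (auto simp: abs_le_iff field_simps)
    then have sq: "(K L * (u / \<tau> L))\<^sup>2 \<le> 1" by (simp add: abs_square_le_1)
    have "\<bar>u / \<tau> L\<bar> \<le> 1 / K L" using u l by (simp add: abs_mult field_simps)
    also have "\<dots> \<le> pi" using l pi_ge_two by (auto intro: order_trans[of _ 1])
    finally have x: "\<bar>u / \<tau> L\<bar> \<le> pi" .
    have t2: "(\<tau> L)\<^sup>2 = real L * K L" using l by (simp add: \<tau>_def)
    have "(K L * (u / \<tau> L))\<^sup>2 = K L * u\<^sup>2 / real L"
      unfolding power_mult_distrib power_divide t2 using l by (simp add: power2_eq_square)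
    then have min: "min 1 ((K L * (u / \<tau> L))\<^sup>2) = K L * u\<^sup>2 / real L" using sq by simp
    have "norm (G L u) = norm (F L (u / \<tau> L))" using True by (simp add: G_def)
    also have "\<dots> \<le> exp (- (c / K L * min 1 ((K L * (u / \<tau> L))\<^sup>2)) * real (L - m))" by (rule normF[OF L x])
    also have "c / K L * min 1 ((K L * (u / \<tau> L))\<^sup>2) = c * u\<^sup>2 / real L"
      unfolding min using l by simp
    also have "exp (- (c * u\<^sup>2 / real L) * real (L - m)) \<le> exp (- (c * u\<^sup>2 / 2))"
    proof -
      have "c * u\<^sup>2 * (1 / 2) \<le> c * u\<^sup>2 * (real (L - m) / real L)"
        using l char(1) by (intro mult_left_mono) (auto simp: field_simps of_nat_diff)
      then show ?thesis by simp
    qed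
    finally show ?thesis .
  qed (simp add: G_def)
  have v_lim: "(\<lambda>L. ((\<Sum>k\<le>M L. p L k * real k ^ 2) - (\<mu> L)\<^sup>2) / K L) \<longlonglongrightarrow> V"
  proof -
    have "(\<lambda>L. (\<mu> L)\<^sup>2 / K L) \<longlonglongrightarrow> 0"
      by (rule real_tendsto_divide_at_top[OF tendsto_power[OF mean[folded \<mu>_def]] K(1)])
    from tendsto_diff[OF second(1) this] show ?thesis by (simp add: diff_divide_distrib)
  qed
  have near_lim: "(\<lambda>L. G L u) \<longlonglongrightarrow> of_real (exp (- (V * u\<^sup>2 / 2)))" for u
  proof -
    define \<xi> where "\<xi> = (\<lambda>L. u / \<tau> L)"
    define v where "v = (\<lambda>L. (\<Sum>k\<le>M L. p L k * real k ^ 2) - (\<mu> L)\<^sup>2)"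
    define y where "y = (\<lambda>L. v L * (\<xi> L)\<^sup>2 / 2)"
    define \<psi> where "\<psi> = (\<lambda>L. \<Sum>k\<le>M L. complex_of_real (p L k) * cis ((real k - \<mu> L) * \<xi> L))"
    \<comment> \<open>\<open>L\<close> times the error made in one factor when it is replaced by
      \<open>exp (- y)\<close>: first the third-order Taylor remainder, then the error
      \<open>y^2\<close> of \<open>1 - y\<close> against \<open>exp (- y)\<close>, both expressed
      through convergent quantities.\<close>
    define E where "E = (\<lambda>L. (\<bar>u\<bar> ^ 3 / 6) * ((\<Sum>k\<le>M L. p L k * real k ^ 3) / (K L)\<^sup>2 + (\<mu> L) ^ 3 / (K L)\<^sup>2) * (K L / \<tau> L)
       + (v L / K L)\<^sup>2 * u ^ 4 / 4 * (1 / real L))"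
    have inv: "(\<lambda>L. 1 / real L) \<longlonglongrightarrow> 0" by (rule lim_1_over_n)
    have K2: "(\<lambda>L. (\<mu> L) ^ 3 / (K L)\<^sup>2) \<longlonglongrightarrow> 0"
      by (rule real_tendsto_divide_at_top[OF tendsto_power[OF mean[folded \<mu>_def]]])
         (use K(1) in \<open>simp add: filterlim_pow_at_top\<close>)
    have "E \<longlonglongrightarrow> (\<bar>u\<bar> ^ 3 / 6) * (S + 0) * 0 + V\<^sup>2 * u ^ 4 / 4 * 0"
      unfolding E_def v_def by (intro tendsto_intros third K2 Kj inv v_lim) auto
    then have E0: "E \<longlonglongrightarrow> 0" by simp
    have ylim: "(\<lambda>L. real (L - m) * y L) \<longlonglongrightarrow> V * u\<^sup>2 / 2"
    proof -
      have "(\<lambda>L. (1 - real m * (1 / real L)) * (v L / K L) * u\<^sup>2 / 2) \<longlonglongrightarrow> (1 - real m * 0) * V * u\<^sup>2 / 2"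
        unfolding v_def by (intro tendsto_intros inv v_lim) auto
      then have "(\<lambda>L. (1 - real m * (1 / real L)) * (v L / K L) * u\<^sup>2 / 2) \<longlonglongrightarrow> V * u\<^sup>2 / 2" by simp
      then show ?thesis
      proof (rule Lim_transform_eventually)
        show "\<forall>\<^sub>F L in sequentially. (1 - real m * (1 / real L)) * (v L / K L) * u\<^sup>2 / 2 = real (L - m) * y L"
          using ev
        proof eventually_elim
          case (elim L)
          then have "(\<tau> L)\<^sup>2 = real L * K L" by (simp add: \<tau>_def)
          then show ?case using elim by (simp add: y_def \<xi>_def power_divide of_nat_diff field_simps)
        qed
      qed
    qed
    have main: "\<forall>\<^sub>F L in sequentially. norm (\<psi> L ^ (L - m) - of_real (exp (- (real (L - m) * y L)))) \<le> E L"
      using ev p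
    proof eventually_elim
      case (elim L)
      then have l: "K L \<ge> 1" "L \<ge> 1" "\<tau> L > 0" and pp: "\<And>k. k \<le> M L \<Longrightarrow> p L k \<ge> 0" "(\<Sum>k\<le>M L. p L k) = 1"
        "(\<Sum>k\<le>M L. p L k * real k) = \<mu> L" by (auto simp: \<mu>_def)
      have t2: "(\<tau> L)\<^sup>2 = real L * K L" using l by (simp add: \<tau>_def)
      have v0: "v L \<ge> 0" unfolding v_def by (rule norm_sum_cis_centered_le(2)[OF pp])
      have y0: "y L \<ge> 0" using v0 by (simp add: y_def)
      have n1: "norm (\<psi> L) \<le> 1"
        unfolding \<psi>_def by (rule order_trans[OF norm_sum]) (use pp in \<open>auto simp: norm_mult\<close>)
      have n2: "norm (complex_of_real (exp (- y L))) \<le> 1" using y0 by simp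
      have "norm (\<psi> L - of_real (exp (- y L))) \<le> norm (\<psi> L - of_real (1 - y L)) + norm (complex_of_real (1 - y L - exp (- y L)))"
        using norm_triangle_ineq[of "\<psi> L - of_real (1 - y L)" "complex_of_real (1 - y L - exp (- y L))"] by simp
      also have "norm (\<psi> L - of_real (1 - y L)) \<le> \<bar>\<xi> L\<bar> ^ 3 * ((\<Sum>k\<le>M L. p L k * real k ^ 3) + (\<mu> L) ^ 3) / 6"
        unfolding \<psi>_def y_def v_def by (rule norm_sum_cis_centered_le(1)[OF pp])
      also have "norm (complex_of_real (1 - y L - exp (- y L))) \<le> (y L)\<^sup>2"
        using abs_exp_minus_linear_le[OF y0] by (simp only: norm_of_real abs_minus_commute)
      finally have d: "norm (\<psi> L - of_real (exp (- y L))) \<le> \<bar>\<xi> L\<bar> ^ 3 * ((\<Sum>k\<le>M L. p L k * real k ^ 3) + (\<mu> L) ^ 3) / 6 + (y L)\<^sup>2"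
        by simp
      have "norm (\<psi> L ^ (L - m) - of_real (exp (- (real (L - m) * y L))))
        = norm (\<psi> L ^ (L - m) - of_real (exp (- y L)) ^ (L - m))"
        by (simp add: exp_of_nat_mult[symmetric] of_real_power[symmetric] del: of_real_power)
      \<comment> \<open>Powers of two numbers in the closed unit disc differ by at most the exponent
        times the distance of the bases.\<close>
      also have "\<dots> \<le> real (L - m) * norm (\<psi> L - of_real (exp (- y L)))"
        by (rule norm_power_diff[OF n1 n2])
      also have "\<dots> \<le> real L * norm (\<psi> L - of_real (exp (- y L)))" by (intro mult_right_mono) auto
      also have "\<dots> \<le> real L * (\<bar>\<xi> L\<bar> ^ 3 * ((\<Sum>k\<le>M L. p L k * real k ^ 3) + (\<mu> L) ^ 3) / 6 + (y L)\<^sup>2)"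
        by (intro mult_left_mono d) auto
      also have "\<dots> = E L"
      proof -
        have a: "real L * \<bar>\<xi> L\<bar> ^ 3 = \<bar>u\<bar> ^ 3 / (K L)\<^sup>2 * (K L / \<tau> L)"
        proof -
          have "\<tau> L ^ 3 = \<tau> L * (real L * K L)" by (simp add: power3_eq_cube t2[symmetric] power2_eq_square)
          then show ?thesis using l by (simp add: \<xi>_def power_divide power2_eq_square field_simps)
        qed
        have b: "real L * (y L)\<^sup>2 = (v L / K L)\<^sup>2 * u ^ 4 / 4 * (1 / real L)"
        proof -
          have x2: "(\<xi> L)\<^sup>2 = u\<^sup>2 / (real L * K L)" by (simp add: \<xi>_def power_divide t2)
          have "u ^ 4 = u\<^sup>2 * u\<^sup>2" by (simp add: power_add[symmetric])
          then show ?thesis unfolding y_def x2 using l by (simp add: power2_eq_square mult_ac)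
        qed
        have e: "real L * (\<bar>\<xi> L\<bar> ^ 3 * X / 6 + (y L)\<^sup>2) = (real L * \<bar>\<xi> L\<bar> ^ 3) * X / 6 + real L * (y L)\<^sup>2" for X
          by (simp add: algebra_simps)
        show ?thesis unfolding e a b E_def by (simp add: add_divide_distrib algebra_simps)
      qed
      finally show ?case .
    qed
    have "(\<lambda>L. \<psi> L ^ (L - m) - of_real (exp (- (real (L - m) * y L)))) \<longlonglongrightarrow> 0"
      by (rule Lim_null_comparison[OF main E0])
    moreover have "(\<lambda>L. complex_of_real (exp (- (real (L - m) * y L)))) \<longlonglongrightarrow> of_real (exp (- (V * u\<^sup>2 / 2)))"
      by (intro tendsto_intros ylim)
    ultimately have "(\<lambda>L. \<psi> L ^ (L - m)) \<longlonglongrightarrow> of_real (exp (- (V * u\<^sup>2 / 2)))"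
      by (rule Lim_transform[rotated])
    \<comment> \<open>The phase left after centring: \<open>L - m\<close> summands with mean
      \<open>N / L\<close> against the target \<open>N - j\<close> leave \<open>j - m \<mu>\<close>,
      which is of order \<open>K\<close> and hence small against \<open>\<tau>\<close>.\<close>
    moreover have "(\<lambda>L. cis ((real (j L) - real m * \<mu> L) * \<xi> L)) \<longlonglongrightarrow> cis 0"
    proof (rule tendsto_cis)
      have jK: "(\<lambda>L. real (j L) / K L * (K L / \<tau> L)) \<longlonglongrightarrow> 0"
      proof (rule lim_null_mult_left_bounded[OF _ Kj])
        show "\<forall>\<^sub>F L in sequentially. norm (real (j L) / K L) \<le> A"
          using j K1 by eventually_elim (auto simp: field_simps)
      qed
      have "(\<lambda>L. (real (j L) / K L * (K L / \<tau> L) - real m * \<mu> L * (1 / K L) * (K L / \<tau> L)) * u)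
          \<longlonglongrightarrow> (0 - real m * \<rho> * 0 * 0) * u"
        by (intro tendsto_intros jK Kj mean[folded \<mu>_def] real_tendsto_divide_at_top[OF tendsto_const K(1)])
      then have "(\<lambda>L. (real (j L) / K L * (K L / \<tau> L) - real m * \<mu> L * (1 / K L) * (K L / \<tau> L)) * u) \<longlonglongrightarrow> 0"
        by simp
      then show "(\<lambda>L. (real (j L) - real m * \<mu> L) * \<xi> L) \<longlonglongrightarrow> 0"
        by (rule Lim_transform_eventually)
           (use K1 in eventually_elim, simp add: \<xi>_def diff_divide_distrib left_diff_distrib)
    qed
    ultimately have "(\<lambda>L. \<psi> L ^ (L - m) * cis ((real (j L) - real m * \<mu> L) * \<xi> L)) \<longlonglongrightarrow> of_real (exp (- (V * u\<^sup>2 / 2))) * cis 0"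
      by (rule tendsto_mult)
    then have "(\<lambda>L. \<psi> L ^ (L - m) * cis ((real (j L) - real m * \<mu> L) * \<xi> L)) \<longlonglongrightarrow> of_real (exp (- (V * u\<^sup>2 / 2)))"
      by simp
    moreover have "\<forall>\<^sub>F L in sequentially. \<bar>u\<bar> \<le> \<tau> L / K L"
    proof -
      have "filterlim (\<lambda>L. inverse (K L / \<tau> L)) at_top sequentially"
        by (rule filterlim_inverse_at_top[OF Kj])
           (use ev in \<open>auto elim!: eventually_mono\<close>)
      then have "\<forall>\<^sub>F L in sequentially. \<bar>u\<bar> \<le> inverse (K L / \<tau> L)" by (auto simp: filterlim_at_top)
      then show ?thesis by simp
    qed
    then have "\<forall>\<^sub>F L in sequentially. \<psi> L ^ (L - m) * cis ((real (j L) - real m * \<mu> L) * \<xi> L) = G L u"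
      using ev
    proof eventually_elim
      case (elim L)
      have "ch L (\<xi> L) = cis (\<mu> L * \<xi> L) * \<psi> L"
        unfolding ch_def \<psi>_def sum_distrib_left
        by (intro sum.cong) (auto simp: cis_mult algebra_simps)
      then have "ch L (\<xi> L) ^ (L - m) = \<psi> L ^ (L - m) * cis (real (L - m) * (\<mu> L * \<xi> L))"
        by (simp only: power_mult_distrib Complex.DeMoivre mult.commute)
      moreover have "real (L - m) * (\<mu> L * \<xi> L) - (real (N L) - real (j L)) * \<xi> L = (real (j L) - real m * \<mu> L) * \<xi> L"
        using elim by (simp add: \<mu>_def of_nat_diff field_simps)
      ultimately have "F L (\<xi> L) = \<psi> L ^ (L - m) * cis ((real (j L) - real m * \<mu> L) * \<xi> L)"
        by (simp add: F_def mult.assoc cis_mult)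
      then show ?case using elim by (auto simp: G_def \<xi>_def abs_le_iff)
    qed
    ultimately show ?thesis by (rule Lim_transform_eventually)
  qed
  have "(\<lambda>i. integral\<^sup>L lborel (G (i + L0))) \<longlonglongrightarrow> (\<integral>u. complex_of_real (exp (- (V * u\<^sup>2 / 2))) \<partial>lborel)"
  proof (rule integral_dominated_convergence[where w = "\<lambda>u. exp (- (c * u\<^sup>2 / 2))"])
    show "integrable lborel (\<lambda>u. exp (- (c * u\<^sup>2 / 2)))" by (rule integral_gaussian[OF char(1)])
    show "AE u in lborel. (\<lambda>i. G (i + L0) u) \<longlonglongrightarrow> complex_of_real (exp (- (V * u\<^sup>2 / 2)))"
      by (intro AE_I2 LIMSEQ_ignore_initial_segment near_lim)
    show "AE u in lborel. norm (G (i + L0) u) \<le> exp (- (c * u\<^sup>2 / 2))" for i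
      by (intro AE_I2 near_bound) simp
  qed (auto simp: G_def)
  then have "(\<lambda>L. integral\<^sup>L lborel (G L)) \<longlonglongrightarrow> of_real (sqrt (2 * pi / V))"
    using LIMSEQ_offset integral_gaussian(2)[OF second(2)] by (subst (asm) integral_complex_of_real) fastforce
  from tendsto_add[OF this far]
  have "(\<lambda>L. integral\<^sup>L lborel (G L) + of_real (\<tau> L) * H L) \<longlonglongrightarrow> of_real (sqrt (2 * pi / V))" by simp
  then have "(\<lambda>L. of_real (\<tau> L) * (\<integral>\<xi>. indicator {-pi..pi} \<xi> *\<^sub>R F L \<xi> \<partial>lborel)) \<longlonglongrightarrow> of_real (sqrt (2 * pi / V))"
    by (rule Lim_transform_eventually) (use split in \<open>auto simp: eventually_sequentially intro!: exI[of _ L0]\<close>)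
  then show ?thesis by (simp only: \<tau>_def F_def)
qed

section \<open>Ratios of partition sums\<close>


text \<open>The Fourier integral sees the set of sites only through its cardinality, which avoids
  constructing a bijection between configurations.\<close>

lemma partition_sum_cong_card:
  assumes "finite A" "finite B" "card A = card B"
  shows "partition_sum a A n = partition_sum a B n"
proof -
  have "complex_of_real (2 * pi * partition_sum a A n) = of_real (2 * pi * partition_sum a B n)"
    unfolding partition_sum_fourier[OF assms(1) order_refl, symmetric]
      partition_sum_fourier[OF assms(2) order_refl, symmetric] assms(3) ..
  then show ?thesis by (simp only: of_real_eq_iff) simp
qed

text \<open>Passes from statements along every admissible sequence to uniformity in
  \<open>j\<close>: choose a counterexample wherever one exists and the admissible default 0
  elsewhere, then apply the assumption to this sequence.\<close>

lemma eventually_uniform_of_sequences: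
  fixes Q :: "nat \<Rightarrow> nat \<Rightarrow> bool"
  assumes "\<And>j. \<forall>\<^sub>F L in sequentially. B L (j L) \<Longrightarrow> \<forall>\<^sub>F L in sequentially. Q L (j L)"
    and "\<forall>\<^sub>F L in sequentially. B L 0"
  shows "\<forall>\<^sub>F L in sequentially. \<forall>j. B L j \<longrightarrow> Q L j"
proof -
  define j where "j = (\<lambda>L. if \<exists>j. B L j \<and> \<not> Q L j then SOME j. B L j \<and> \<not> Q L j else 0)"
  have *: "B L (j L) \<and> \<not> Q L (j L)" if "\<exists>j. B L j \<and> \<not> Q L j" for L
    using someI_ex[OF that] that by (simp add: j_def)
  have "\<forall>\<^sub>F L in sequentially. B L (j L)"
    using assms(2) by eventually_elim (use * in \<open>auto simp: j_def\<close>)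
  from assms(1)[OF this] show ?thesis
    by eventually_elim (use * in blast)
qed

context condensation
begin

lemma P_pos: "L \<ge> 1 \<Longrightarrow> P L s > 0"
  unfolding P_def using W_pos by (intro sum_pos) auto

text \<open>The block bound applied to the condensate alone. About \<open>C\<close> integers with
  weight at least of order \<open>1 / C^2\<close> save an amount of order \<open>1 / C\<close>, and
  normalising costs at most a factor 2 because \<open>P\<close> tends to 1.\<close>

lemma char_bound:
  assumes s: "(\<lambda>L. s L * C L) \<longlonglongrightarrow> 1"
  obtains c where "c > 0" and "\<forall>\<^sub>F L in sequentially. \<forall>\<xi>. \<bar>\<xi>\<bar> \<le> pi \<longrightarrow>
    norm (\<Sum>k\<le>N L. complex_of_real (W L k * exp (- s L * real k) / P L (s L)) * cis (real k * \<xi>))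
      \<le> 1 - c / C L * min 1 ((C L * \<xi>)\<^sup>2)"
proof
  have cmp: "comparable s" using s by (rule comparable_tendsto) simp
  \<comment> \<open>on the block \<open>B \<le> k < 3 * B\<close> with \<open>B = \<lceil>C\<rceil>\<close> the tilted condensate weight is at least of order \<open>1 / C\<^sup>2\<close>\<close>
  define c1 where "c1 = min 1 (6 powr \<kappa>)"
  \<comment> \<open>On the block \<open>C \<le> k + 1 \<le> 6 C\<close>, so \<open>c1\<close> bounds
    the power for either sign of \<open>\<kappa>\<close>. There \<open>s k \<le> 12\<close> because
    \<open>s C < 2\<close>, and the last factor is \<open>1 + \<delta> \<ge> 1 / 2\<close>.\<close>
  define b0 where "b0 = (\<rho> - \<rho>c) / Gamma (\<kappa> + 2) * c1 * exp (- 12) / 2"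
  have c1: "c1 > 0" by (simp add: c1_def)
  have b0: "b0 > 0" using \<rho> Gamma_pos c1 by (simp add: b0_def)
  show "b0 / 32 > 0" using b0 by simp
  have n: "(1::real) < 2" "(0::real) < 1 / 2" by auto
  show "\<forall>\<^sub>F L in sequentially. \<forall>\<xi>. \<bar>\<xi>\<bar> \<le> pi \<longrightarrow>
    norm (\<Sum>k\<le>N L. complex_of_real (W L k * exp (- s L * real k) / P L (s L)) * cis (real k * \<xi>))
      \<le> 1 - b0 / 32 / C L * min 1 ((C L * \<xi>)\<^sup>2)"
    using eventually_ge_at_top[of 1] filterlim_at_top[THEN iffD1, OF C_top, rule_format, of 1]
      comparable_facts(1)[OF cmp] order_tendstoD(2)[OF s n(1)] order_tendstoD(2)[OF P_tendsto[OF cmp] n(1)]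
      order_tendstoD(2)[OF err_tendsto n(2)] filterlim_at_top[THEN iffD1, OF N_over_C, rule_format, of 6]
  proof (eventually_elim, intro allI impI)
    fix L \<xi> assume L: "1 \<le> L" and CL: "1 \<le> C L" and sL: "0 < s L" "s L * C L < 2" and P2: "P L (s L) < 2"
      and err: "err L < 1 / 2" and NC: "6 \<le> real (N L) / C L" and \<xi>: "\<bar>\<xi>\<bar> \<le> pi"
    define B where "B = nat \<lceil>C L\<rceil>"
    have B: "C L \<le> real B" "real B \<le> 2 * C L" "B > 0" using CL unfolding B_def by linarith+
    have P: "P L (s L) > 0" using P_pos[OF L] .
    have NB: "3 * B \<le> N L"
    proof -
      have "real (3 * B) \<le> 6 * C L" using B by simp
      also have "\<dots> \<le> real (N L)" using NC CL by (simp add: field_simps)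
      finally show ?thesis by simp
    qed
    have lower: "b0 / (C L)\<^sup>2 \<le> W L k * exp (- s L * real k)" if k: "B \<le> k" "k < B + 2 * B" for k
    proof -
      have kr: "C L \<le> real k + 1" "real k + 1 \<le> 6 * C L" "real k \<le> 6 * C L"
        using k B by linarith+
      have pw: "c1 * C L powr \<kappa> \<le> (real k + 1) powr \<kappa>"
      proof (cases "\<kappa> \<ge> 0")
        case True
        have "c1 * C L powr \<kappa> \<le> 1 * C L powr \<kappa>" by (intro mult_right_mono) (auto simp: c1_def)
        also have "\<dots> \<le> (real k + 1) powr \<kappa>" using True kr CL by (simp add: powr_mono2)
        finally show ?thesis .
      next
        case False
        have "c1 * C L powr \<kappa> \<le> 6 powr \<kappa> * C L powr \<kappa>" by (intro mult_right_mono) (auto simp: c1_def)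
        also have "\<dots> = (6 * C L) powr \<kappa>" using CL by (simp add: powr_mult)
        also have "\<dots> \<le> (real k + 1) powr \<kappa>" using False kr CL by (intro powr_mono2') auto
        finally show ?thesis .
      qed
      have "k \<le> N L" using k NB by linarith
      from \<delta>_le_err[OF this] have dk: "1 + \<delta> L k \<ge> 1 / 2" using err by linarith
      have ex: "exp (- 12) \<le> exp (- s L * real k)"
      proof -
        have "s L * real k \<le> s L * (6 * C L)" using kr sL by (intro mult_left_mono) auto
        also have "\<dots> \<le> 12" using sL by simp
        finally show ?thesis by simp
      qed
      have Cp: "\<theta> / real L powr \<gamma> * C L powr \<kappa> = (\<rho> - \<rho>c) / Gamma (\<kappa> + 2) / (C L)\<^sup>2"
      proof -
        have "\<theta> / real L powr \<gamma> = (\<rho> - \<rho>c) / Gamma (\<kappa> + 2) * C L powr (- (\<kappa> + 2))"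
          using condensate_weight[OF L, of 1] by simp
        moreover have "C L powr (- (\<kappa> + 2)) * C L powr \<kappa> = C L powr (- 2)"
          by (simp add: powr_add[symmetric])
        moreover have "C L powr (- 2) = 1 / (C L)\<^sup>2"
          using CL by (simp add: powr_minus_divide powr_numeral)
        ultimately show ?thesis by (simp add: mult.assoc)
      qed
      have "b0 / (C L)\<^sup>2 = (\<rho> - \<rho>c) / Gamma (\<kappa> + 2) / (C L)\<^sup>2 * c1 * (1 / 2) * exp (- 12)"
        by (simp add: b0_def)
      also have "\<dots> = \<theta> / real L powr \<gamma> * (c1 * C L powr \<kappa>) * (1 / 2) * exp (- 12)"
        unfolding Cp[symmetric] by (simp only: mult_ac)
      also have "\<dots> \<le> \<theta> / real L powr \<gamma> * (real k + 1) powr \<kappa> * (1 + \<delta> L k) * exp (- s L * real k)"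
        using pw dk ex \<theta> c1 by (intro mult_mono mult_left_mono mult_nonneg_nonneg) auto
      also have "\<dots> \<le> W L k * exp (- s L * real k)"
        unfolding W_eq[OF L] using w_nonneg[of k] by (intro mult_right_mono) auto
      finally show ?thesis .
    qed
    have "norm (\<Sum>k\<le>N L. of_real (W L k * exp (- s L * real k)) * cis (real k * \<xi>))
       \<le> P L (s L) - b0 / (C L)\<^sup>2 * real B / 16 * min 1 ((C L * \<xi>)\<^sup>2)"
      unfolding P_def
      by (rule norm_weighted_sum_cis_le[OF _ _ lower])
         (use W_pos[OF L] b0 NB B CL \<xi> in \<open>auto intro: less_imp_le\<close>)
    also have "\<dots> \<le> P L (s L) - P L (s L) * (b0 / 32 / C L * min 1 ((C L * \<xi>)\<^sup>2))"
    proof -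
      have "P L (s L) * (b0 / 32 / C L) \<le> 2 * (b0 / 32 / C L)" using P2 b0 CL by (intro mult_right_mono) auto
      also have "\<dots> = b0 / (C L)\<^sup>2 * C L / 16" using CL by (simp add: power2_eq_square)
      also have "\<dots> \<le> b0 / (C L)\<^sup>2 * real B / 16"
        using B b0 by (intro divide_right_mono mult_left_mono) auto
      finally have "P L (s L) * (b0 / 32 / C L) * min 1 ((C L * \<xi>)\<^sup>2) \<le> b0 / (C L)\<^sup>2 * real B / 16 * min 1 ((C L * \<xi>)\<^sup>2)"
        by (intro mult_right_mono) auto
      then show ?thesis by (simp only: mult.assoc)
    qed
    also have "\<dots> = P L (s L) * (1 - b0 / 32 / C L * min 1 ((C L * \<xi>)\<^sup>2))"
      by (simp add: right_diff_distrib)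
    finally have "norm (\<Sum>k\<le>N L. of_real (W L k * exp (- s L * real k)) * cis (real k * \<xi>)) / P L (s L)
        \<le> 1 - b0 / 32 / C L * min 1 ((C L * \<xi>)\<^sup>2)"
      using P by (simp add: pos_divide_le_eq mult.commute)
    moreover have "(\<Sum>k\<le>N L. complex_of_real (W L k * exp (- s L * real k) / P L (s L)) * cis (real k * \<xi>))
        = (\<Sum>k\<le>N L. of_real (W L k * exp (- s L * real k)) * cis (real k * \<xi>)) / of_real (P L (s L))"
      by (simp add: sum_divide_distrib)
    ultimately show "norm (\<Sum>k\<le>N L. complex_of_real (W L k * exp (- s L * real k) / P L (s L)) * cis (real k * \<xi>))
      \<le> 1 - b0 / 32 / C L * min 1 ((C L * \<xi>)\<^sup>2)"
      using P by (simp add: norm_divide)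
  qed
qed

end

section \<open>The tilted single-site law and its partition sums\<close>

locale tilted_condensation = condensation +
  fixes s :: "nat \<Rightarrow> real"
  assumes s_C: "(\<lambda>L. s L * C L) \<longlonglongrightarrow> 1"
    and tilt_mean: "\<forall>\<^sub>F L in sequentially. T (\<lambda>x. 1) L (s L) = real (N L) / real L * P L (s L)"
begin

definition p :: "nat \<Rightarrow> nat \<Rightarrow> real" where "p L k = W L k * exp (- s L * real k) / P L (s L)"

lemma comparable_s: "comparable s" using s_C by (rule comparable_tendsto) simp

lemma s_pos: "\<forall>\<^sub>F L in sequentially. s L > 0" by (rule comparable_facts[OF comparable_s])

lemma T_limit:
  assumes "continuous_on UNIV f" "\<And>x. x \<ge> 0 \<Longrightarrow> \<bar>f x\<bar> \<le> A * (1 + x\<^sup>2)"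
  shows "(\<lambda>L. T f L (s L)) \<longlonglongrightarrow> \<rho>c * f 0 + (\<rho> - \<rho>c) / Gamma (\<kappa> + 2) * J f"
proof -
  have "(\<lambda>L. (\<rho> - \<rho>c) / Gamma (\<kappa> + 2) * (s L * C L) powr (- (\<kappa> + 2)) * J f)
     \<longlonglongrightarrow> (\<rho> - \<rho>c) / Gamma (\<kappa> + 2) * 1 powr (- (\<kappa> + 2)) * J f"
    by (intro tendsto_intros s_C) (use Gamma_pos in auto)
  from tendsto_add[OF T_tendsto[OF comparable_s assms] this] show ?thesis by simp
qed

text \<open>\<open>T\<close> at \<open>x^k\<close> already contains one power of \<open>n\<close>,
  so it equals \<open>s^k\<close> times the moment of order \<open>k + 1\<close>. Both values of
  \<open>k\<close> stay within the quadratic growth allowed for test functions.\<close>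

lemma moment_limit:
  assumes k: "k = 1 \<or> k = 2"
  shows "(\<lambda>L. (\<Sum>n\<le>N L. p L n * real n ^ Suc k) / (C L) ^ k) \<longlonglongrightarrow> (\<rho> - \<rho>c) / Gamma (\<kappa> + 2) * Gamma (\<kappa> + 2 + real k)"
proof -
  have b: "\<bar>x ^ k\<bar> \<le> 1 * (1 + x\<^sup>2)" for x :: real
    using k abs_le_one_plus_square[of x] by auto
  have "(\<lambda>L. T (\<lambda>x. x ^ k) L (s L)) \<longlonglongrightarrow> (\<rho> - \<rho>c) / Gamma (\<kappa> + 2) * Gamma (\<kappa> + 2 + real k)"
    using T_limit[of "\<lambda>x. x ^ k" 1, OF _ b] k by (auto simp: J_power continuous_intros)
  then have "(\<lambda>L. T (\<lambda>x. x ^ k) L (s L) / P L (s L) / (s L * C L) ^ k) \<longlonglongrightarrow> (\<rho> - \<rho>c) / Gamma (\<kappa> + 2) * Gamma (\<kappa> + 2 + real k) / 1 / 1 ^ k"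
    by (intro tendsto_intros s_C P_tendsto[OF comparable_s]) auto
  then have "(\<lambda>L. T (\<lambda>x. x ^ k) L (s L) / P L (s L) / (s L * C L) ^ k) \<longlonglongrightarrow> (\<rho> - \<rho>c) / Gamma (\<kappa> + 2) * Gamma (\<kappa> + 2 + real k)"
    by simp
  then show ?thesis
  proof (rule Lim_transform_eventually)
    show "\<forall>\<^sub>F L in sequentially. T (\<lambda>x. x ^ k) L (s L) / P L (s L) / (s L * C L) ^ k = (\<Sum>n\<le>N L. p L n * real n ^ Suc k) / (C L) ^ k"
      using s_pos
    proof eventually_elim
      case (elim L)
      have "T (\<lambda>x. x ^ k) L (s L) / P L (s L) = (s L) ^ k * (\<Sum>n\<le>N L. p L n * real n ^ Suc k)"
        unfolding T_def p_def sum_distrib_left sum_divide_distrib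
        by (intro sum.cong) (auto simp: power_mult_distrib mult_ac)
      then show ?case using elim by (simp add: power_mult_distrib)
    qed
  qed
qed

text \<open>The limit of the second moment in units of \<open>C\<close>. As the mean stays bounded
  while \<open>C\<close> diverges, it is also the limit of the variance in these units.\<close>

definition V :: real where "V = (\<rho> - \<rho>c) / Gamma (\<kappa> + 2) * Gamma (\<kappa> + 3)"

lemma V_pos: "V > 0"
  using \<rho> \<kappa> Gamma_pos Gamma_real_pos[of "\<kappa> + 3"] by (simp add: V_def)

lemma p_facts:
  "\<forall>\<^sub>F L in sequentially. (\<forall>k\<le>N L. p L k \<ge> 0) \<and> (\<Sum>k\<le>N L. p L k) = 1 \<and>
      (\<Sum>k\<le>N L. p L k * real k) = real (N L) / real L"
  using tilt_mean eventually_ge_at_top[of 1]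
proof eventually_elim
  case (elim L)
  have P: "P L (s L) > 0" using P_pos elim by simp
  have "(\<Sum>k\<le>N L. p L k * real k) = T (\<lambda>x. 1) L (s L) / P L (s L)"
    unfolding T_def p_def sum_divide_distrib by (intro sum.cong) auto
  moreover have "(\<Sum>k\<le>N L. p L k) = P L (s L) / P L (s L)"
    unfolding p_def sum_divide_distrib[symmetric] by (simp add: P_def)
  moreover have "\<forall>k\<le>N L. p L k \<ge> 0"
    using P W_pos[OF elim(2)] by (auto simp: p_def intro!: divide_nonneg_nonneg mult_nonneg_nonneg intro: less_imp_le)
  ultimately show ?case using P elim by simp
qed

lemma partition_sum_limit:
  assumes j: "\<forall>\<^sub>F L in sequentially. real (j L) \<le> A * C L"
  shows "(\<lambda>L. sqrt (real L * C L) * partition_sum (p L) {1..L - m} (N L - j L)) \<longlonglongrightarrow> sqrt (2 * pi / V) / (2 * pi)"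
proof -
  obtain c where c: "c > 0" "\<forall>\<^sub>F L in sequentially. \<forall>\<xi>. \<bar>\<xi>\<bar> \<le> pi \<longrightarrow>
    norm (\<Sum>k\<le>N L. complex_of_real (p L k) * cis (real k * \<xi>)) \<le> 1 - c / C L * min 1 ((C L * \<xi>)\<^sup>2)"
    using char_bound[OF s_C] unfolding p_def .
  have "(\<lambda>L. complex_of_real (sqrt (real L * C L)) * (\<integral>\<xi>. indicator {-pi..pi} \<xi> *\<^sub>R
      ((\<Sum>k\<le>N L. complex_of_real (p L k) * cis (real k * \<xi>)) ^ (L - m) * cis (- ((real (N L) - real (j L)) * \<xi>))) \<partial>lborel)) \<longlonglongrightarrow> complex_of_real (sqrt (2 * pi / V))"
  proof (rule local_limit_theorem[OF p_facts C_top C_over_L exp_tail N_density _ V_pos _ c j])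
    show "(\<lambda>L. (\<Sum>k\<le>N L. p L k * (real k)\<^sup>2) / C L) \<longlonglongrightarrow> V"
      using moment_limit[of 1] by (simp add: V_def power2_eq_square algebra_simps)
    show "(\<lambda>L. (\<Sum>k\<le>N L. p L k * real k ^ 3) / (C L)\<^sup>2) \<longlonglongrightarrow> (\<rho> - \<rho>c) / Gamma (\<kappa> + 2) * Gamma (\<kappa> + 2 + real 2)"
      using moment_limit[of 2] by (simp add: numeral_eq_Suc)
  qed
  then have "(\<lambda>L. complex_of_real (sqrt (real L * C L) * (2 * pi * partition_sum (p L) {1..L - m} (N L - j L)))) \<longlonglongrightarrow> complex_of_real (sqrt (2 * pi / V))"
  proof (rule Lim_transform_eventually)
    show "\<forall>\<^sub>F L in sequentially. complex_of_real (sqrt (real L * C L)) * (\<integral>\<xi>. indicator {-pi..pi} \<xi> *\<^sub>R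
      ((\<Sum>k\<le>N L. complex_of_real (p L k) * cis (real k * \<xi>)) ^ (L - m) * cis (- ((real (N L) - real (j L)) * \<xi>))) \<partial>lborel)
      = complex_of_real (sqrt (real L * C L) * (2 * pi * partition_sum (p L) {1..L - m} (N L - j L)))"
      using j filterlim_at_top[THEN iffD1, OF N_over_C, rule_format, of A]
        filterlim_at_top[THEN iffD1, OF C_top, rule_format, of 1]
    proof eventually_elim
      case (elim L)
      \<comment> \<open>Eventually \<open>j L \<le> N L\<close>, so the truncated difference
        \<open>N L - j L\<close> is the true one and matches the frequency in the Fourier
        integral.\<close>
      have "A * C L \<le> real (N L)" using elim(2,3) by (simp add: field_simps)
      then have "j L \<le> N L" using elim(1) by linarith
      then have e: "real (N L) - real (j L) = real (N L - j L)" by (simp add: of_nat_diff)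
      have c: "card {1..L - m} = L - m" by simp
      note I = partition_sum_fourier[of "{1..L - m}" "N L - j L" "N L" "p L", OF finite_atLeastAtMost diff_le_self, unfolded c]
      show ?case
        unfolding e I
        by (simp only: of_real_mult)
    qed
  qed
  then have "(\<lambda>L. sqrt (real L * C L) * (2 * pi * partition_sum (p L) {1..L - m} (N L - j L))) \<longlonglongrightarrow> sqrt (2 * pi / V)"
    by (simp only: tendsto_of_real_iff)
  from tendsto_divide[OF this tendsto_const[of "2 * pi"]] show ?thesis by simp
qed

text \<open>Numerator and denominator have the same nonzero limit after multiplication by
  \<open>sqrt (L C)\<close>, since the limit involves neither \<open>m\<close> nor
  \<open>j\<close>.\<close>

lemma partition_sum_ratio_tendsto:
  assumes j: "\<forall>\<^sub>F L in sequentially. real (j L) \<le> A * C L"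
  shows "(\<lambda>L. partition_sum (p L) {1..L - m} (N L - j L) / partition_sum (p L) {1..L} (N L)) \<longlonglongrightarrow> 1"
proof -
  have z: "\<forall>\<^sub>F L in sequentially. real 0 \<le> 0 * C L" by simp
  have "(\<lambda>L. (sqrt (real L * C L) * partition_sum (p L) {1..L - m} (N L - j L)) /
      (sqrt (real L * C L) * partition_sum (p L) {1..L - 0} (N L - 0))) \<longlonglongrightarrow> (sqrt (2 * pi / V) / (2 * pi)) / (sqrt (2 * pi / V) / (2 * pi))"
    by (intro tendsto_divide partition_sum_limit[OF j] partition_sum_limit[OF z]) (use V_pos in auto)
  then have "(\<lambda>L. (sqrt (real L * C L) * partition_sum (p L) {1..L - m} (N L - j L)) /
      (sqrt (real L * C L) * partition_sum (p L) {1..L - 0} (N L - 0))) \<longlonglongrightarrow> 1"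
    using V_pos by simp
  then show ?thesis
    by (rule Lim_transform_eventually)
       (use eventually_ge_at_top[of 1] in eventually_elim, use C_pos in force)
qed

text \<open>Uniformity in \<open>j\<close> is required because the minorant must hold simultaneously
  at all points of the box, whose total mass \<open>j\<close> varies.\<close>

lemma partition_sum_ratio_ge:
  assumes \<epsilon>: "\<epsilon> > 0" and A: "A \<ge> 0"
  shows "\<forall>\<^sub>F L in sequentially. \<forall>j. real j \<le> A * C L \<longrightarrow>
    1 - \<epsilon> \<le> partition_sum (p L) {1..L - m} (N L - j) / partition_sum (p L) {1..L} (N L)"
proof (rule eventually_uniform_of_sequences)
  fix j assume j: "\<forall>\<^sub>F L in sequentially. real (j L) \<le> A * C L"
  have "1 - \<epsilon> < 1" using \<epsilon> by simp
  from order_tendstoD(1)[OF partition_sum_ratio_tendsto[OF j, of m] this]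
  show "\<forall>\<^sub>F L in sequentially. 1 - \<epsilon> \<le> partition_sum (p L) {1..L - m} (N L - j L) / partition_sum (p L) {1..L} (N L)"
    by eventually_elim simp
next
  show "\<forall>\<^sub>F L in sequentially. real 0 \<le> A * C L"
    using eventually_ge_at_top[of 1] by eventually_elim (use A C_pos in \<open>simp add: less_imp_le\<close>)
qed

end

section \<open>The law of the first size-biased entries\<close>


lemma pmf_bind_ge: "pmf (bind_pmf M f) y \<ge> pmf M x * pmf (f x) y"
proof -
  have "pmf M x * pmf (f x) y = (\<integral>z. indicator {x} z * pmf (f x) y \<partial>measure_pmf M)"
    by (simp add: measure_pmf_single)
  also have "\<dots> \<le> (\<integral>z. pmf (f z) y \<partial>measure_pmf M)"
    by (intro integral_mono measure_pmf.integrable_const_bound[where B = 1])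
       (auto simp: indicator_def pmf_le_1)
  finally show ?thesis by (simp add: pmf_bind)
qed

lemma length_size_biased_sites:
  "xs \<in> set_pmf (size_biased_sites t L \<eta> k) \<Longrightarrow> length xs = k"
  by (induction k arbitrary: xs) auto

lemma take_size_biased_sites:
  assumes "m \<le> k"
  shows "map_pmf (take m) (size_biased_sites t L \<eta> k) = size_biased_sites t L \<eta> m"
  using assms
proof (induction k rule: dec_induct)
  case base
  have "map_pmf (take m) (size_biased_sites t L \<eta> m) = map_pmf id (size_biased_sites t L \<eta> m)"
    by (intro map_pmf_cong) (auto dest: length_size_biased_sites)
  then show ?case by simp
next
  case (step k)
  have "map_pmf (take m) (size_biased_sites t L \<eta> (Suc k)) =
     bind_pmf (size_biased_sites t L \<eta> k) (\<lambda>xs. map_pmf (\<lambda>x. take m (xs @ [x])) (next_site t L \<eta> xs))"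
    by (simp add: map_bind_pmf pmf.map_comp comp_def)
  also have "\<dots> = bind_pmf (size_biased_sites t L \<eta> k) (\<lambda>xs. return_pmf (take m xs))"
    using step by (intro bind_pmf_cong) (auto dest!: length_size_biased_sites simp: map_pmf_const)
  also have "\<dots> = map_pmf (take m) (size_biased_sites t L \<eta> k)" by (simp add: map_pmf_def)
  finally show ?case using step by simp
qed

text \<open>Each step divides by the mass not yet chosen, which is at most \<open>N\<close>. As the
  chosen mass stays below \<open>N\<close>, the process has not reached the stage governed by
  \<open>t\<close>, so the bound is free of the arbitrary rule.\<close>

lemma pmf_size_biased_sites_ge:
  assumes \<eta>: "\<eta> \<in> configs L N"
  shows "distinct xs \<Longrightarrow> set xs \<subseteq> {1..L} \<Longrightarrow> (\<Sum>y\<leftarrow>xs. \<eta> y) < N \<Longrightarrow>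
    (\<Prod>y\<leftarrow>xs. real (\<eta> y) / real N) \<le> pmf (size_biased_sites t L \<eta> (length xs)) xs"
proof (induction xs rule: rev_induct)
  case (snoc x xs)
  have IH: "(\<Prod>y\<leftarrow>xs. real (\<eta> y) / real N) \<le> pmf (size_biased_sites t L \<eta> (length xs)) xs"
    using snoc by (intro snoc.IH) auto
  have "pmf (map_pmf (\<lambda>x. xs @ [x]) (next_site t L \<eta> xs)) (xs @ [x]) = pmf (next_site t L \<eta> xs) x"
    by (rule pmf_map_inj') (auto simp: inj_def)
  also have "\<dots> = real (\<eta> x) / (real N - real (\<Sum>y\<leftarrow>xs. \<eta> y))"
    using snoc.prems by (intro pmf_next_site[OF \<eta>]) auto
  also have "\<dots> \<ge> real (\<eta> x) / real N"
  proof (intro divide_left_mono mult_pos_pos)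
    have "(\<Sum>y\<leftarrow>xs. \<eta> y) < N" using snoc.prems by simp
    then have "real (\<Sum>y\<leftarrow>xs. \<eta> y) < real N" by (simp only: of_nat_less_iff)
    then show "0 < real N" "0 < real N - real (\<Sum>y\<leftarrow>xs. \<eta> y)" "real N - real (\<Sum>y\<leftarrow>xs. \<eta> y) \<le> real N" by linarith+
  qed simp
  finally have "(\<Prod>y\<leftarrow>xs. real (\<eta> y) / real N) * (real (\<eta> x) / real N) \<le>
     pmf (size_biased_sites t L \<eta> (length xs)) xs * pmf (map_pmf (\<lambda>x. xs @ [x]) (next_site t L \<eta> xs)) (xs @ [x])"
    using IH by (intro mult_mono) auto
  also have "\<dots> \<le> pmf (size_biased_sites t L \<eta> (length (xs @ [x]))) (xs @ [x])"
    using pmf_bind_ge[of "size_biased_sites t L \<eta> (length xs)" xs "\<lambda>xs. map_pmf (\<lambda>x. xs @ [x]) (next_site t L \<eta> xs)" "xs @ [x]"]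
    by simp
  finally show ?case by simp
qed simp

text \<open>Induction removing one site at a time; resetting the removed entry to
  \<open>undefined\<close> keeps the configuration extensional on the smaller set.\<close>

lemma partition_sum_marginal:
  assumes "finite A"
  shows "distinct xs \<Longrightarrow> set xs \<subseteq> A \<Longrightarrow> length xs = length ns \<Longrightarrow> sum_list ns \<le> n \<Longrightarrow>
    (\<Sum>\<eta>\<in>{\<eta> \<in> A \<rightarrow>\<^sub>E UNIV. sum \<eta> A = n \<and> map \<eta> xs = ns}. \<Prod>x\<in>A. v (\<eta> x))
      = (\<Prod>k\<leftarrow>ns. v k) * partition_sum v (A - set xs) (n - sum_list ns)"
  using assms
proof (induction xs arbitrary: ns A n)
  case Nil
  then show ?case by (simp add: partition_sum_def)
next
  case (Cons x xs)
  obtain k ks where ns: "ns = k # ks" using Cons.prems by (cases ns) auto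
  have x: "x \<in> A" "x \<notin> set xs" "finite A" and k: "k \<le> n" using Cons.prems by (auto simp: ns)
  have split: "sum f A = f x + sum f (A - {x})" for f :: "'a \<Rightarrow> nat" using x by (simp add: sum.remove)
  have "(\<Sum>\<eta>\<in>{\<eta> \<in> A \<rightarrow>\<^sub>E UNIV. sum \<eta> A = n \<and> map \<eta> (x # xs) = ns}. \<Prod>x\<in>A. v (\<eta> x))
    = (\<Sum>\<eta>\<in>{\<eta> \<in> (A - {x}) \<rightarrow>\<^sub>E UNIV. sum \<eta> (A - {x}) = n - k \<and> map \<eta> xs = ks}. v k * (\<Prod>x\<in>A - {x}. v (\<eta> x)))"
  proof (rule sum.reindex_bij_witness[where i = "\<lambda>\<eta>. \<eta>(x := k)" and j = "\<lambda>\<eta>. \<eta>(x := undefined)"])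
    fix \<eta> assume \<eta>: "\<eta> \<in> {\<eta> \<in> A \<rightarrow>\<^sub>E UNIV. sum \<eta> A = n \<and> map \<eta> (x # xs) = ns}"
    then have e: "\<eta> x = k" "map \<eta> xs = ks" "sum \<eta> A = n" by (auto simp: ns)
    then show "(\<eta>(x := undefined))(x := k) = \<eta>" by auto
    have "sum (\<eta>(x := undefined)) (A - {x}) = sum \<eta> (A - {x})" by (intro sum.cong) auto
    moreover have "map (\<eta>(x := undefined)) xs = map \<eta> xs" using x by (intro map_cong) auto
    ultimately show "\<eta>(x := undefined) \<in> {\<eta> \<in> (A - {x}) \<rightarrow>\<^sub>E UNIV. sum \<eta> (A - {x}) = n - k \<and> map \<eta> xs = ks}"
      using \<eta> e split[of \<eta>] by (auto simp: PiE_iff extensional_def)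
    have "(\<Prod>y\<in>A - {x}. v ((\<eta>(x := undefined)) y)) = (\<Prod>y\<in>A - {x}. v (\<eta> y))" by (intro prod.cong) auto
    then show "v k * (\<Prod>y\<in>A - {x}. v ((\<eta>(x := undefined)) y)) = (\<Prod>y\<in>A. v (\<eta> y))"
      using x e by (simp add: prod.remove)
  next
    fix \<eta> assume \<eta>: "\<eta> \<in> {\<eta> \<in> (A - {x}) \<rightarrow>\<^sub>E UNIV. sum \<eta> (A - {x}) = n - k \<and> map \<eta> xs = ks}"
    then show "(\<eta>(x := k))(x := undefined) = \<eta>" by (auto simp: PiE_iff extensional_def)
    have "sum (\<eta>(x := k)) (A - {x}) = sum \<eta> (A - {x})" by (intro sum.cong) auto
    moreover have "map (\<eta>(x := k)) xs = map \<eta> xs" using x by (intro map_cong) auto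
    ultimately show "\<eta>(x := k) \<in> {\<eta> \<in> A \<rightarrow>\<^sub>E UNIV. sum \<eta> A = n \<and> map \<eta> (x # xs) = ns}"
      using \<eta> x k split[of "\<eta>(x := k)"] by (auto simp: PiE_iff extensional_def ns)
  qed
  also have "\<dots> = v k * ((\<Prod>k\<leftarrow>ks. v k) * partition_sum v (A - {x} - set xs) (n - k - sum_list ks))"
    using Cons.prems x unfolding sum_distrib_left[symmetric]
    by (intro arg_cong2[where f = "(*)"] refl Cons.IH) (auto simp: ns)
  finally show ?case by (simp add: ns Diff_insert2[symmetric] mult.assoc)
qed

text \<open>Sum over all ordered choices of \<open>m\<close> distinct sites showing the entries
  \<open>ns\<close>. Each choice has at least the product probability with denominators
  \<open>N\<close>, and by exchangeability all contribute the same, hence the cardinality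
  factor.\<close>

lemma pmf_take_size_biased_ge:
  assumes L: "L \<ge> 1" and v: "\<And>n. v n > 0" and m: "length ns = m" "m \<le> L" and N: "sum_list ns < N"
  shows "real (card {xs. length xs = m \<and> distinct xs \<and> set xs \<subseteq> {1..L}}) *
      (\<Prod>k\<leftarrow>ns. real k * v k / real N) *
      (partition_sum v {1..L - m} (N - sum_list ns) / partition_sum v {1..L} N)
    \<le> pmf (map_pmf (take m) (size_biased_pmf t v L N)) ns"
proof -
  define D where "D = {xs. length xs = m \<and> distinct xs \<and> set xs \<subseteq> {1..L}}"
  define c where "c = (\<Prod>k\<leftarrow>ns. real k / real N)"
  define Z where "Z = partition_sum v {1..L} N"
  have finD: "finite D"
    by (rule finite_subset[OF _ finite_lists_length_eq[of "{1..L}" m]]) (auto simp: D_def)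
  have conf: "configs L n = {\<eta> \<in> {1..L} \<rightarrow>\<^sub>E UNIV. sum \<eta> {1..L} = n}" for n
    by (simp add: configs_def)
  have pmfc: "pmf (canonical_pmf v L N) \<eta> = (if \<eta> \<in> configs L N then (\<Prod>x\<in>{1..L}. v (\<eta> x)) / Z else 0)" for \<eta>
    using pmf_canonical_pmf[where v = v and N = N and \<eta> = \<eta>, OF L v] by (simp add: Z_def partition_sum_def conf)
  have Zp: "Z > 0"
    unfolding Z_def partition_sum_def conf[symmetric]
    using configs_nonempty[OF L] finite_configs v by (intro sum_pos prod_pos) auto
  have "map_pmf (take m) (size_biased_pmf t v L N) =
     bind_pmf (canonical_pmf v L N) (\<lambda>\<eta>. map_pmf (map \<eta>) (map_pmf (take m) (size_biased_sites (t \<eta>) L \<eta> L)))"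
    by (simp add: size_biased_pmf_def map_bind_pmf pmf.map_comp comp_def take_map)
  also have "\<dots> = bind_pmf (canonical_pmf v L N) (\<lambda>\<eta>. map_pmf (map \<eta>) (size_biased_sites (t \<eta>) L \<eta> m))"
    by (simp add: take_size_biased_sites[OF m(2)])
  finally have "pmf (map_pmf (take m) (size_biased_pmf t v L N)) ns =
     (\<integral>\<eta>. pmf (map_pmf (map \<eta>) (size_biased_sites (t \<eta>) L \<eta> m)) ns \<partial>measure_pmf (canonical_pmf v L N))"
    by (simp add: pmf_bind)
  also have "\<dots> = (\<Sum>\<eta>\<in>configs L N. pmf (map_pmf (map \<eta>) (size_biased_sites (t \<eta>) L \<eta> m)) ns * pmf (canonical_pmf v L N) \<eta>)"
    by (rule integral_measure_pmf_real[OF finite_configs]) (auto simp: set_pmf_iff pmfc split: if_splits)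
  also have "\<dots> = (\<Sum>\<eta>\<in>configs L N. pmf (map_pmf (map \<eta>) (size_biased_sites (t \<eta>) L \<eta> m)) ns * ((\<Prod>x\<in>{1..L}. v (\<eta> x)) / Z))"
    by (intro sum.cong) (auto simp: pmfc)
  also have "\<dots> \<ge> (\<Sum>\<eta>\<in>configs L N. (\<Sum>xs\<in>D. if map \<eta> xs = ns then c else 0) * ((\<Prod>x\<in>{1..L}. v (\<eta> x)) / Z))"
  proof (intro sum_mono mult_right_mono)
    fix \<eta> assume \<eta>: "\<eta> \<in> configs L N"
    have "(\<Sum>xs\<in>D. if map \<eta> xs = ns then c else 0) = (\<Sum>xs\<in>{xs\<in>D. map \<eta> xs = ns}. c)"
      by (rule sum.inter_filter[OF finD, symmetric])
    also have "\<dots> \<le> (\<Sum>xs\<in>{xs\<in>D. map \<eta> xs = ns}. pmf (size_biased_sites (t \<eta>) L \<eta> m) xs)"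
    proof (intro sum_mono)
      fix xs assume xs: "xs \<in> {xs\<in>D. map \<eta> xs = ns}"
      then have "(\<Prod>y\<leftarrow>xs. real (\<eta> y) / real N) \<le> pmf (size_biased_sites (t \<eta>) L \<eta> (length xs)) xs"
        using N by (intro pmf_size_biased_sites_ge[OF \<eta>]) (auto simp: D_def)
      moreover have "(\<Prod>y\<leftarrow>xs. real (\<eta> y) / real N) = c"
        using xs by (auto simp: c_def comp_def)
      ultimately show "c \<le> pmf (size_biased_sites (t \<eta>) L \<eta> m) xs" using xs by (simp add: D_def)
    qed
    also have "\<dots> = measure (measure_pmf (size_biased_sites (t \<eta>) L \<eta> m)) {xs\<in>D. map \<eta> xs = ns}"
      using finD by (simp add: measure_measure_pmf_finite)
    also have "\<dots> \<le> measure (measure_pmf (size_biased_sites (t \<eta>) L \<eta> m)) (map \<eta> -` {ns})"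
      by (rule measure_pmf.finite_measure_mono) auto
    also have "\<dots> = pmf (map_pmf (map \<eta>) (size_biased_sites (t \<eta>) L \<eta> m)) ns"
      by (simp add: pmf_map)
    finally show "(\<Sum>xs\<in>D. if map \<eta> xs = ns then c else 0) \<le> pmf (map_pmf (map \<eta>) (size_biased_sites (t \<eta>) L \<eta> m)) ns" .
  next
    show "0 \<le> (\<Prod>x\<in>{1..L}. v (\<eta> x)) / Z" for \<eta> :: "nat \<Rightarrow> nat"
      using Zp v by (intro divide_nonneg_pos prod_nonneg) (auto intro: less_imp_le)
  qed
  also have "(\<Sum>\<eta>\<in>configs L N. (\<Sum>xs\<in>D. if map \<eta> xs = ns then c else 0) * ((\<Prod>x\<in>{1..L}. v (\<eta> x)) / Z))
     = (\<Sum>\<eta>\<in>configs L N. \<Sum>xs\<in>D. if map \<eta> xs = ns then c / Z * (\<Prod>x\<in>{1..L}. v (\<eta> x)) else 0)"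
    unfolding sum_distrib_right by (intro sum.cong refl) auto
  \<comment> \<open>For a fixed list of sites the inner sum becomes a partition sum over the
    remaining sites, whose value depends only on their number \<open>L - m\<close>.\<close>
  also have "\<dots> = (\<Sum>xs\<in>D. \<Sum>\<eta>\<in>configs L N. if map \<eta> xs = ns then c / Z * (\<Prod>x\<in>{1..L}. v (\<eta> x)) else 0)"
    by (rule sum.swap)
  also have "\<dots> = (\<Sum>xs\<in>D. c / Z * ((\<Prod>k\<leftarrow>ns. v k) * partition_sum v {1..L - m} (N - sum_list ns)))"
  proof (intro sum.cong refl)
    fix xs assume "xs \<in> D"
    then have xs: "distinct xs" "set xs \<subseteq> {1..L}" "length xs = length ns" using m by (auto simp: D_def)
    have "(\<Sum>\<eta>\<in>configs L N. if map \<eta> xs = ns then c / Z * (\<Prod>x\<in>{1..L}. v (\<eta> x)) else 0)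
      = (\<Sum>\<eta>\<in>{\<eta>\<in>configs L N. map \<eta> xs = ns}. c / Z * (\<Prod>x\<in>{1..L}. v (\<eta> x)))"
      by (rule sum.inter_filter[OF finite_configs, symmetric])
    also have "{\<eta>\<in>configs L N. map \<eta> xs = ns} = {\<eta> \<in> {1..L} \<rightarrow>\<^sub>E UNIV. sum \<eta> {1..L} = N \<and> map \<eta> xs = ns}"
      by (auto simp: conf)
    also have "(\<Sum>\<eta>\<in>\<dots>. c / Z * (\<Prod>x\<in>{1..L}. v (\<eta> x)))
       = c / Z * ((\<Prod>k\<leftarrow>ns. v k) * partition_sum v ({1..L} - set xs) (N - sum_list ns))"
      unfolding sum_distrib_left[symmetric]
      using N by (subst partition_sum_marginal[OF _ xs]) auto
    also have "partition_sum v ({1..L} - set xs) (N - sum_list ns) = partition_sum v {1..L - m} (N - sum_list ns)"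
      using xs m by (intro partition_sum_cong_card) (auto simp: card_Diff_subset distinct_card)
    finally show "(\<Sum>\<eta>\<in>configs L N. if map \<eta> xs = ns then c / Z * (\<Prod>x\<in>{1..L}. v (\<eta> x)) else 0)
      = c / Z * ((\<Prod>k\<leftarrow>ns. v k) * partition_sum v {1..L - m} (N - sum_list ns))" .
  qed
  also have "\<dots> = real (card D) * (c * (\<Prod>k\<leftarrow>ns. v k)) * (partition_sum v {1..L - m} (N - sum_list ns) / Z)"
    by simp
  also have "c * (\<Prod>k\<leftarrow>ns. v k) = (\<Prod>k\<leftarrow>ns. real k * v k / real N)"
    unfolding c_def by (induction ns) (auto simp: mult_ac)
  finally show ?thesis by (simp only: D_def Z_def)
qed

text \<open>The cardinality is the falling factorial of \<open>L\<close>; each induction step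
  contributes the factor \<open>1 - m / L\<close>.\<close>

lemma card_distinct_lists_ratio:
  "(\<lambda>L. real (card {xs. length xs = m \<and> distinct xs \<and> set xs \<subseteq> {1..L}}) / real L ^ m) \<longlonglongrightarrow> 1"
proof (induction m)
  case 0
  have "{xs. length xs = 0 \<and> distinct xs \<and> set xs \<subseteq> {1..L}} = {[]}" for L :: nat by auto
  then show ?case by simp
next
  case (Suc m)
  have inv: "(\<lambda>L. 1 / real L) \<longlonglongrightarrow> 0" by (rule lim_1_over_n)
  have "(\<lambda>L. real (card {xs. length xs = m \<and> distinct xs \<and> set xs \<subseteq> {1..L}}) / real L ^ m * (1 - real m * (1 / real L))) \<longlonglongrightarrow> 1 * (1 - real m * 0)"
    by (intro tendsto_intros Suc inv)
  then have "(\<lambda>L. real (card {xs. length xs = m \<and> distinct xs \<and> set xs \<subseteq> {1..L}}) / real L ^ m * (1 - real m * (1 / real L))) \<longlonglongrightarrow> 1"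
    by simp
  then show ?case
  proof (rule Lim_transform_eventually)
    show "\<forall>\<^sub>F L in sequentially. real (card {xs. length xs = m \<and> distinct xs \<and> set xs \<subseteq> {1..L}}) / real L ^ m * (1 - real m * (1 / real L))
      = real (card {xs. length xs = Suc m \<and> distinct xs \<and> set xs \<subseteq> {1..L}}) / real L ^ Suc m"
      using eventually_ge_at_top[of "Suc m"]
    proof eventually_elim
      case (elim L)
      have c: "card {xs. length xs = k \<and> distinct xs \<and> set xs \<subseteq> {1..L}} = \<Prod>{L - k + 1..L}" if "k \<le> L" for k
        using card_lists_distinct_length_eq[of "{1..L}" k] that by simp
      have "{L - Suc m + 1..L} = insert (L - m) {L - m + 1..L}" using elim by auto
      then have "\<Prod>{L - Suc m + 1..L} = (L - m) * \<Prod>{L - m + 1..L}" by simp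
      then have "card {xs. length xs = Suc m \<and> distinct xs \<and> set xs \<subseteq> {1..L}} = (L - m) * card {xs. length xs = m \<and> distinct xs \<and> set xs \<subseteq> {1..L}}"
        using elim by (simp only: c Suc_leD)
      then show ?case using elim by (simp add: of_nat_diff field_simps)
    qed
  qed
qed

section \<open>Weak convergence on finite products\<close>


text \<open>Continuity of \<open>f\<close> refers to extensional functions only. Composing with
  restriction gives a continuous function on the full function space, where Borel and product
  sigma-algebras agree; extension by 0 then leads back.\<close>

lemma continuous_map_product_imp_measurable:
  fixes f :: "(nat \<Rightarrow> real) \<Rightarrow> real"
  assumes f: "continuous_map (product_topology (\<lambda>_. euclidean) I) euclideanreal f"
  shows "f \<in> borel_measurable (\<Pi>\<^sub>M i\<in>I. borel)"
proof -
  have "continuous_map (product_topology (\<lambda>_. euclidean) UNIV) (product_topology (\<lambda>_. euclidean) I) (\<lambda>y::nat \<Rightarrow> real. restrict y I)"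
    unfolding continuous_map_componentwise
    by (auto intro!: continuous_map_eq[OF continuous_map_product_projection])
  from continuous_map_compose[OF this f]
  have "continuous_on UNIV (f \<circ> (\<lambda>y. restrict y I))"
    by (simp add: euclidean_product_topology)
  then have g: "f \<circ> (\<lambda>y. restrict y I) \<in> borel_measurable (Pi\<^sub>M UNIV (\<lambda>_. borel))"
    by (intro borel_measurable_continuous_onI[THEN measurable_cong_sets[OF sets_PiM_equal_borel refl, THEN equalityD2, THEN subsetD]])
  have e: "(\<lambda>x i. if i \<in> I then x i else 0) \<in> measurable (\<Pi>\<^sub>M i\<in>I. borel) (Pi\<^sub>M UNIV (\<lambda>_::nat. borel :: real measure))"
  proof (rule measurable_PiM_single')
    show "(\<lambda>x. if i \<in> I then x i else 0) \<in> measurable (\<Pi>\<^sub>M i\<in>I. borel) (borel :: real measure)" for i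
      by (cases "i \<in> I") auto
  qed (auto simp: space_PiM)
  have "(\<lambda>x. (f \<circ> (\<lambda>y. restrict y I)) (\<lambda>i. if i \<in> I then x i else 0)) \<in> borel_measurable (\<Pi>\<^sub>M i\<in>I. borel)"
    by (rule measurable_compose[OF e g])
  also have "?this \<longleftrightarrow> ?thesis"
  proof (rule measurable_cong)
    fix x :: "nat \<Rightarrow> real" assume "x \<in> space (\<Pi>\<^sub>M i\<in>I. borel)"
    then have "restrict (\<lambda>i. if i \<in> I then x i else 0) I = x"
      by (auto simp: space_PiM PiE_iff extensional_def fun_eq_iff)
    then show "(f \<circ> (\<lambda>y. restrict y I)) (\<lambda>i. if i \<in> I then x i else 0) = f x" by simp
  qed
  finally show ?thesis .
qed

lemma continuous_map_product_tendsto: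
  fixes f :: "(nat \<Rightarrow> real) \<Rightarrow> real"
  assumes f: "continuous_map (product_topology (\<lambda>_. euclidean) I) euclideanreal f"
    and x: "\<And>n. x n \<in> extensional I" "l \<in> extensional I" "\<And>i. i \<in> I \<Longrightarrow> (\<lambda>n. x n i) \<longlonglongrightarrow> l i"
  shows "(\<lambda>n. f (x n)) \<longlonglongrightarrow> f l"
proof -
  have "limitin (product_topology (\<lambda>_. euclideanreal) I) x l sequentially"
    using x by (auto simp: limitin_componentwise PiE_iff)
  from continuous_map_limit[OF f this] show ?thesis by (simp add: comp_def)
qed

text \<open>Skorohod's theorem realises all one-dimensional laws on one space, hence the products on its power.\<close>

lemma weak_conv_m_imp_product:
  fixes f :: "(nat \<Rightarrow> real) \<Rightarrow> real" and a :: "nat \<Rightarrow> real"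
  assumes \<mu>: "\<And>n. real_distribution (\<mu> n)" and M: "real_distribution M" and conv: "weak_conv_m \<mu> M"
    and a: "a \<longlonglongrightarrow> 1" and I: "finite I"
    and f: "continuous_map (product_topology (\<lambda>_. euclidean) I) euclideanreal f"
    and bound: "\<And>x. x \<in> I \<rightarrow>\<^sub>E UNIV \<Longrightarrow> \<bar>f x\<bar> \<le> B"
  shows "(\<lambda>n. \<integral>x. f x \<partial>(\<Pi>\<^sub>M i\<in>I. distr (\<mu> n) borel (\<lambda>y. a n * y))) \<longlonglongrightarrow> (\<integral>x. f x \<partial>(\<Pi>\<^sub>M i\<in>I. M))"
proof -
  obtain \<Omega> :: "real measure" and X Y where \<Omega>: "prob_space \<Omega>"
    and X: "\<forall>n. X n \<in> borel_measurable \<Omega>" "\<forall>n. distr \<Omega> borel (X n) = \<mu> n"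
    and Y: "Y \<in> measurable \<Omega> lborel" "distr \<Omega> borel Y = M"
    and lim: "\<forall>x\<in>space \<Omega>. (\<lambda>n. X n x) \<longlonglongrightarrow> Y x"
    using Skorohod[OF \<mu> M conv] by blast
  interpret \<Omega>: prob_space \<Omega> by (rule \<Omega>)
  have [measurable]: "X n \<in> borel_measurable \<Omega>" "Y \<in> borel_measurable \<Omega>" for n
    using X Y by (auto simp: measurable_lborel2)
  have fm[measurable]: "f \<in> borel_measurable (\<Pi>\<^sub>M i\<in>I. borel)"
    by (rule continuous_map_product_imp_measurable[OF f])
  have eq: "(\<integral>x. f x \<partial>(\<Pi>\<^sub>M i\<in>I. distr \<Omega> borel Z)) = (\<integral>\<omega>. f (compose I Z \<omega>) \<partial>(\<Pi>\<^sub>M i\<in>I. \<Omega>))"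
    if [measurable]: "Z \<in> borel_measurable \<Omega>" for Z
  proof -
    have "(\<Pi>\<^sub>M i\<in>I. distr \<Omega> borel Z) = (\<Pi>\<^sub>M i\<in>I. distr \<Omega> (distr \<Omega> borel Z) Z)"
      by (intro PiM_cong refl distr_cong) auto
    also have "\<dots> = distr (\<Pi>\<^sub>M i\<in>I. \<Omega>) (\<Pi>\<^sub>M i\<in>I. distr \<Omega> borel Z) (compose I Z)"
      by (intro distr_PiM_finite_prob_space'[symmetric] I \<Omega> \<Omega>.prob_space_distr) auto
    also have "\<dots> = distr (\<Pi>\<^sub>M i\<in>I. \<Omega>) (\<Pi>\<^sub>M i\<in>I. borel) (compose I Z)"
      by (intro distr_cong sets_PiM_cong) auto
    finally have *: "(\<Pi>\<^sub>M i\<in>I. distr \<Omega> borel Z) = distr (\<Pi>\<^sub>M i\<in>I. \<Omega>) (\<Pi>\<^sub>M i\<in>I. borel) (compose I Z)" .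
    have [measurable]: "compose I Z \<in> measurable (\<Pi>\<^sub>M i\<in>I. \<Omega>) (\<Pi>\<^sub>M i\<in>I. borel)"
      unfolding compose_def by measurable
    show ?thesis unfolding * by (subst integral_distr) auto
  qed
  have "(\<Pi>\<^sub>M i\<in>I. distr (\<mu> n) borel (\<lambda>y. a n * y)) = (\<Pi>\<^sub>M i\<in>I. distr \<Omega> borel (\<lambda>\<omega>. a n * X n \<omega>))" for n
    by (intro PiM_cong refl) (simp add: X(2)[rule_format, symmetric] distr_distr comp_def)
  then have 1: "(\<integral>x. f x \<partial>(\<Pi>\<^sub>M i\<in>I. distr (\<mu> n) borel (\<lambda>y. a n * y)))
     = (\<integral>\<omega>. f (compose I (\<lambda>\<omega>. a n * X n \<omega>) \<omega>) \<partial>(\<Pi>\<^sub>M i\<in>I. \<Omega>))" for n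
    by (simp add: eq)
  have 2: "(\<integral>x. f x \<partial>(\<Pi>\<^sub>M i\<in>I. M)) = (\<integral>\<omega>. f (compose I Y \<omega>) \<partial>(\<Pi>\<^sub>M i\<in>I. \<Omega>))"
    unfolding Y(2)[symmetric] by (rule eq) measurable
  interpret P: prob_space "\<Pi>\<^sub>M i\<in>I. \<Omega>" by (rule prob_space_PiM) (rule \<Omega>)
  show ?thesis unfolding 1 2
  proof (rule integral_dominated_convergence[where w = "\<lambda>_. B"])
    show "AE \<omega> in \<Pi>\<^sub>M i\<in>I. \<Omega>. (\<lambda>n. f (compose I (\<lambda>\<omega>. a n * X n \<omega>) \<omega>)) \<longlonglongrightarrow> f (compose I Y \<omega>)"
    proof (intro AE_I2 continuous_map_product_tendsto[OF f])
      fix \<omega> i assume "\<omega> \<in> space (\<Pi>\<^sub>M i\<in>I. \<Omega>)" "i \<in> I"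
      then have "\<omega> i \<in> space \<Omega>" by (auto simp: space_PiM)
      from tendsto_mult[OF a lim[rule_format, OF this]]
      show "(\<lambda>n. compose I (\<lambda>\<omega>. a n * X n \<omega>) \<omega> i) \<longlonglongrightarrow> compose I Y \<omega> i" using \<open>i \<in> I\<close> by (simp add: compose_eq)
    qed (auto simp: compose_def)
    show "AE \<omega> in \<Pi>\<^sub>M i\<in>I. \<Omega>. norm (f (compose I (\<lambda>\<omega>. a n * X n \<omega>) \<omega>)) \<le> B" for n
      by (intro AE_I2) (auto intro!: bound simp: compose_def)
  qed (auto simp: compose_def)
qed

text \<open>With both total masses equal to 1, a minorant on a set of almost full
  \<open>Q\<close>-mass bounds the \<open>P\<close>-mass outside it and the excess inside it. The 6
  is 2 and 1 for the complement of \<open>B\<close> under \<open>P\<close> and \<open>Q\<close>,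
  plus 3 for the difference on \<open>B\<close>.\<close>

lemma integral_close_of_minorant:
  fixes f :: "'a \<Rightarrow> real"
  assumes P: "prob_space P" and Q: "prob_space Q" and sets: "sets P = sets Q"
    and B: "finite B" "\<And>x. x \<in> B \<Longrightarrow> {x} \<in> sets Q"
    and minor: "\<And>x. x \<in> B \<Longrightarrow> (1 - \<epsilon>) * measure Q {x} \<le> measure P {x}"
    and mass: "1 - \<epsilon> \<le> measure Q B" and \<epsilon>: "0 \<le> \<epsilon>" "\<epsilon> \<le> 1"
    and f: "f \<in> borel_measurable Q" "\<And>x. x \<in> space Q \<Longrightarrow> \<bar>f x\<bar> \<le> K"
  shows "\<bar>(\<integral>x. f x \<partial>P) - (\<integral>x. f x \<partial>Q)\<bar> \<le> 6 * K * \<epsilon>"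
proof -
  interpret P: prob_space P by fact
  interpret Q: prob_space Q by fact
  have BQ: "B \<in> sets Q" using B by (metis sets.finite_UN UN_singleton)
  have K: "K \<ge> 0" using Q.not_empty f(2) by (metis abs_ge_zero ex_in_conv order_trans)
  have mB: "measure M B = (\<Sum>x\<in>B. measure M {x})" if "prob_space M" "sets M = sets Q" for M
  proof -
    interpret M: prob_space M by fact
    show ?thesis by (rule M.finite_measure_eq_sum_singleton) (use B that in auto)
  qed
  have split: "\<bar>(\<integral>x. f x \<partial>M) - (\<Sum>x\<in>B. f x * measure M {x})\<bar> \<le> K * (1 - measure M B)"
    if M: "prob_space M" "sets M = sets Q" for M
  proof -
    interpret M: prob_space M by fact
    have spM: "space M = space Q" by (rule sets_eq_imp_space_eq[OF M(2)])
    have fM: "f \<in> borel_measurable M" using f(1) by (simp add: measurable_cong_sets[OF M(2) refl])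
    have BM: "B \<in> sets M" and sM: "\<And>x. x \<in> B \<Longrightarrow> {x} \<in> sets M" using BQ B M by auto
    have i: "integrable M f"
      by (rule M.integrable_const_bound[where B = K]) (use fM f spM in auto)
    have i1: "integrable M (\<lambda>x. indicator {y} x * c)" if "y \<in> B" for y and c :: real
      using sM[OF that] by (intro integrable_mult_left integrable_real_indicator) (auto simp: M.emeasure_eq_measure)
    have "(\<Sum>x\<in>B. f x * measure M {x}) = (\<integral>x. (\<Sum>y\<in>B. indicator {y} x * f y) \<partial>M)"
      using i1 sM by (subst Bochner_Integration.integral_sum) (auto intro!: sum.cong)
    then have "(\<integral>x. f x \<partial>M) - (\<Sum>x\<in>B. f x * measure M {x}) = (\<integral>x. f x - (\<Sum>y\<in>B. indicator {y} x * f y) \<partial>M)"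
      using i i1 by (subst Bochner_Integration.integral_diff) auto
    also have "\<bar>\<dots>\<bar> \<le> (\<integral>x. K * indicator (space M - B) x \<partial>M)"
    proof (rule order_trans[OF integral_abs_bound], rule integral_mono)
      show "integrable M (\<lambda>x. \<bar>f x - (\<Sum>y\<in>B. indicator {y} x * f y)\<bar>)" using i i1 by auto
      show "integrable M (\<lambda>x. K * indicator (space M - B) x)"
        using BM by (intro integrable_mult_right integrable_real_indicator) (auto simp: M.emeasure_eq_measure)
      fix x assume x: "x \<in> space M"
      have "(\<Sum>y\<in>B. indicator {y} x * f y) = (if x \<in> B then f x else 0)"
        using B(1) by (simp add: indicator_def sum.delta' if_distrib[of "\<lambda>z. z * _"] cong: if_cong)
      then show "\<bar>f x - (\<Sum>y\<in>B. indicator {y} x * f y)\<bar> \<le> K * indicator (space M - B) x"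
        using x f(2)[of x] spM by auto
    qed
    also have "\<dots> = K * (1 - measure M B)" using BM by (simp add: M.prob_compl)
    finally show ?thesis .
  qed
  have low: "measure P B \<ge> (1 - \<epsilon>) * measure Q B"
    unfolding mB[OF P sets] mB[OF Q refl] sum_distrib_left by (intro sum_mono minor)
  have "(1 - \<epsilon>) * (1 - \<epsilon>) \<le> (1 - \<epsilon>) * measure Q B" using mass \<epsilon> by (intro mult_left_mono) auto
  then have "(1 - \<epsilon>) * (1 - \<epsilon>) \<le> measure P B" using low by linarith
  moreover have "(1 - \<epsilon>) * (1 - \<epsilon>) = 1 - 2 * \<epsilon> + \<epsilon> * \<epsilon>" by (simp add: algebra_simps)
  ultimately have PB: "measure P B \<ge> 1 - 2 * \<epsilon>" using mult_nonneg_nonneg[OF \<epsilon>(1) \<epsilon>(1)] by linarith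
  \<comment> \<open>The difference at a point is a nonnegative excess over the minorant minus
    \<open>\<epsilon> * measure Q {x}\<close>. Bounding by the sum of the two leaves no absolute
    values, so the total is expressed through the masses of \<open>B\<close>.\<close>
  have "\<bar>(\<Sum>x\<in>B. f x * measure P {x}) - (\<Sum>x\<in>B. f x * measure Q {x})\<bar> \<le> (\<Sum>x\<in>B. K * (measure P {x} - (1 - \<epsilon>) * measure Q {x} + \<epsilon> * measure Q {x}))"
    unfolding sum_subtractf[symmetric]
  proof (rule order_trans[OF sum_abs], rule sum_mono)
    fix x assume x: "x \<in> B"
    then have "x \<in> space Q" using sets.sets_into_space[OF B(2)[OF x]] by auto
    then have "\<bar>f x * measure P {x} - f x * measure Q {x}\<bar> \<le> K * \<bar>measure P {x} - measure Q {x}\<bar>"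
      using f(2)[of x] by (simp add: right_diff_distrib[symmetric] abs_mult mult_right_mono)
    also have "\<bar>measure P {x} - measure Q {x}\<bar> = \<bar>(measure P {x} - (1 - \<epsilon>) * measure Q {x}) - \<epsilon> * measure Q {x}\<bar>"
      by (simp add: algebra_simps)
    also have "\<dots> \<le> measure P {x} - (1 - \<epsilon>) * measure Q {x} + \<epsilon> * measure Q {x}"
    proof -
      have "\<epsilon> * measure Q {x} \<ge> 0" using \<epsilon> by simp
      then show ?thesis using minor[OF x] by linarith
    qed
    finally show "\<bar>f x * measure P {x} - f x * measure Q {x}\<bar> \<le> K * (measure P {x} - (1 - \<epsilon>) * measure Q {x} + \<epsilon> * measure Q {x})"
      using K by (simp add: mult_left_mono)
  qed
  also have "\<dots> = K * (measure P B - (1 - \<epsilon>) * measure Q B + \<epsilon> * measure Q B)"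
    unfolding mB[OF P sets] mB[OF Q refl] by (simp add: sum.distrib sum_subtractf sum_distrib_left algebra_simps)
  also have "\<dots> \<le> K * (3 * \<epsilon>)"
  proof (intro mult_left_mono K)
    have "\<epsilon> * measure Q B \<le> \<epsilon> * 1" using \<epsilon> by (intro mult_left_mono) auto
    then show "measure P B - (1 - \<epsilon>) * measure Q B + \<epsilon> * measure Q B \<le> 3 * \<epsilon>"
      using \<open>(1 - \<epsilon>) * (1 - \<epsilon>) \<le> (1 - \<epsilon>) * measure Q B\<close> \<open>(1 - \<epsilon>) * (1 - \<epsilon>) = _\<close> mult_nonneg_nonneg[OF \<epsilon>(1) \<epsilon>(1)]
        P.prob_le_1[of B] by linarith
  qed
  finally have mid: "\<bar>(\<Sum>x\<in>B. f x * measure P {x}) - (\<Sum>x\<in>B. f x * measure Q {x})\<bar> \<le> K * (3 * \<epsilon>)" .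
  have "K * (1 - measure P B) \<le> K * (2 * \<epsilon>)" "K * (1 - measure Q B) \<le> K * \<epsilon>"
    using PB mass K by (auto intro!: mult_left_mono)
  then have "\<bar>(\<integral>x. f x \<partial>P) - (\<integral>x. f x \<partial>Q)\<bar> \<le> K * (2 * \<epsilon>) + K * (3 * \<epsilon>) + K * \<epsilon>"
    using split[OF P sets] split[OF Q refl] mid by linarith
  then show ?thesis by (simp add: algebra_simps)
qed

section \<open>The zero-Gamma mixture as a probability law\<close>

lemma prob_space_zero_gamma_mixture:
  assumes "a > 0" "0 \<le> p" "p \<le> 1" shows "prob_space (zero_gamma_mixture p a)" and "sets (zero_gamma_mixture p a) = sets borel"
proof -
  interpret G: prob_space "gamma_measure a" by (rule prob_space_gamma_measure[OF assms(1)])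
  have s: "sets (if b then gamma_measure a else return borel 0) = sets borel" for b
    by (cases b) (simp_all add: gamma_measure_def)
  show sets: "sets (zero_gamma_mixture p a) = sets borel"
    unfolding zero_gamma_mixture_def by (rule sets_bind[OF s]) auto
  have "emeasure (zero_gamma_mixture p a) UNIV = ennreal (1 - p) + ennreal p * emeasure (gamma_measure a) UNIV"
    using emeasure_zero_gamma_mixture[OF assms, of UNIV] by simp
  also have "emeasure (gamma_measure a) UNIV = 1"
    using G.emeasure_space_1 by (simp add: gamma_measure_def)
  also have "ennreal (1 - p) + ennreal p * 1 = 1" using assms by (simp add: ennreal_plus[symmetric] del: ennreal_plus)
  finally show "prob_space (zero_gamma_mixture p a)"
    using sets_eq_imp_space_eq[OF sets] by (intro prob_spaceI) simp
qed

lemma integral_zero_gamma_mixture: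
  fixes f :: "real \<Rightarrow> real"
  assumes "a > 0" "0 \<le> p" "p \<le> 1" and f[measurable]: "f \<in> borel_measurable borel" and bound: "\<And>x. \<bar>f x\<bar> \<le> B"
  shows "(\<integral>x. f x \<partial>zero_gamma_mixture p a) = (1 - p) * f 0 +
     p / Gamma a * (\<integral>x. indicator {0<..} x * (x powr (a - 1) * exp (- x)) * f x \<partial>lborel)"
proof -
  let ?N = "\<lambda>b. if b then gamma_measure a else return borel 0"
  have ps: "prob_space (?N b)" for b
    using prob_space_gamma_measure[OF assms(1)] by (auto intro: prob_space_return)
  have N: "?N \<in> measurable (measure_pmf (bernoulli_pmf p)) (subprob_algebra borel)"
    using ps prob_space_imp_subprob_space[OF ps]
    by (auto simp: space_subprob_algebra gamma_measure_def simp del: if_split split: if_split)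
  have "(\<integral>x. f x \<partial>zero_gamma_mixture p a) = (\<integral>b. (\<integral>x. f x \<partial>?N b) \<partial>measure_pmf (bernoulli_pmf p))"
    unfolding zero_gamma_mixture_def
  proof (rule integral_bind[OF f bound N])
    show "AE b in measure_pmf (bernoulli_pmf p). emeasure (?N b) (space (?N b)) \<le> ennreal 1"
      using ps by (intro AE_I2) (simp add: prob_space.emeasure_space_1)
  qed (rule measure_pmf.finite_measure)
  also have "\<dots> = (1 - p) * f 0 + p * (\<integral>x. f x \<partial>gamma_measure a)"
    using assms by (simp add: integral_return)
  also have "(\<integral>x. f x \<partial>gamma_measure a) = (\<integral>x. (indicator {0<..} x * (x powr (a - 1) * exp (- x)) * f x) / Gamma a \<partial>lborel)"
  proof -
    have "(\<integral>x. f x \<partial>gamma_measure a) = (\<integral>x. (if x > 0 then x powr (a - 1) * exp (- x) / Gamma a else 0) *\<^sub>R f x \<partial>lborel)"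
      unfolding gamma_measure_def using Gamma_real_pos[OF assms(1)] by (subst integral_density) auto
    also have "\<dots> = (\<integral>x. (indicator {0<..} x * (x powr (a - 1) * exp (- x)) * f x) / Gamma a \<partial>lborel)"
      by (rule Bochner_Integration.integral_cong) auto
    finally show ?thesis .
  qed
  finally show ?thesis by simp
qed

section \<open>Convergence of the size-biased configuration\<close>


context tilted_condensation
begin

definition q :: "nat \<Rightarrow> nat pmf" where
  "q L = weighted_pmf {..N L} (\<lambda>n. real n * W L n * exp (- s L * real n))"

abbreviation limit_law :: "real measure" where
  "limit_law \<equiv> zero_gamma_mixture ((\<rho> - \<rho>c) / \<rho>) (\<kappa> + 2)"

lemma limit_law: "prob_space limit_law" "sets limit_law = sets borel" "real_distribution limit_law"
proof -
  have "\<kappa> + 2 > 0" "0 \<le> (\<rho> - \<rho>c) / \<rho>" "(\<rho> - \<rho>c) / \<rho> \<le> 1"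
    using \<kappa> \<rho> \<rho>_pos \<rho>c_nonneg by auto
  from prob_space_zero_gamma_mixture[OF this]
  show "prob_space limit_law" "sets limit_law = sets borel" by auto
  then show "real_distribution limit_law"
    by (simp add: real_distribution_def real_distribution_axioms_def)
qed

text \<open>Only eventually true: the total weight is zero when \<open>N L = 0\<close>, and at
  \<open>L = 0\<close> the sign of \<open>W\<close> is not known, so \<open>weighted_pmf\<close>
  need not have its intended value there.\<close>

lemma pmf_q:
  "\<forall>\<^sub>F L in sequentially. T (\<lambda>x. 1) L (s L) > 0 \<and> T (\<lambda>x. 1) L (s L) = real (N L) / real L * P L (s L) \<and> N L > 0 \<and>
    (\<forall>n. pmf (q L) n = (if n \<le> N L then real n * W L n * exp (- s L * real n) / T (\<lambda>x. 1) L (s L) else 0))"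
  using tilt_mean eventually_ge_at_top[of 1] filterlim_at_top[THEN iffD1, OF N_top, rule_format, of 1]
proof eventually_elim
  case (elim L)
  have T: "T (\<lambda>x. 1) L (s L) = (\<Sum>n\<le>N L. real n * W L n * exp (- s L * real n))"
    by (simp add: T_def)
  have pos: "T (\<lambda>x. 1) L (s L) > 0" using elim P_pos[of L "s L"] by simp
  have "pmf (q L) n = (if n \<in> {..N L} then real n * W L n * exp (- s L * real n) / (\<Sum>n\<le>N L. real n * W L n * exp (- s L * real n)) else 0)" for n
    unfolding q_def using less_imp_le[OF W_pos[OF elim(2)]] pos
    by (intro pmf_weighted_pmf) (auto simp: T)
  then show ?case using pos elim by (simp add: T)
qed

lemma integral_q:
  assumes "\<forall>n. pmf (q L) n = (if n \<le> N L then real n * W L n * exp (- s L * real n) / T (\<lambda>x. 1) L (s L) else 0)"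
  shows "(\<integral>n. f (real n) \<partial>measure_pmf (q L)) = (\<Sum>n\<le>N L. real n * W L n * exp (- s L * real n) * f (real n)) / T (\<lambda>x. 1) L (s L)"
proof -
  have "(\<integral>n. f (real n) \<partial>measure_pmf (q L)) = (\<Sum>n\<le>N L. f (real n) * pmf (q L) n)"
    using assms by (intro integral_measure_pmf_real) (auto simp: set_pmf_iff split: if_splits)
  also have "\<dots> = (\<Sum>n\<le>N L. real n * W L n * exp (- s L * real n) * f (real n) / T (\<lambda>x. 1) L (s L))"
    using assms by (intro sum.cong) auto
  finally show ?thesis by (simp add: sum_divide_distrib)
qed

lemma T_one_limit: "(\<lambda>L. T (\<lambda>x. 1) L (s L)) \<longlonglongrightarrow> \<rho>"
  using T_limit[of "\<lambda>x. 1" 1] Gamma_pos by (simp add: J_one)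

text \<open>The expectation of \<open>f (s n)\<close> under \<open>q\<close> is the quotient of
  \<open>T f\<close> and \<open>T 1\<close>. Its limit, bulk part \<open>\<rho>c * f 0\<close> plus
  Gamma part, divided by \<open>\<rho>\<close>, is the integral against the mixture.\<close>

lemma q_weak_conv: "weak_conv_m (\<lambda>L. distr (q L) borel (\<lambda>n. s L * real n)) limit_law"
proof (rule integral_bdd_continuous_conv_imp_weak_conv)
  show "real_distribution (distr (q L) borel (\<lambda>n. s L * real n))" for L
    by (rule prob_space.real_distribution_distr[OF measure_pmf.prob_space_axioms]) simp
  show "real_distribution limit_law" by (rule limit_law)
  fix f :: "real \<Rightarrow> real" assume f: "\<And>x. isCont f x" "\<And>x. \<bar>f x\<bar> \<le> 1"
  have cont: "continuous_on UNIV f" using f by (simp add: continuous_at_imp_continuous_on)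
  then have fm: "f \<in> borel_measurable borel" by (rule borel_measurable_continuous_onI)
  have fb: "\<bar>f x\<bar> \<le> 1 * (1 + x\<^sup>2)" for x using f(2)[of x] by (simp add: add_increasing2)
  have J: "J f = (\<integral>x. indicator {0<..} x * (x powr (\<kappa> + 2 - 1) * exp (- x)) * f x \<partial>lborel)"
    by (simp add: J_def add.commute)
  have "(\<lambda>L. T f L (s L) / T (\<lambda>x. 1) L (s L)) \<longlonglongrightarrow> (\<rho>c * f 0 + (\<rho> - \<rho>c) / Gamma (\<kappa> + 2) * J f) / \<rho>"
    using \<rho>_pos by (intro tendsto_divide T_limit[OF cont fb] T_one_limit) auto
  also have "(\<rho>c * f 0 + (\<rho> - \<rho>c) / Gamma (\<kappa> + 2) * J f) / \<rho> = (\<integral>x. f x \<partial>limit_law)"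
  proof -
    have "\<kappa> + 2 > 0" "0 \<le> (\<rho> - \<rho>c) / \<rho>" "(\<rho> - \<rho>c) / \<rho> \<le> 1"
      using \<kappa> \<rho> \<rho>_pos \<rho>c_nonneg by auto
    from integral_zero_gamma_mixture[OF this fm f(2)] show ?thesis
      unfolding J using \<rho>_pos Gamma_pos by (simp add: field_simps)
  qed
  finally show "(\<lambda>L. \<integral>x. f x \<partial>distr (q L) borel (\<lambda>n. s L * real n)) \<longlonglongrightarrow> (\<integral>x. f x \<partial>limit_law)"
  proof (rule Lim_transform_eventually)
    show "\<forall>\<^sub>F L in sequentially. T f L (s L) / T (\<lambda>x. 1) L (s L) = (\<integral>x. f x \<partial>distr (q L) borel (\<lambda>n. s L * real n))"
      using pmf_q
    proof eventually_elim
      case (elim L)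
      have "(\<integral>x. f x \<partial>distr (q L) borel (\<lambda>n. s L * real n)) = (\<integral>n. f (s L * real n) \<partial>measure_pmf (q L))"
        using fm by (subst integral_distr) auto
      also have "\<dots> = T f L (s L) / T (\<lambda>x. 1) L (s L)"
        unfolding T_def[of f] by (rule integral_q[where f = "\<lambda>x. f (s L * x)"]) (use elim in auto)
      finally show ?case ..
    qed
  qed
qed

text \<open>Changes the scale from \<open>1 / s\<close> to \<open>C\<close>: the two differ by the
  factor \<open>1 / (s C)\<close>, which tends to 1.\<close>

lemma q_product_weak_conv:
  fixes f :: "(nat \<Rightarrow> real) \<Rightarrow> real"
  assumes f: "continuous_map (product_topology (\<lambda>_. euclidean) {..<m}) euclideanreal f"
    and bound: "\<And>x. x \<in> {..<m} \<rightarrow>\<^sub>E UNIV \<Longrightarrow> \<bar>f x\<bar> \<le> B"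
  shows "(\<lambda>L. \<integral>x. f x \<partial>(\<Pi>\<^sub>M i\<in>{..<m}. distr (q L) borel (\<lambda>n. real n / C L))) \<longlonglongrightarrow> (\<integral>x. f x \<partial>(\<Pi>\<^sub>M i\<in>{..<m}. limit_law))"
proof -
  have a: "(\<lambda>L. 1 / (s L * C L)) \<longlonglongrightarrow> 1" using tendsto_divide[OF tendsto_const s_C, of 1] by simp
  have rd: "real_distribution (distr (q L) borel (\<lambda>n. s L * real n))" for L
    by (rule prob_space.real_distribution_distr[OF measure_pmf.prob_space_axioms]) simp
  have "(\<lambda>L. \<integral>x. f x \<partial>(\<Pi>\<^sub>M i\<in>{..<m}. distr (distr (q L) borel (\<lambda>n. s L * real n)) borel (\<lambda>y. 1 / (s L * C L) * y)))
     \<longlonglongrightarrow> (\<integral>x. f x \<partial>(\<Pi>\<^sub>M i\<in>{..<m}. limit_law))"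
    by (rule weak_conv_m_imp_product) (fact rd limit_law(3) q_weak_conv a finite_lessThan f bound)+
  then show ?thesis
  proof (rule Lim_transform_eventually)
    show "\<forall>\<^sub>F L in sequentially. (\<integral>x. f x \<partial>(\<Pi>\<^sub>M i\<in>{..<m}. distr (distr (q L) borel (\<lambda>n. s L * real n)) borel (\<lambda>y. 1 / (s L * C L) * y)))
      = (\<integral>x. f x \<partial>(\<Pi>\<^sub>M i\<in>{..<m}. distr (q L) borel (\<lambda>n. real n / C L)))"
      using s_pos
    proof eventually_elim
      case (elim L)
      then have "distr (distr (q L) borel (\<lambda>n. s L * real n)) borel (\<lambda>y. 1 / (s L * C L) * y) = distr (q L) borel (\<lambda>n. real n / C L)"
        by (simp add: distr_distr comp_def)
      then show ?case by simp
    qed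
  qed
qed

text \<open>Markov's inequality: the mean under \<open>q\<close> is the second moment of the tilted
  law over its first, asymptotically \<open>V / \<rho>\<close> times \<open>C\<close>. The extra 1
  in \<open>b\<close> turns this limit into an eventual bound.\<close>

lemma q_tight:
  assumes \<epsilon>: "\<epsilon> > 0"
  obtains A where "A > 0" "\<forall>\<^sub>F L in sequentially. measure (measure_pmf (q L)) {n. real n \<le> A * C L} \<ge> 1 - \<epsilon>"
proof
  define b where "b = V / \<rho> + 1"
  let ?A = "b / \<epsilon>"
  have b: "b > 0" using V_pos \<rho>_pos by (simp add: b_def add_pos_pos)
  show A: "?A > 0" using b \<epsilon> by simp
  have lim: "(\<lambda>L. ((\<Sum>n\<le>N L. p L n * real n ^ 2) / C L) / (real (N L) / real L)) \<longlonglongrightarrow> V / \<rho>"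
  proof (rule tendsto_divide[OF _ N_density])
    show "(\<lambda>L. (\<Sum>n\<le>N L. p L n * (real n)\<^sup>2) / C L) \<longlonglongrightarrow> V"
      using moment_limit[of 1] by (simp add: V_def power2_eq_square algebra_simps)
  qed (use \<rho>_pos in auto)
  have "V / \<rho> < b" by (simp add: b_def)
  from order_tendstoD(2)[OF lim this]
  show "\<forall>\<^sub>F L in sequentially. measure (measure_pmf (q L)) {n. real n \<le> ?A * C L} \<ge> 1 - \<epsilon>"
    using pmf_q eventually_ge_at_top[of 1]
  proof eventually_elim
    case (elim L)
    have CL: "C L > 0" and L: "L \<ge> 1" and P: "P L (s L) > 0" using elim C_pos P_pos by auto
    have fin: "finite (set_pmf (q L))"
      by (rule finite_subset[of _ "{..N L}"]) (use elim(2) in \<open>auto simp: set_pmf_iff split: if_splits\<close>)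
    have "(\<integral>n. real n \<partial>measure_pmf (q L)) = (\<Sum>n\<le>N L. real n * W L n * exp (- s L * real n) * real n) / T (\<lambda>x. 1) L (s L)"
      by (rule integral_q) (use elim in auto)
    also have "(\<Sum>n\<le>N L. real n * W L n * exp (- s L * real n) * real n) = P L (s L) * (\<Sum>n\<le>N L. p L n * (real n)\<^sup>2)"
      unfolding p_def sum_distrib_left using P by (intro sum.cong) (auto simp: power2_eq_square)
    also have "\<dots> / T (\<lambda>x. 1) L (s L) = (\<Sum>n\<le>N L. p L n * (real n)\<^sup>2) / C L / (real (N L) / real L) * C L"
      using elim P CL L by simp
    also have "\<dots> \<le> b * C L" using elim CL by (intro mult_right_mono) auto
    finally have E: "(\<integral>n. real n \<partial>measure_pmf (q L)) \<le> b * C L" .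
    have AC: "?A * C L > 0" by (rule mult_pos_pos[OF A CL])
    have "measure (measure_pmf (q L)) {n \<in> space (measure_pmf (q L)). real n \<ge> ?A * C L} \<le> (\<integral>n. real n \<partial>measure_pmf (q L)) / (?A * C L)"
      by (rule integral_Markov_inequality_measure[where A = "{}"]) (use AC integrable_measure_pmf_finite[OF fin] in auto)
    also have "\<dots> \<le> b * C L / (?A * C L)"
      using E AC by (intro divide_right_mono) auto
    also have "\<dots> = \<epsilon>" using CL \<epsilon> b by simp
    finally have "measure (measure_pmf (q L)) {n. real n \<ge> ?A * C L} \<le> \<epsilon>" by simp
    then have "1 - \<epsilon> \<le> measure (measure_pmf (q L)) (- {n. real n \<ge> ?A * C L})"
      using measure_pmf.prob_compl[of "{n. real n \<ge> ?A * C L}" "q L"] by (simp add: Compl_eq_Diff_UNIV)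
    also have "\<dots> \<le> measure (measure_pmf (q L)) {n. real n \<le> ?A * C L}"
      by (rule measure_pmf.finite_measure_mono) auto
    finally show ?case .
  qed
qed

text \<open>Three factors are combined: the number of site lists is nearly \<open>L^m\<close>, the
  ratio of tilted partition sums is nearly at least 1, and the remaining single-site factors,
  including those released by undoing the tilt, assemble exactly into the product of the
  \<open>q\<close>-masses.\<close>

lemma pmf_size_biased_ge:
  assumes \<epsilon>: "0 < \<epsilon>" "\<epsilon> < 1" and A: "A \<ge> 0"
  shows "\<forall>\<^sub>F L in sequentially. \<forall>ns. length ns = m \<and> (\<forall>n\<in>set ns. real n \<le> A * C L) \<longrightarrow>
    (1 - \<epsilon>) * (\<Prod>n\<leftarrow>ns. pmf (q L) n) \<le> pmf (map_pmf (take m) (size_biased_pmf (t L) (W L) L (N L))) ns"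
proof -
  define cd where "cd = (\<lambda>L. real (card {xs. length xs = m \<and> distinct xs \<and> set xs \<subseteq> {1..L}}) / real L ^ m)"
  have cd: "cd \<longlonglongrightarrow> 1" unfolding cd_def by (rule card_distinct_lists_ratio)
  have l: "1 - \<epsilon> / 2 < 1" "\<epsilon> / 2 > 0" using \<epsilon> by auto
  have mA: "real m * A \<ge> 0" using A by simp
  show ?thesis
    using pmf_q eventually_ge_at_top[of "max 1 m"] order_tendstoD(1)[OF cd l(1)]
      partition_sum_ratio_ge[OF l(2) mA, of m] filterlim_at_top[THEN iffD1, OF N_over_C, rule_format, of "real m * A + 1"]
  proof eventually_elim
    case (elim L)
    show ?case
    proof (intro allI impI, elim conjE)
      fix ns :: "nat list" assume ns: "length ns = m" "\<forall>n\<in>set ns. real n \<le> A * C L"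
      have L: "L \<ge> 1" "m \<le> L" using elim by auto
      have CL: "C L > 0" and Pp: "P L (s L) > 0" using C_pos P_pos L by auto
      have NL: "N L > 0" and Tq: "T (\<lambda>x. 1) L (s L) = real (N L) / real L * P L (s L)"
        and q: "\<And>n. pmf (q L) n = (if n \<le> N L then real n * W L n * exp (- s L * real n) / T (\<lambda>x. 1) L (s L) else 0)"
        using elim(1) by auto
      have "real (sum_list ns) \<le> real (length ns) * (A * C L)"
        using ns(2) by (induction ns) (auto simp: algebra_simps)
      then have sum: "real (sum_list ns) \<le> real m * A * C L" using ns by simp
      also have "\<dots> < real (N L)"
      proof -
        have "(real m * A + 1) * C L \<le> real (N L)" using elim(5) CL by (simp add: field_simps)
        moreover have "(real m * A + 1) * C L = real m * A * C L + C L" by (simp add: algebra_simps)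
        ultimately show ?thesis using CL by linarith
      qed
      finally have less: "sum_list ns < N L" by simp
      define Rp where "Rp = partition_sum (p L) {1..L - m} (N L - sum_list ns) / partition_sum (p L) {1..L} (N L)"
      have Rp: "1 - \<epsilon> / 2 \<le> Rp" using elim(4) sum by (simp add: Rp_def)
      have ps: "partition_sum (p L) {1..k} n = exp (- s L * real n) * partition_sum (W L) {1..k} n / P L (s L) ^ k" for k n
        unfolding p_def partition_sum_scale partition_sum_tilt by simp
      have ratio: "partition_sum (W L) {1..L - m} (N L - sum_list ns) / partition_sum (W L) {1..L} (N L)
        = Rp * exp (- s L * real (sum_list ns)) / P L (s L) ^ m"
      proof -
        \<comment> \<open>Undoing the tilt in a quotient of partition sums: everything cancels
          except the tilt of the mass on the \<open>m\<close> chosen sites and their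
          \<open>m\<close> normalisations \<open>P\<close>.\<close>
        have alg: "x / y = (e3 * x / u) / (e3 * e2 * y / (u * v)) * e2 / v"
          if "e2 \<noteq> 0" "e3 \<noteq> 0" "u \<noteq> 0" "v \<noteq> 0" for x y e2 e3 u v :: real
          using that by (cases "y = 0") (auto simp: field_simps)
        have PL: "P L (s L) ^ L = P L (s L) ^ (L - m) * P L (s L) ^ m" using L by (simp add: power_add[symmetric])
        have E: "exp (- s L * real (N L)) = exp (- s L * real (N L - sum_list ns)) * exp (- s L * real (sum_list ns))"
          using less by (simp add: exp_add[symmetric] of_nat_diff algebra_simps)
        show ?thesis unfolding Rp_def ps E PL by (rule alg) (use Pp in auto)
      qed
      have "(\<Prod>n\<leftarrow>ns. real n * W L n / real (N L)) * exp (- s L * real (sum_list ns)) / P L (s L) ^ length ns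
        = (\<Prod>n\<leftarrow>ns. pmf (q L) n) / real L ^ length ns"
        using ns(2) less
      proof (induction ns)
        case (Cons n ns)
        then have IH: "(\<Prod>n\<leftarrow>ns. real n * W L n / real (N L)) * exp (- s L * real (sum_list ns)) / P L (s L) ^ length ns
          = (\<Prod>n\<leftarrow>ns. pmf (q L) n) / real L ^ length ns" by auto
        \<comment> \<open>This uses the mean condition of the tilt: the normalisation of
          \<open>q\<close> is \<open>N / L * P\<close>, so the denominator \<open>N\<close> from the
          size-biased choice is exactly what \<open>q\<close> asks for, up to
          \<open>L\<close>.\<close>
        have "real n * W L n / real (N L) * exp (- s L * real n) / P L (s L) = pmf (q L) n / real L"
          using Cons.prems L Pp NL by (simp add: q Tq)
        moreover have "(\<Prod>n\<leftarrow>n # ns. real n * W L n / real (N L)) * exp (- s L * real (sum_list (n # ns))) / P L (s L) ^ length (n # ns)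
          = (real n * W L n / real (N L) * exp (- s L * real n) / P L (s L)) *
            ((\<Prod>n\<leftarrow>ns. real n * W L n / real (N L)) * exp (- s L * real (sum_list ns)) / P L (s L) ^ length ns)"
          by (simp add: exp_add[symmetric] algebra_simps)
        ultimately show ?case unfolding IH by simp
      qed simp
      then have prod: "(\<Prod>n\<leftarrow>ns. real n * W L n / real (N L)) * exp (- s L * real (sum_list ns)) / P L (s L) ^ m
        = (\<Prod>n\<leftarrow>ns. pmf (q L) n) / real L ^ m" using ns by simp
      have pq: "(\<Prod>n\<leftarrow>ns. pmf (q L) n) \<ge> 0" by (induction ns) auto
      have "(1 - \<epsilon>) \<le> (1 - \<epsilon> / 2) * (1 - \<epsilon> / 2)" by (simp add: algebra_simps)
      also have "\<dots> \<le> cd L * Rp" using elim(3) Rp \<epsilon> by (intro mult_mono) auto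
      finally have "(1 - \<epsilon>) * (\<Prod>n\<leftarrow>ns. pmf (q L) n) \<le> cd L * Rp * (\<Prod>n\<leftarrow>ns. pmf (q L) n)"
        using pq by (rule mult_right_mono)
      also have "\<dots> = (cd L * real L ^ m) * Rp * ((\<Prod>n\<leftarrow>ns. pmf (q L) n) / real L ^ m)"
        using L by simp
      also have "\<dots> = real (card {xs. length xs = m \<and> distinct xs \<and> set xs \<subseteq> {1..L}}) *
         (\<Prod>n\<leftarrow>ns. real n * W L n / real (N L)) *
         (partition_sum (W L) {1..L - m} (N L - sum_list ns) / partition_sum (W L) {1..L} (N L))"
        unfolding prod[symmetric] ratio using L by (simp add: cd_def)
      also have "\<dots> \<le> pmf (map_pmf (take m) (size_biased_pmf (t L) (W L) L (N L))) ns"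
        by (rule pmf_take_size_biased_ge) (use L W_pos ns less in auto)
      finally show "(1 - \<epsilon>) * (\<Prod>n\<leftarrow>ns. pmf (q L) n) \<le> pmf (map_pmf (take m) (size_biased_pmf (t L) (W L) L (N L))) ns" .
    qed
  qed
qed

text \<open>Carries the bound on lists over to the product space: the points of the finite box
  \<open>B\<close> correspond to lists with entries at most \<open>A * C L\<close>, so
  \<open>integral_close_of_minorant\<close> applies.\<close>

lemma size_biased_close:
  fixes f :: "(nat \<Rightarrow> real) \<Rightarrow> real"
  assumes f: "f \<in> borel_measurable (\<Pi>\<^sub>M i\<in>{..<m}. borel)" and bound: "\<And>x. x \<in> {..<m} \<rightarrow>\<^sub>E UNIV \<Longrightarrow> \<bar>f x\<bar> \<le> K"
    and \<epsilon>: "0 < \<epsilon>" "\<epsilon> < 1"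
  shows "\<forall>\<^sub>F L in sequentially.
    \<bar>(\<integral>x. f x \<partial>distr (size_biased_pmf (t L) (W L) L (N L)) (\<Pi>\<^sub>M i\<in>{..<m}. borel) (\<lambda>\<zeta>. \<lambda>i\<in>{..<m}. real (\<zeta> ! i) / C L))
     - (\<integral>x. f x \<partial>(\<Pi>\<^sub>M i\<in>{..<m}. distr (q L) borel (\<lambda>n. real n / C L)))\<bar> \<le> 6 * K * \<epsilon>"
proof -
  \<comment> \<open>The error is shared among the coordinates; Bernoulli's inequality then leaves
    the box with product mass at least \<open>1 - \<epsilon>\<close>. \<open>Suc m\<close> instead
    of \<open>m\<close> covers the empty product.\<close>
  have \<epsilon>m: "\<epsilon> / real (Suc m) > 0" using \<epsilon> by simp
  obtain A where A: "A > 0" "\<forall>\<^sub>F L in sequentially. measure (measure_pmf (q L)) {n. real n \<le> A * C L} \<ge> 1 - \<epsilon> / real (Suc m)"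
    using q_tight[OF \<epsilon>m] by blast
  have A0: "A \<ge> 0" using A by simp
  show ?thesis
    using A(2) pmf_size_biased_ge[OF \<epsilon> A0, of m t] eventually_ge_at_top[of 1]
  proof eventually_elim
    case (elim L)
    have CL: "C L > 0" using elim C_pos by simp
    define S where "S = {n. real n \<le> A * C L}"
    define D where "D = distr (q L) borel (\<lambda>n. real n / C L)"
    define Q where "Q = (\<Pi>\<^sub>M i\<in>{..<m}. D)"
    define R where "R = size_biased_pmf (t L) (W L) L (N L)"
    define F where "F = (\<lambda>\<zeta>::nat list. \<lambda>i\<in>{..<m}. real (\<zeta> ! i) / C L)"
    define Pm where "Pm = distr R (\<Pi>\<^sub>M i\<in>{..<m}. borel) F"
    define B where "B = {..<m} \<rightarrow>\<^sub>E (\<lambda>n. real n / C L) ` S"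
    have finS: "finite S"
    proof (rule finite_subset)
      show "S \<subseteq> {..nat \<lceil>A * C L\<rceil>}" by (auto simp: S_def) linarith
    qed simp
    have D: "prob_space D" unfolding D_def by (rule measure_pmf.prob_space_distr) simp
    have sD: "sets D = sets borel" by (simp add: D_def)
    interpret D: product_prob_space "\<lambda>_. D" "{..<m}" by (rule product_prob_spaceI[OF D])
    have mD: "measure D {real n / C L} = pmf (q L) n" for n
    proof -
      have "(\<lambda>n. real n / C L) -` {real n / C L} = {n}" using CL by auto
      then show ?thesis by (simp add: D_def measure_distr pmf.rep_eq)
    qed
    have mS: "measure D ((\<lambda>n. real n / C L) ` S) = measure (measure_pmf (q L)) S"
    proof -
      have "inj (\<lambda>n::nat. real n / C L)" using CL by (auto simp: inj_def)
      then have "(\<lambda>n. real n / C L) -` ((\<lambda>n. real n / C L) ` S) = S" by (rule inj_vimage_image_eq)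
      moreover have "(\<lambda>n. real n / C L) ` S \<in> sets borel" using finS by (intro finite_imp_closed borel_closed) auto
      ultimately show ?thesis by (simp add: D_def measure_distr)
    qed
    have box: "measure Q (PiE {..<m} X) = (\<Prod>i<m. measure D (X i))" if "\<And>i. i < m \<Longrightarrow> X i \<in> sets borel" for X
    proof -
      have "emeasure Q (PiE {..<m} X) = (\<Prod>i<m. emeasure D (X i))"
        unfolding Q_def using that sD by (intro D.emeasure_PiM) auto
      also have "\<dots> = ennreal (\<Prod>i<m. measure D (X i))"
        by (simp add: finite_measure.emeasure_eq_measure[OF prob_space.finite_measure[OF D]] prod_ennreal)
      finally have "emeasure Q (PiE {..<m} X) = ennreal (\<Prod>i<m. measure D (X i))" .
      then show ?thesis unfolding measure_def[of Q] by (simp add: prod_nonneg)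
    qed
    have Q: "prob_space Q" unfolding Q_def by (rule prob_space_PiM) (rule D)
    have sQ: "sets Q = sets (\<Pi>\<^sub>M i\<in>{..<m}. (borel :: real measure))" unfolding Q_def by (rule sets_PiM_cong) (auto simp: sD)
    have F: "F \<in> measurable R (\<Pi>\<^sub>M i\<in>{..<m}. borel)" by (auto simp: F_def space_PiM)
    have P: "prob_space Pm" unfolding Pm_def by (rule measure_pmf.prob_space_distr[OF F])
    have sing: "{x} \<in> sets Q" and sing_eq: "{x} = PiE {..<m} (\<lambda>i. {x i})" if "x \<in> {..<m} \<rightarrow>\<^sub>E UNIV" for x
    proof -
      show e: "{x} = PiE {..<m} (\<lambda>i. {x i})" using that by (intro PiE_singleton[symmetric]) (simp add: PiE_iff)
      show "{x} \<in> sets Q" unfolding sQ e by (rule sets_PiM_I_finite) auto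
    qed
    have BU: "B \<subseteq> {..<m} \<rightarrow>\<^sub>E UNIV" unfolding B_def by (intro PiE_mono) auto
    have "\<bar>(\<integral>x. f x \<partial>Pm) - (\<integral>x. f x \<partial>Q)\<bar> \<le> 6 * K * \<epsilon>"
    proof (rule integral_close_of_minorant[OF P Q])
      show "sets Pm = sets Q" by (simp add: Pm_def sQ)
      show "finite B" unfolding B_def using finS by (intro finite_PiE) auto
      show "{x} \<in> sets Q" if "x \<in> B" for x using sing that BU by auto
      show "(1 - \<epsilon>) * measure Q {x} \<le> measure Pm {x}" if x: "x \<in> B" for x
      proof -
        have "\<forall>i<m. \<exists>n\<in>S. x i = real n / C L" using x by (auto simp: B_def PiE_iff)
        then obtain k where k: "\<And>i. i < m \<Longrightarrow> k i \<in> S" "\<And>i. i < m \<Longrightarrow> x i = real (k i) / C L" by metis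
        define ns where "ns = map k [0..<m]"
        have ns: "length ns = m" "\<forall>n\<in>set ns. real n \<le> A * C L" using k(1) by (auto simp: ns_def S_def)
        have xU: "x \<in> {..<m} \<rightarrow>\<^sub>E UNIV" using x BU by auto
        have "measure Q {x} = (\<Prod>i<m. measure D {x i})"
          by (subst sing_eq[OF xU], rule box) auto
        also have "\<dots> = (\<Prod>i<m. pmf (q L) (k i))" by (intro prod.cong) (auto simp: k mD)
        also have "\<dots> = (\<Prod>n\<leftarrow>ns. pmf (q L) n)"
          by (simp add: ns_def prod.list_conv_set_nth atLeast0LessThan)
        finally have "(1 - \<epsilon>) * measure Q {x} \<le> pmf (map_pmf (take m) R) ns"
          using elim(2) ns by (simp add: R_def)
        also have "\<dots> = measure R (take m -` {ns})" by (simp add: pmf_map)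
        \<comment> \<open>\<open>F\<close> reads only the first \<open>m\<close> entries, so
          prescribing them determines its value; inclusion is enough for a lower bound.\<close>
        also have "\<dots> \<le> measure R (F -` {x})"
        proof (rule measure_pmf.finite_measure_mono)
          show "take m -` {ns} \<subseteq> F -` {x}"
          proof
            fix \<zeta> assume "\<zeta> \<in> take m -` {ns}"
            then have "take m \<zeta> = ns" by simp
            then have "\<zeta> ! i = k i" if "i < m" for i
              using that nth_take[of i m \<zeta>] by (simp add: ns_def)
            then have "F \<zeta> = x" using k(2) xU
              by (auto simp: F_def fun_eq_iff PiE_iff extensional_def)
            then show "\<zeta> \<in> F -` {x}" by simp
          qed
        qed simp
        also have "\<dots> = measure Pm {x}"
          using sing[OF xU] sQ by (simp add: Pm_def measure_distr[OF F])
        finally show ?thesis .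
      qed
      show "1 - \<epsilon> \<le> measure Q B"
      proof -
        have "1 - \<epsilon> \<le> 1 + real m * (- (\<epsilon> / real (Suc m)))" using \<epsilon> by (simp add: field_simps)
        also have "\<dots> \<le> (1 + - (\<epsilon> / real (Suc m))) ^ m"
          by (rule Bernoulli_inequality) (use \<epsilon> in \<open>simp add: field_simps\<close>)
        also have "\<dots> \<le> measure (measure_pmf (q L)) S ^ m"
          using elim(1) \<epsilon> by (intro power_mono) (auto simp: S_def field_simps)
        also have "\<dots> = measure Q B"
          unfolding B_def using finS by (subst box) (auto simp: mS intro!: finite_imp_closed borel_closed)
        finally show ?thesis .
      qed
      show "f \<in> borel_measurable Q" using f by (simp add: measurable_cong_sets[OF sQ refl])
      show "\<bar>f x\<bar> \<le> K" if "x \<in> space Q" for x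
        using bound[of x] that sets_eq_imp_space_eq[OF sQ] by (auto simp: space_PiM)
    qed (use \<epsilon> in auto)
    then show ?case by (simp add: Pm_def Q_def D_def R_def F_def)
  qed
qed

lemma size_biased_weak_conv_prod:
  "weak_conv_prod {..<m}
    (\<lambda>L. distr (size_biased_pmf (t L) (W L) L (N L)) (\<Pi>\<^sub>M i\<in>{..<m}. borel) (\<lambda>\<zeta>. \<lambda>i\<in>{..<m}. real (\<zeta> ! i) / C L))
    (\<Pi>\<^sub>M i\<in>{..<m}. limit_law)"
  unfolding weak_conv_prod_def
proof (intro allI impI)
  fix f :: "(nat \<Rightarrow> real) \<Rightarrow> real"
  assume f: "continuous_map (product_topology (\<lambda>_. euclidean) {..<m}) euclideanreal f"
    and "bounded (f ` ({..<m} \<rightarrow>\<^sub>E UNIV))"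
  then obtain K where K: "\<And>x. x \<in> {..<m} \<rightarrow>\<^sub>E UNIV \<Longrightarrow> \<bar>f x\<bar> \<le> K"
    by (auto simp: bounded_iff)
  have fm: "f \<in> borel_measurable (\<Pi>\<^sub>M i\<in>{..<m}. borel)" by (rule continuous_map_product_imp_measurable[OF f])
  define EP where "EP = (\<lambda>L. \<integral>x. f x \<partial>distr (size_biased_pmf (t L) (W L) L (N L)) (\<Pi>\<^sub>M i\<in>{..<m}. borel) (\<lambda>\<zeta>. \<lambda>i\<in>{..<m}. real (\<zeta> ! i) / C L))"
  define EQ where "EQ = (\<lambda>L. \<integral>x. f x \<partial>(\<Pi>\<^sub>M i\<in>{..<m}. distr (q L) borel (\<lambda>n. real n / C L)))"
  have K0: "K \<ge> 0" using K[of "\<lambda>i\<in>{..<m}. 0"] by auto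
  have "(\<lambda>L. EP L - EQ L) \<longlonglongrightarrow> 0"
  proof (rule tendstoI)
    fix e :: real assume e: "e > 0"
    \<comment> \<open>Chosen so that \<open>6 * K * \<epsilon>\<close> is at most
      \<open>e / 2\<close>; \<open>K + 1\<close> guards against \<open>K = 0\<close>, and
      \<open>1 / 2\<close> keeps \<open>\<epsilon>\<close> below 1.\<close>
    define \<epsilon> where "\<epsilon> = min (1 / 2) (e / (12 * (K + 1)))"
    have \<epsilon>: "0 < \<epsilon>" "\<epsilon> < 1" using e K0 by (auto simp: \<epsilon>_def)
    have "6 * K * \<epsilon> \<le> 6 * (K + 1) * (e / (12 * (K + 1)))"
      using K0 e \<epsilon> by (intro mult_mono) (auto simp: \<epsilon>_def)
    also have "\<dots> = e / 2" using K0 by (auto simp: divide_simps)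
    also have "\<dots> < e" using e by simp
    finally have small: "6 * K * \<epsilon> < e" .
    have "\<forall>\<^sub>F L in sequentially. \<bar>EP L - EQ L\<bar> \<le> 6 * K * \<epsilon>"
      unfolding EP_def EQ_def by (rule size_biased_close[OF fm K \<epsilon>])
    then show "\<forall>\<^sub>F L in sequentially. dist (EP L - EQ L) 0 < e"
      by eventually_elim (use small in simp)
  qed
  moreover have "EQ \<longlonglongrightarrow> (\<integral>x. f x \<partial>(\<Pi>\<^sub>M i\<in>{..<m}. limit_law))"
    unfolding EQ_def by (rule q_product_weak_conv[OF f K])
  ultimately have "(\<lambda>L. (EP L - EQ L) + EQ L) \<longlonglongrightarrow> 0 + (\<integral>x. f x \<partial>(\<Pi>\<^sub>M i\<in>{..<m}. limit_law))"
    by (rule tendsto_add)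
  then show "EP \<longlonglongrightarrow> (\<integral>x. f x \<partial>(\<Pi>\<^sub>M i\<in>{..<m}. limit_law))" by simp
qed

text \<open>The product statement for one coordinate, tested on functions that factor through the
  projection; convergence of bounded continuous integrals then gives convergence of distribution
  functions.\<close>

lemma size_biased_weak_conv:
  "weak_conv_m (\<lambda>L. distr (size_biased_pmf (t L) (W L) L (N L)) borel (\<lambda>\<zeta>. real (\<zeta> ! 0) / C L)) limit_law"
proof (rule integral_bdd_continuous_conv_imp_weak_conv)
  show "real_distribution (distr (size_biased_pmf (t L) (W L) L (N L)) borel (\<lambda>\<zeta>. real (\<zeta> ! 0) / C L))" for L
    by (rule prob_space.real_distribution_distr[OF measure_pmf.prob_space_axioms]) simp
  show "real_distribution limit_law" by (rule limit_law)
  fix f :: "real \<Rightarrow> real" assume f: "\<And>x. isCont f x" "\<And>x. \<bar>f x\<bar> \<le> 1"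
  let ?I = "{..<1::nat}"
  have cont: "continuous_on UNIV f" using f by (simp add: continuous_at_imp_continuous_on)
  then have fm[measurable]: "f \<in> borel_measurable borel" by (rule borel_measurable_continuous_onI)
  have "continuous_map (product_topology (\<lambda>_. euclidean) ?I) euclideanreal (f \<circ> (\<lambda>x. x 0))"
    by (rule continuous_map_compose[OF continuous_map_product_projection])
       (use cont in auto)
  moreover have "bounded ((f \<circ> (\<lambda>x. x 0)) ` (?I \<rightarrow>\<^sub>E UNIV))"
    using f(2) by (auto simp: bounded_iff intro!: exI[of _ 1])
  ultimately have conv: "(\<lambda>L. \<integral>x. (f \<circ> (\<lambda>x. x 0)) x \<partial>distr (size_biased_pmf (t L) (W L) L (N L)) (\<Pi>\<^sub>M i\<in>?I. borel) (\<lambda>\<zeta>. \<lambda>i\<in>?I. real (\<zeta> ! i) / C L))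
     \<longlonglongrightarrow> (\<integral>x. (f \<circ> (\<lambda>x. x 0)) x \<partial>(\<Pi>\<^sub>M i\<in>?I. limit_law))"
    using size_biased_weak_conv_prod[of 1 t] unfolding weak_conv_prod_def by blast
  have 1: "(\<integral>x. (f \<circ> (\<lambda>x. x 0)) x \<partial>distr (size_biased_pmf (t L) (W L) L (N L)) (\<Pi>\<^sub>M i\<in>?I. borel) (\<lambda>\<zeta>. \<lambda>i\<in>?I. real (\<zeta> ! i) / C L))
    = (\<integral>x. f x \<partial>distr (size_biased_pmf (t L) (W L) L (N L)) borel (\<lambda>\<zeta>. real (\<zeta> ! 0) / C L))" for L
    by (subst (1 2) integral_distr) (auto simp: space_PiM)
  have "(\<integral>x. f x \<partial>limit_law) = (\<integral>x. f x \<partial>distr (\<Pi>\<^sub>M i\<in>?I. limit_law) limit_law (\<lambda>x. x 0))"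
    by (subst distr_PiM_component) (auto simp: limit_law)
  also have "\<dots> = (\<integral>x. (f \<circ> (\<lambda>x. x 0)) x \<partial>(\<Pi>\<^sub>M i\<in>?I. limit_law))"
    using fm by (subst integral_distr) (auto simp: measurable_cong_sets[OF limit_law(2) refl] comp_def)
  finally show "(\<lambda>L. \<integral>x. f x \<partial>distr (size_biased_pmf (t L) (W L) L (N L)) borel (\<lambda>\<zeta>. real (\<zeta> ! 0) / C L)) \<longlonglongrightarrow> (\<integral>x. f x \<partial>limit_law)"
    using conv unfolding 1 by simp
qed

end

theorem theorem2:
  fixes w :: "nat \<Rightarrow> real"
    and W \<delta> :: "nat \<Rightarrow> nat \<Rightarrow> real"
    and \<theta> \<gamma> \<kappa> \<rho> \<rho>c :: real
    and \<phi>b :: ereal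
    and N :: "nat \<Rightarrow> nat"
    and t :: "nat \<Rightarrow> (nat \<Rightarrow> nat) \<Rightarrow> nat list \<Rightarrow> nat pmf"
  assumes "\<theta> > 0" and "\<gamma> > 0" and "\<kappa> > -1"
    and W_pos: "\<And>L n. L \<ge> 1 \<Longrightarrow> W L n > 0"
    and W_eq: "\<And>L n. L \<ge> 1 \<Longrightarrow>
      W L n = w n + \<theta> / real L powr \<gamma> * (real n + 1) powr \<kappa> * (1 + \<delta> L n)"
    and w_nonneg: "\<And>n. w n \<ge> 0"
    and "\<phi>b > 1"
    and "\<And>\<phi>. \<phi> \<ge> 0 \<Longrightarrow> summable (\<lambda>n. w n * \<phi> ^ n) \<longleftrightarrow> ereal \<phi> < \<phi>b"
    and "w sums 1"
    and "(\<lambda>n. real n * w n) sums \<rho>c"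
    and "\<kappa> + 2 > max \<gamma> 1"
    and "filterlim N at_top sequentially"
    and "(\<lambda>L. real (N L) / real L) \<longlonglongrightarrow> \<rho>"
    and "\<rho> > \<rho>c"
    and "(\<lambda>L. real L * (SUP n\<in>{..N L}. \<bar>\<delta> L n\<bar>)) \<longlonglongrightarrow> 0"
    and "\<And>L \<eta>. admissible_rule L (t L \<eta>)"
  shows "(\<lambda>L. cluster_scale \<theta> \<gamma> \<kappa> \<rho> \<rho>c L / real L) \<longlonglongrightarrow> 0 \<and>
    weak_conv_m
      (\<lambda>L. distr (size_biased_pmf (t L) (W L) L (N L)) borel
             (\<lambda>\<zeta>. real (\<zeta> ! 0) / cluster_scale \<theta> \<gamma> \<kappa> \<rho> \<rho>c L))
      (zero_gamma_mixture ((\<rho> - \<rho>c) / \<rho>) (\<kappa> + 2)) \<and>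
    (\<forall>m. weak_conv_prod {..<m}
      (\<lambda>L. distr (size_biased_pmf (t L) (W L) L (N L)) (\<Pi>\<^sub>M i\<in>{..<m}. borel)
             (\<lambda>\<zeta>. \<lambda>i\<in>{..<m}. real (\<zeta> ! i) / cluster_scale \<theta> \<gamma> \<kappa> \<rho> \<rho>c L))
      (\<Pi>\<^sub>M i\<in>{..<m}. zero_gamma_mixture ((\<rho> - \<rho>c) / \<rho>) (\<kappa> + 2)))"
proof -
  interpret condensation w W \<delta> \<theta> \<gamma> \<kappa> \<rho> \<rho>c N
    by unfold_locales (use assms in auto)
  obtain s where s: "(\<lambda>L. s L * C L) \<longlonglongrightarrow> 1"
    "\<forall>\<^sub>F L in sequentially. T (\<lambda>x. 1) L (s L) = real (N L) / real L * P L (s L)"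
    using tilt_exists by blast
  interpret tilted_condensation w W \<delta> \<theta> \<gamma> \<kappa> \<rho> \<rho>c N s
    by unfold_locales (fact s)+
  show ?thesis
    using C_over_L size_biased_weak_conv[of t] size_biased_weak_conv_prod[of _ t]
    unfolding C_def by blast
qed

end
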